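(* Let $d\ge 1$ be an integer, let $\alpha>d$, and let $(W_x)_{x\in\mathbb{Z}^d}$ be i.i.d. non-negative random variables, distributed as $W$ with distribution function $F$, such that for some $c>0$ and $\tau>1$ $$1-F(w)\le c\,w^{-(\tau-1)}\quad\text{for all } w>0,\qquad\text{and}\qquad \gamma:=\alpha(\tau-1)/d>1.$$ Let $\lambda_c$ be the critical percolation value of the random graph with edge probabilities $p_{xy}=1-\exp\{-\lambda W_xW_y/|x-y|^{\alpha}\}$. Then: (a) If $d\ge 2$ and $\mathbb{P}(W=0)<1$, then $\lambda_c<\infty$. (b) If $d=1$, $\alpha\in(1,2]$ and $\mathbb{P}(W\ge w)=1$ for some $w>0$, then $\lambda_c<\infty$. (c) If $d=1$, $\alpha>2$ and the tail bound above holds for some $c>0$ and $\tau>1$ with $\gamma=\alpha(\tau-1)/d>2$, then $\lambda_c=\infty$.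
   Context: For $\lambda>0$, the random graph has vertex set $\mathbb{Z}^d$; conditionally on the weights $(W_x)_{x\in\mathbb{Z}^d}$, the edges between distinct vertices $x,y$ are independently present (occupied) with probability $p_{xy}=1-\exp\{-\lambda W_xW_y/|x-y|^{\alpha}\}$, where $|\cdot|$ is the Euclidean norm. The component $\mathcal{C}(0)$ is the set of vertices connected to $0$ by a path of occupied edges. The percolation probability is $\theta(\lambda)=\mathbb{P}(|\mathcal{C}(0)|=\infty)$, and the critical percolation value is $\lambda_c=\inf\{\lambda>0:\theta(\lambda)>0\}$, with $\inf\emptyset=\infty$; here $\alpha$ and the weight distribution are fixed. Standing normalization: if the weights have finite mean, they are normalized so that $\mathbb{E}[W]=1$ (for non-degenerate weights this amounts only to rescaling $\lambda$). *)

theory Defs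
  imports "HOL-Probability.Probability"
begin

definition lattice_dist :: "int ^ 'd \<Rightarrow> int ^ 'd \<Rightarrow> real" where
  "lattice_dist x y = norm ((\<chi> i. real_of_int (x $ i - y $ i)) :: real ^ 'd)"

definition conn_prob ::
  "real \<Rightarrow> real \<Rightarrow> (int ^ 'd \<Rightarrow> real) \<Rightarrow> int ^ 'd \<Rightarrow> int ^ 'd \<Rightarrow> real" where
  "conn_prob \<alpha> lam w x y = 1 - exp (- (lam * w x * w y / lattice_dist x y powr \<alpha>))"

text \<open>An edge is an unordered pair of distinct vertices, encoded as a two-element set.\<close>

definition edges :: "(int ^ 'd) set set" where
  "edges = {{x, y} |x y. x \<noteq> y}"

text \<open>Well defined because \<open>conn_prob\<close> is symmetric in the vertices; see \<open>edge_prob_doubleton\<close>.\<close>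

definition edge_prob :: "real \<Rightarrow> real \<Rightarrow> (int ^ 'd \<Rightarrow> real) \<Rightarrow> (int ^ 'd) set \<Rightarrow> real" where
  "edge_prob \<alpha> lam w e = (THE p. \<exists>x y. e = {x, y} \<and> p = conn_prob \<alpha> lam w x y)"

text \<open>The conditional law of the edge configuration given that the weights are \<open>w\<close>.
  A configuration \<open>\<eta>\<close> maps each edge to \<open>True\<close> (occupied) or \<open>False\<close> (vacant).\<close>

definition edge_law ::
  "real \<Rightarrow> real \<Rightarrow> (int ^ 'd \<Rightarrow> real) \<Rightarrow> ((int ^ 'd) set \<Rightarrow> bool) measure" where
  "edge_law \<alpha> lam w = (\<Pi>\<^sub>M e\<in>edges. measure_pmf (bernoulli_pmf (edge_prob \<alpha> lam w e)))"

text \<open>The unconditional law of the edge configuration, for random weights \<open>W\<close> on the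
  probability space \<open>M\<close>: the mixture of the conditional laws. That the mixing kernel is
  measurable, as \<open>bind\<close> requires, is \<open>measurable_edge_law\<close> below.\<close>

definition graph_law ::
  "'a measure \<Rightarrow> (int ^ 'd \<Rightarrow> 'a \<Rightarrow> real) \<Rightarrow> real \<Rightarrow> real \<Rightarrow> ((int ^ 'd) set \<Rightarrow> bool) measure" where
  "graph_law M W \<alpha> lam = M \<bind> (\<lambda>\<omega>. edge_law \<alpha> lam (\<lambda>x. W x \<omega>))"

definition cluster :: "((int ^ 'd) set \<Rightarrow> bool) \<Rightarrow> int ^ 'd \<Rightarrow> (int ^ 'd) set" where
  "cluster \<eta> x = {y. (\<lambda>u v. u \<noteq> v \<and> \<eta> {u, v})\<^sup>*\<^sup>* x y}"

definition percolation_prob ::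
  "'a measure \<Rightarrow> (int ^ 'd \<Rightarrow> 'a \<Rightarrow> real) \<Rightarrow> real \<Rightarrow> real \<Rightarrow> real" where
  "percolation_prob M W \<alpha> lam =
     measure (graph_law M W \<alpha> lam) {\<eta> \<in> space (graph_law M W \<alpha> lam). infinite (cluster \<eta> 0)}"

text \<open>Taken in \<^typ>\<open>ereal\<close>, where the infimum of the empty set is \<open>\<infinity>\<close>.\<close>

definition critical_value :: "'a measure \<Rightarrow> (int ^ 'd \<Rightarrow> 'a \<Rightarrow> real) \<Rightarrow> real \<Rightarrow> ereal" where
  "critical_value M W \<alpha> = Inf {ereal lam |lam. lam > 0 \<and> percolation_prob M W \<alpha> lam > 0}"

definition tail_bound :: "(real \<Rightarrow> real) \<Rightarrow> real \<Rightarrow> real \<Rightarrow> bool" where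
  "tail_bound F c \<tau> \<longleftrightarrow> (\<forall>w>0. 1 - F w \<le> c * w powr (- (\<tau> - 1)))"

lemma lattice_dist_commute: "lattice_dist x y = lattice_dist y x"
  unfolding lattice_dist_def norm_vec_def by (simp add: abs_minus_commute)

lemma conn_prob_commute: "conn_prob \<alpha> lam w x y = conn_prob \<alpha> lam w y x"
  unfolding conn_prob_def by (simp add: lattice_dist_commute mult_ac)

lemma edge_prob_doubleton: "edge_prob \<alpha> lam w {x, y} = conn_prob \<alpha> lam w x y"
  unfolding edge_prob_def
  by (rule the_equality) (auto simp: doubleton_eq_iff conn_prob_commute)

lemma conn_prob_bounds:
  assumes "lam \<ge> 0" "w x \<ge> 0" "w y \<ge> 0"
  shows "0 \<le> conn_prob \<alpha> lam w x y" "conn_prob \<alpha> lam w x y < 1"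
  using assms by (auto simp: conn_prob_def)

lemma prob_space_edge_law: "prob_space (edge_law \<alpha> lam w)"
  unfolding edge_law_def by (intro prob_space_PiM measure_pmf.prob_space_axioms)

lemma sets_edge_law: "sets (edge_law \<alpha> lam w) = sets (\<Pi>\<^sub>M e\<in>edges. count_space UNIV)"
  unfolding edge_law_def by (intro sets_PiM_cong) auto

lemma measurable_edge_law:
  fixes W :: "int ^ 'd \<Rightarrow> 'a \<Rightarrow> real"
  assumes "\<And>x. W x \<in> borel_measurable M"
  shows "(\<lambda>\<omega>. edge_law \<alpha> lam (\<lambda>x. W x \<omega>)) \<in> measurable M (prob_algebra (\<Pi>\<^sub>M e\<in>edges. count_space UNIV))"
proof (rule measurable_prob_algebra_generated[OF sets_PiM Int_stable_prod_algebra prod_algebra_sets_into_space])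
  show "prob_space (edge_law \<alpha> lam (\<lambda>x. W x \<omega>))" for \<omega>
    by (rule prob_space_edge_law)
  show "sets (edge_law \<alpha> lam (\<lambda>x. W x \<omega>)) = sets (\<Pi>\<^sub>M e\<in>edges. count_space UNIV)" for \<omega>
    by (rule sets_edge_law)
  fix A :: "((int ^ 'd) set \<Rightarrow> bool) set"
  assume "A \<in> prod_algebra edges (\<lambda>e. count_space UNIV)"
  then obtain J E where A: "A = prod_emb edges (\<lambda>e. count_space UNIV) J (Pi\<^sub>E J E)"
    and J: "finite J" "J \<subseteq> edges"
    by (auto simp: prod_algebra_def)
  have bern: "(\<lambda>\<omega>. emeasure (measure_pmf (bernoulli_pmf (edge_prob \<alpha> lam (\<lambda>x. W x \<omega>) e))) B)
      \<in> borel_measurable M" if e: "e \<in> edges" for e and B :: "bool set"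
  proof -
    obtain x y where e: "e = {x, y}" using e by (auto simp: edges_def)
    have p: "(\<lambda>\<omega>. conn_prob \<alpha> lam (\<lambda>x. W x \<omega>) x y) \<in> borel_measurable M"
      unfolding conn_prob_def using assms by measurable
    have "emeasure (measure_pmf (bernoulli_pmf q)) B =
        ennreal ((if True \<in> B then min 1 (max 0 q) else 0) +
          (if False \<in> B then 1 - min 1 (max 0 q) else 0))" for q
    proof -
      have "measure (measure_pmf (bernoulli_pmf q)) B = (\<Sum>b\<in>B. pmf (bernoulli_pmf q) b)"
        by (rule measure_measure_pmf_finite) simp
      also have "\<dots> = (\<Sum>b\<in>UNIV. if b \<in> B then pmf (bernoulli_pmf q) b else 0)"
        by (simp add: sum.If_cases)
      also have "\<dots> = (if True \<in> B then min 1 (max 0 q) else 0) +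
          (if False \<in> B then 1 - min 1 (max 0 q) else 0)"
        unfolding UNIV_bool by (simp add: bernoulli_pmf.rep_eq)
      finally show ?thesis by (simp add: measure_pmf.emeasure_eq_measure)
    qed
    with p show ?thesis unfolding e edge_prob_doubleton by simp
  qed
  have "emeasure (edge_law \<alpha> lam (\<lambda>x. W x \<omega>)) A =
      (\<Prod>e\<in>J. emeasure (measure_pmf (bernoulli_pmf (edge_prob \<alpha> lam (\<lambda>x. W x \<omega>) e))) (E e))" for \<omega>
  proof -
    interpret product_prob_space "\<lambda>e. measure_pmf (bernoulli_pmf (edge_prob \<alpha> lam (\<lambda>x. W x \<omega>) e))" edges ..
    have "A = prod_emb edges (\<lambda>e. measure_pmf (bernoulli_pmf (edge_prob \<alpha> lam (\<lambda>x. W x \<omega>) e))) J (Pi\<^sub>E J E)"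
      unfolding A prod_emb_def by (simp add: space_PiM)
    then show ?thesis
      unfolding edge_law_def using emeasure_PiM_emb[OF J(2,1), of E] by simp
  qed
  then show "(\<lambda>\<omega>. emeasure (edge_law \<alpha> lam (\<lambda>x. W x \<omega>)) A) \<in> borel_measurable M"
    using bern J(2) by (simp add: borel_measurable_prod_ennreal subset_eq)
qed

lemma prob_space_graph_law:
  assumes "prob_space M" "\<And>x. W x \<in> borel_measurable M"
  shows "prob_space (graph_law M W \<alpha> lam)"
  unfolding graph_law_def
  by (rule prob_space_bind'[OF _ measurable_edge_law])
     (use assms in \<open>auto simp: space_prob_algebra\<close>)

lemma sets_graph_law:
  assumes "prob_space M" "\<And>x. W x \<in> borel_measurable M"
  shows "sets (graph_law M W \<alpha> lam) = sets (\<Pi>\<^sub>M e\<in>edges. count_space UNIV)"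
  unfolding graph_law_def using assms(1)
  by (intro sets_bind sets_edge_law prob_space.not_empty)

lemma countable_lattice: "countable (UNIV :: (int ^ 'd) set)"
proof -
  have "countable (range (vec_nth :: int ^ 'd \<Rightarrow> 'd \<Rightarrow> int))"
    by (rule countable_subset[OF subset_UNIV]) simp
  then show ?thesis
    by (rule countable_image_inj_on) (simp add: inj_on_def vec_eq_iff fun_eq_iff)
qed

lemma measurable_infinite_cluster:
  fixes x :: "int ^ 'd"
  defines "C \<equiv> (\<Pi>\<^sub>M e\<in>edges. count_space UNIV) :: ((int ^ 'd) set \<Rightarrow> bool) measure"
  shows "{\<eta> \<in> space C. infinite (cluster \<eta> x)} \<in> sets C"
proof -
  let ?R = "\<lambda>\<eta> u v. u \<noteq> v \<and> \<eta> {u, v}"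
  have step: "{\<eta> \<in> space C. ?R \<eta> u v} \<in> sets C" for u v :: "int ^ 'd"
  proof (cases "u = v")
    case False
    then have "{u, v} \<in> edges" by (auto simp: edges_def)
    then have "(\<lambda>\<eta>. \<eta> {u, v}) \<in> measurable C (count_space UNIV)"
      unfolding C_def by (rule measurable_component_singleton)
    then show ?thesis using False by simp
  qed simp
  have path: "{\<eta> \<in> space C. (?R \<eta> ^^ n) x y} \<in> sets C" for n y
  proof (induction n arbitrary: y)
    case 0
    then show ?case by simp
  next
    case (Suc n)
    have "{\<eta> \<in> space C. (?R \<eta> ^^ Suc n) x y} =
        (\<Union>z. {\<eta> \<in> space C. (?R \<eta> ^^ n) x z} \<inter> {\<eta> \<in> space C. ?R \<eta> z y})"
      by auto
    also have "\<dots> \<in> sets C"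
      using Suc step by (intro sets.countable_UN'' countable_lattice sets.Int) auto
    finally show ?case .
  qed
  have mem: "{\<eta> \<in> space C. y \<in> cluster \<eta> x} \<in> sets C" for y
  proof -
    have "{\<eta> \<in> space C. y \<in> cluster \<eta> x} = (\<Union>n. {\<eta> \<in> space C. (?R \<eta> ^^ n) x y})"
      unfolding cluster_def by (auto simp: rtranclp_power)
    then show ?thesis using path by (simp add: sets.countable_UN image_subset_iff)
  qed
  have fin: "countable {A :: (int ^ 'd) set. finite A}"
    using countable_Collect_finite_subset[OF countable_lattice] by simp
  have "{\<eta> \<in> space C. infinite (cluster \<eta> x)} =
      space C - (\<Union>A\<in>{A. finite A}. space C - (\<Union>y\<in>-A. {\<eta> \<in> space C. y \<in> cluster \<eta> x}))"
    (is "?L = ?S")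
  proof -
    have "infinite B \<longleftrightarrow> (\<forall>A. finite A \<longrightarrow> (\<exists>y\<in>-A. y \<in> B))" for B :: "(int ^ 'd) set"
      by (metis ComplD ComplI finite_subset subsetI)
    then show ?thesis by auto
  qed
  also have "?S \<in> sets C"
    using mem by (intro sets.Diff sets.top sets.countable_UN'' fin)
      (auto intro: countable_subset[OF subset_UNIV countable_lattice])
  finally show ?thesis .
qed

end

theory Submission
  imports Defs
begin

text \<open>
  The three claims are statements about one probability space. Give every vertex an independent
  weight with the law of \<open>W\<close> and every edge an independent uniform variable, and open an edge when
  its uniform variable lies below its connection probability. This reproduces the law of the graph
  (\<open>graph_law_seed\<close>). On this space events that read disjoint sets of coordinates are independent
  (\<open>seeds_indep\<close>), and translations preserve the measure (\<open>distr_translate\<close>).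

  Existence of an infinite cluster is a renormalisation argument. A block of side \<open>2 S\<close> is good if
  its induced graph has a cluster containing more than three quarters of its points. Two good blocks
  that overlap in half of their points have clusters that meet, by counting (\<open>majority_meet\<close>), so
  a chain of good blocks carries one cluster. A block of the next scale is covered by half-overlapping
  blocks of the present scale, and two disjoint bad ones among them cost the square of the
  failure probability. If all bad ones overlap pairwise, they lie in two consecutive rows and two
  consecutive columns. In the plane the good blocks that remain are still connected to each other,
  and only a small fraction of the points is lost (\<open>dense_sq_step\<close>). On the line they fall into a
  left and a right part, and one edge across the gap is needed (\<open>dense_seg_step\<close>). For \<open>\<alpha> \<le> 2\<close> the
  expected number of such edges grows at least like the logarithm of the number of blocks
  (\<open>bridge_energy\<close>), with a factor proportional to \<open>lam\<close>, so for large \<open>lam\<close> the failure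
  probability is a large negative power of the number of blocks. With growing numbers of sub-blocks
  the loss of density is summable and the failure probabilities stay below a geometric sequence
  (\<open>sparse_sq_prob\<close>, \<open>sparse_seg_prob\<close>). Blocks of every scale therefore have probability at
  least one half to contain a cluster of a fixed positive density. By translation invariance, the
  origin lies in a cluster of at least the given size with probability bounded below, and the infinite
  cluster at the origin follows by continuity (\<open>percolation_from_dense_clusters\<close>).

  On the line, with weights at least \<open>w\<close>, this applies to the vertices themselves. In dimension at
  least two the vertices of weight at least \<open>w\<close> may be rare. A cell of the plane is then a segment
  of \<open>L\<close> vertices, and cells are joined if both contain a heavy vertex and all edges between them
  have a small uniform variable. Choosing \<open>L\<close> large makes cells heavy, and choosing \<open>lam\<close> large after
  that makes the edges present (\<open>percolation_plane_eventually\<close>).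

  Absence of percolation on the line for \<open>\<alpha> > 2\<close> and \<open>\<alpha> (\<tau> - 1) > 2\<close> rests on a moment of order
  \<open>s \<le> 1\<close> with \<open>s < \<tau> - 1\<close> and \<open>\<alpha> s > 2\<close>. Since \<open>1 - exp (- t) \<le> t powr s\<close>, an edge of length \<open>r\<close> is open
  with probability at most a constant times \<open>r powr (- \<alpha> s)\<close>, which is summable over the edges
  crossing a given point. Hence, uniformly in the window, no edge inside a window crosses its middle
  with probability at least some \<open>\<delta> > 0\<close> (\<open>local_cut_prob\<close>), windows far apart are independent, and long
  edges are negligible. So almost surely no edge crosses some point on either side of the
  origin, and the cluster of the origin is finite (\<open>no_percolation_line\<close>).
\<close>

section \<open>Gluing clusters of overlapping blocks\<close>

definition induced :: "('v \<Rightarrow> 'v \<Rightarrow> bool) \<Rightarrow> 'v set \<Rightarrow> ('v \<times> 'v) set" where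
  "induced E B = {(x, y). x \<in> B \<and> y \<in> B \<and> E x y}"

text \<open>Two points of a linked set may be joined through points outside it, but only along \<open>H\<close>.\<close>

definition linked :: "('v \<times> 'v) set \<Rightarrow> 'v set \<Rightarrow> bool" where
  "linked H A \<longleftrightarrow> (\<forall>x\<in>A. \<forall>y\<in>A. (x, y) \<in> H\<^sup>*)"

text \<open>The cluster is hidden behind an existential quantifier, which makes this a property of the induced
  graph alone. Hence it is independent for disjoint blocks.\<close>

definition dense_cluster :: "real \<Rightarrow> 'v set \<Rightarrow> ('v \<times> 'v) set \<Rightarrow> bool" where
  "dense_cluster \<theta> B H \<longleftrightarrow> (\<exists>A\<subseteq>B. \<theta> * card B \<le> card A \<and> linked H A)"

abbreviation good_block :: "real \<Rightarrow> ('v \<Rightarrow> 'v \<Rightarrow> bool) \<Rightarrow> 'v set \<Rightarrow> bool" where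
  "good_block \<theta> E B \<equiv> dense_cluster \<theta> B (induced E B)"

lemma induced_mono: "A \<subseteq> B \<Longrightarrow> induced E A \<subseteq> induced E B"
  by (auto simp: induced_def)

lemma linked_mono: "linked H A \<Longrightarrow> H \<subseteq> H' \<Longrightarrow> linked H' A"
  unfolding linked_def by (meson rtrancl_mono subsetD)

lemma linked_subset: "linked H A \<Longrightarrow> A' \<subseteq> A \<Longrightarrow> linked H A'"
  unfolding linked_def by blast

lemma linked_Un:
  assumes "linked H A" "linked H B" "A \<inter> B \<noteq> {}"
  shows "linked H (A \<union> B)"
proof -
  obtain w where "w \<in> A" "w \<in> B" using assms(3) by blast
  then have "(x, w) \<in> H\<^sup>* \<and> (w, x) \<in> H\<^sup>*" if "x \<in> A \<union> B" for x
    using assms(1,2) that unfolding linked_def by blast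
  then show ?thesis unfolding linked_def by (meson rtrancl_trans)
qed

lemma linked_Un_edge:
  assumes "linked H A" "linked H B" "x \<in> A" "y \<in> B" "(x, y) \<in> H" "(y, x) \<in> H"
  shows "linked H (A \<union> B)"
  using assms unfolding linked_def
  by (metis Un_iff r_into_rtrancl rtrancl_trans)

lemma linked_chain:
  assumes "\<And>k. k \<in> {l..u} \<Longrightarrow> linked H (A k)"
    and "\<And>k. l \<le> k \<Longrightarrow> k < u \<Longrightarrow> A k \<inter> A (Suc k) \<noteq> {}"
  shows "linked H (\<Union>k\<in>{l..u}. A k)"
proof (cases "l \<le> u")
  case True
  from True assms show ?thesis
  proof (induction u rule: dec_induct)
    case base
    then show ?case by simp
  next
    case (step n)
    have "(\<Union>k\<in>{l..Suc n}. A k) = (\<Union>k\<in>{l..n}. A k) \<union> A (Suc n)"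
      using step.hyps by (auto simp: atLeastAtMostSuc_conv)
    moreover have "linked H (\<Union>k\<in>{l..n}. A k)"
      using step by auto
    moreover have "(\<Union>k\<in>{l..n}. A k) \<inter> A (Suc n) \<noteq> {}"
      using step.prems(2)[of n] step.hyps by fastforce
    ultimately show ?case
      using linked_Un[of H "\<Union>k\<in>{l..n}. A k" "A (Suc n)"] step.prems(1)[of "Suc n"] step.hyps
      by simp
  qed
qed (simp add: linked_def)

lemma dense_cluster_mono:
  "dense_cluster \<theta> B H \<Longrightarrow> \<theta>' \<le> \<theta> \<Longrightarrow> dense_cluster \<theta>' B H"
  unfolding dense_cluster_def by (meson mult_right_mono of_nat_0_le_iff order_trans)

text \<open>Pigeonhole: two subsets with more than \<open>3 N / 4\<close> elements each cannot be disjoint inside a union of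
  at most \<open>3 N / 2\<close> elements. This is what lets clusters of overlapping blocks be glued without any
  topology of the plane.\<close>

lemma majority_meet:
  fixes \<theta> :: real and N :: nat
  assumes "finite B" "finite B'" "A \<subseteq> B" "A' \<subseteq> B'" "3 / 4 < \<theta>"
    and "\<theta> * card B \<le> card A" "\<theta> * card B' \<le> card A'"
    and "card B = N" "card B' = N" "2 * card (B \<union> B') \<le> 3 * N" "0 < N"
  shows "A \<inter> A' \<noteq> {}"
proof
  assume "A \<inter> A' = {}"
  then have "card A + card A' = card (A \<union> A')"
    using assms(1-4) by (metis card_Un_disjoint finite_subset)
  also have "\<dots> \<le> card (B \<union> B')"
    using assms(1-4) by (intro card_mono) auto
  finally have "2 * (card A + card A') \<le> 3 * N"
    using assms(10) by (meson le_trans mult_le_mono2)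
  then have "2 * (real (card A) + real (card A')) \<le> 3 * real N"
    by (metis (mono_tags, lifting) of_nat_add of_nat_le_iff of_nat_mult of_nat_numeral)
  moreover have "3 / 4 * real N < \<theta> * real N"
    using assms(5,11) by (intro mult_strict_right_mono) auto
  ultimately show False
    using assms(6-9) by (simp add: )
qed

text \<open>\<open>S\<close> is half the side, because neighbouring blocks of one scale are shifted by \<open>S\<close> and thus share half
  of their points.\<close>

definition seg :: "nat \<Rightarrow> int \<Rightarrow> int set" where
  "seg S a = {a..<a + 2 * int S}"

definition sq :: "nat \<Rightarrow> int \<times> int \<Rightarrow> (int \<times> int) set" where
  "sq S z = seg S (fst z) \<times> seg S (snd z)"

lemma finite_seg [simp]: "finite (seg S a)" and card_seg [simp]: "card (seg S a) = 2 * S"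
  by (auto simp: seg_def)

lemma finite_sq [simp]: "finite (sq S z)" and card_sq [simp]: "card (sq S z) = 4 * S\<^sup>2"
  by (auto simp: sq_def card_cartesian_product power2_eq_square)

abbreviation subseg :: "nat \<Rightarrow> int \<Rightarrow> nat \<Rightarrow> int set" where
  "subseg S a j \<equiv> seg S (a + int S * int j)"

lemma subseg_subset: "j < 2 * C - 1 \<Longrightarrow> subseg S a j \<subseteq> seg (C * S) a"
proof -
  assume "j < 2 * C - 1"
  then have "int S * (int j + 2) \<le> int S * (2 * int C)"
    by (intro mult_left_mono) auto
  then show ?thesis
    unfolding seg_def by (auto simp: algebra_simps)
qed

lemma subseg_Suc_Un: "subseg S a j \<union> subseg S a (Suc j) = {a + int S * int j..<a + int S * int j + 3 * int S}"
  unfolding seg_def by (auto simp: algebra_simps)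

lemma subseg_disjoint: "j + 2 \<le> j' \<Longrightarrow> subseg S a j \<inter> subseg S a j' = {}"
proof -
  assume "j + 2 \<le> j'"
  then have "int S * (int j + 2) \<le> int S * int j'"
    by (intro mult_left_mono) auto
  then show ?thesis
    unfolding seg_def by (auto simp: algebra_simps)
qed

text \<open>Applied to the indices of bad blocks: blocks whose indices differ by at least two are disjoint, so
  bad blocks that pairwise overlap have at most two consecutive indices in each direction.\<close>

lemma close_pairs_interval:
  fixes J :: "nat set"
  assumes "\<And>j j'. j \<in> J \<Longrightarrow> j' \<in> J \<Longrightarrow> \<not> j + 2 \<le> j'"
  obtains i where "J \<subseteq> {i, Suc i}" "i \<in> J \<or> J = {}"
proof (cases "J = {}")
  case False
  define i where "i = (LEAST j. j \<in> J)"
  have "i \<in> J" using False unfolding i_def by (metis LeastI_ex ex_in_conv)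
  moreover have "j = i \<or> j = Suc i" if "j \<in> J" for j
    using assms[OF \<open>i \<in> J\<close> that] Least_le[of "\<lambda>j. j \<in> J" j] that unfolding i_def by linarith
  ultimately show ?thesis using that by blast
qed (use that in auto)

text \<open>The bad blocks lie in two consecutive rows and two consecutive columns. Every other row consists of
  good blocks and carries one cluster, and any other column consists of good blocks
  too, meets all those rows and links them. Among the blocks with even indices, which tile the
  square, at most one row of \<open>C\<close> blocks out of \<open>C\<close> such rows is lost.\<close>

lemma dense_sq_step:
  fixes E :: "int \<times> int \<Rightarrow> int \<times> int \<Rightarrow> bool" and z :: "int \<times> int" and S C :: nat and \<theta> :: real
  defines "sub \<equiv> \<lambda>p. subseg S (fst z) (fst p) \<times> subseg S (snd z) (snd p)"
  defines "bad \<equiv> {p. fst p < 2 * C - 1 \<and> snd p < 2 * C - 1 \<and> \<not> good_block \<theta> E (sub p)}"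
  assumes "2 \<le> C" "0 < S" "3 / 4 < \<theta>"
    and close: "\<And>p q. p \<in> bad \<Longrightarrow> q \<in> bad \<Longrightarrow> sub p \<inter> sub q \<noteq> {}"
  shows "good_block ((1 - 1 / C) * \<theta>) E (sq (C * S) z)"
proof -
  let ?m = "2 * C - 1" and ?R = "induced E (sq (C * S) z)"
  obtain i where i: "fst ` bad \<subseteq> {i, Suc i}"
  proof (rule close_pairs_interval[of "fst ` bad"])
    fix r r' assume "r \<in> fst ` bad" "r' \<in> fst ` bad"
    then obtain p q where "p \<in> bad" "q \<in> bad" "r = fst p" "r' = fst q" by auto
    then show "\<not> r + 2 \<le> r'"
      using close[of p q] subseg_disjoint[of r r' S "fst z"] by (auto simp: sub_def)
  qed auto
  obtain j where j: "snd ` bad \<subseteq> {j, Suc j}"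
  proof (rule close_pairs_interval[of "snd ` bad"])
    fix r r' assume "r \<in> snd ` bad" "r' \<in> snd ` bad"
    then obtain p q where "p \<in> bad" "q \<in> bad" "r = snd p" "r' = snd q" by auto
    then show "\<not> r + 2 \<le> r'"
      using close[of p q] subseg_disjoint[of r r' S "snd z"] by (auto simp: sub_def)
  qed auto
  have sub_sub: "sub (r, c) \<subseteq> sq (C * S) z" if "r < ?m" "c < ?m" for r c
    unfolding sub_def sq_def using subseg_subset[OF that(1)] subseg_subset[OF that(2)]
    by (simp, blast)
  have card_sub: "card (sub p) = 4 * S\<^sup>2" and fin_sub: "finite (sub p)" for p
    by (auto simp: sub_def card_cartesian_product power2_eq_square)
  have "\<exists>A\<subseteq>sub (r, c). \<theta> * card (sub (r, c)) \<le> card A \<and> linked (induced E (sub (r, c))) A"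
    if "r < ?m" "c < ?m" "r \<notin> {i, Suc i} \<or> c \<notin> {j, Suc j}" for r c
  proof -
    have "(r, c) \<notin> bad"
      using that(3) i j by (metis fst_conv image_subset_iff snd_conv)
    then show ?thesis
      using that unfolding bad_def dense_cluster_def by auto
  qed
  note ex = this
  define A where "A p = (SOME A. A \<subseteq> sub p \<and> \<theta> * card (sub p) \<le> card A \<and> linked (induced E (sub p)) A)" for p
  have A: "A (r, c) \<subseteq> sub (r, c) \<and> \<theta> * card (sub (r, c)) \<le> card (A (r, c)) \<and> linked (induced E (sub (r, c))) (A (r, c))"
    if "r < ?m" "c < ?m" "r \<notin> {i, Suc i} \<or> c \<notin> {j, Suc j}" for r c
    unfolding A_def by (rule someI_ex, use ex[OF that] in blast)
  have lA: "linked ?R (A (r, c))" if "r < ?m" "c < ?m" "r \<notin> {i, Suc i} \<or> c \<notin> {j, Suc j}" for r c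
    using A[OF that] induced_mono[OF sub_sub[OF that(1,2)]] linked_mono by blast
  have pos: "0 < 4 * S\<^sup>2" using \<open>0 < S\<close> by simp
  have meet_row: "A (r, c) \<inter> A (r, Suc c) \<noteq> {}" if "r < ?m" "Suc c < ?m" "r \<notin> {i, Suc i}" for r c
  proof (rule majority_meet[OF fin_sub fin_sub _ _ \<open>3 / 4 < \<theta>\<close> _ _ card_sub card_sub _ pos])
    have "sub (r, c) \<union> sub (r, Suc c) = subseg S (fst z) r \<times> (subseg S (snd z) c \<union> subseg S (snd z) (Suc c))"
      unfolding sub_def by auto
    then show "2 * card (sub (r, c) \<union> sub (r, Suc c)) \<le> 3 * (4 * S\<^sup>2)"
      unfolding subseg_Suc_Un by (simp add: card_cartesian_product power2_eq_square nat_mult_distrib)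
  qed (use that A[of r c] A[of r "Suc c"] in auto)
  have meet_col: "A (r, c) \<inter> A (Suc r, c) \<noteq> {}" if "Suc r < ?m" "c < ?m" "c \<notin> {j, Suc j}" for r c
  proof (rule majority_meet[OF fin_sub fin_sub _ _ \<open>3 / 4 < \<theta>\<close> _ _ card_sub card_sub _ pos])
    have "sub (r, c) \<union> sub (Suc r, c) = (subseg S (fst z) r \<union> subseg S (fst z) (Suc r)) \<times> subseg S (snd z) c"
      unfolding sub_def by auto
    then show "2 * card (sub (r, c) \<union> sub (Suc r, c)) \<le> 3 * (4 * S\<^sup>2)"
      unfolding subseg_Suc_Un by (simp add: card_cartesian_product power2_eq_square nat_mult_distrib)
  qed (use that A[of r c] A[of "Suc r" c] in auto)
  (* U r is the cluster of the full row r, V the cluster of a full column of good blocks. *)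
  define U where "U r = (\<Union>c\<in>{0..2 * C - 2}. A (r, c))" for r
  obtain c0 where c0: "c0 < ?m" "c0 \<notin> {j, Suc j}"
    using \<open>2 \<le> C\<close> that[of 0] that[of 2] by (cases "j = 0") auto
  define V where "V = (\<Union>r\<in>{0..2 * C - 2}. A (r, c0))"
  have lU: "linked ?R (U r)" if "r < ?m" "r \<notin> {i, Suc i}" for r
    unfolding U_def using that \<open>2 \<le> C\<close> by (intro linked_chain lA meet_row) auto
  have lV: "linked ?R V"
    unfolding V_def using c0 \<open>2 \<le> C\<close> by (intro linked_chain lA meet_col) auto
  have meet: "U r \<inter> V \<noteq> {}" if "r < ?m" "r \<notin> {i, Suc i}" for r
  proof -
    have "\<theta> * card (sub (r, c0)) > 0" using \<open>3 / 4 < \<theta>\<close> pos card_sub by simp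
    then have "card (A (r, c0)) > 0" using A[of r c0] that c0 by linarith
    then have "A (r, c0) \<noteq> {}" by auto
    moreover have "A (r, c0) \<subseteq> U r" "A (r, c0) \<subseteq> V"
      using c0(1) that(1) unfolding U_def V_def by fastforce+
    ultimately show ?thesis by blast
  qed
  define good where "good = {r. r < ?m \<and> r \<notin> {i, Suc i}}"
  have lin: "linked ?R (\<Union>r\<in>good. U r)"
    unfolding linked_def
  proof clarify
    fix x y r r' assume "r \<in> good" "r' \<in> good" "x \<in> U r" "y \<in> U r'"
    then have r: "r < ?m" "r \<notin> {i, Suc i}" "r' < ?m" "r' \<notin> {i, Suc i}" and xy: "x \<in> U r" "y \<in> U r'"
      by (auto simp: good_def)
    have "linked ?R (U r \<union> V)" by (rule linked_Un[OF lU lV meet]) (use r in auto)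
    moreover have "linked ?R (U r' \<union> V)" by (rule linked_Un[OF lU lV meet]) (use r in auto)
    moreover have "V \<noteq> {}" using meet[OF r(1,2)] by auto
    ultimately show "(x, y) \<in> ?R\<^sup>*"
      using xy unfolding linked_def by (metis UnCI all_not_in_conv rtrancl_trans)
  qed
  (* The pair (k, l) stands for the block (2 k, 2 l); 2 k \<in> {i, Suc i} forces k = (i + 1) div 2. *)
  define T where "T = ({..<C} - {(i + 1) div 2}) \<times> {..<C}"
  let ?g = "\<lambda>(k::nat, l::nat). (2 * k, 2 * l)"
  let ?W = "\<Union>p\<in>T. A (?g p)"
  have T: "fst (?g p) < ?m" "snd (?g p) < ?m" "fst (?g p) \<notin> {i, Suc i}" if "p \<in> T" for p
    using that unfolding T_def by auto
  have AT: "A (?g p) \<subseteq> sub (?g p)" "\<theta> * (4 * S\<^sup>2) \<le> card (A (?g p))" if "p \<in> T" for p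
    using A[of "fst (?g p)" "snd (?g p)"] T[OF that] card_sub by auto
  have "?W \<subseteq> (\<Union>r\<in>good. U r)"
  proof
    fix x assume "x \<in> ?W"
    then obtain p where p: "p \<in> T" "x \<in> A (?g p)" by blast
    have "x \<in> U (fst (?g p))" unfolding U_def
      using p T(2)[OF p(1)] by (intro UN_I[of "snd (?g p)"]) auto
    then show "x \<in> (\<Union>r\<in>good. U r)"
      using T(1,3)[OF p(1)] unfolding good_def by blast
  qed
  then have "linked ?R ?W" using lin linked_subset by blast
  moreover have "?W \<subseteq> sq (C * S) z"
    using AT(1) T sub_sub by (smt (verit, best) UN_E prod.collapse subset_eq)
  moreover have "(1 - 1 / C) * \<theta> * card (sq (C * S) z) \<le> card ?W"
  proof -
    have disj: "sub (?g p) \<inter> sub (?g q) = {}" if ne: "p \<noteq> q" for p q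
    proof -
      obtain k l k' l' where pq: "p = (k, l)" "q = (k', l')" by (metis surj_pair)
      consider "k < k'" | "k' < k" | "l < l'" | "l' < l" using ne pq by (metis linorder_neqE_nat)
      then show ?thesis
        unfolding pq sub_def
        using subseg_disjoint[of "2*k" "2*k'" S "fst z"] subseg_disjoint[of "2*k'" "2*k" S "fst z"]
          subseg_disjoint[of "2*l" "2*l'" S "snd z"] subseg_disjoint[of "2*l'" "2*l" S "snd z"]
        by cases auto
    qed
    have "card ?W = (\<Sum>p\<in>T. card (A (?g p)))"
    proof (rule card_UN_disjoint)
      show "finite T" by (simp add: T_def)
      show "\<forall>p\<in>T. finite (A (?g p))" using AT(1) fin_sub finite_subset by blast
      show "\<forall>p\<in>T. \<forall>q\<in>T. p \<noteq> q \<longrightarrow> A (?g p) \<inter> A (?g q) = {}"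
        using AT(1) disj by blast
    qed
    then have "real (card ?W) = (\<Sum>p\<in>T. real (card (A (?g p))))" by simp
    moreover have "real (card T) * (\<theta> * (4 * S\<^sup>2)) \<le> (\<Sum>p\<in>T. real (card (A (?g p))))"
      using AT(2) by (intro sum_bounded_below) auto
    moreover have "real (card T) \<ge> (real C - 1) * C"
      unfolding T_def by (auto simp: card_cartesian_product card_Diff_singleton_if intro!: mult_right_mono)
    then have "real (card T) * (\<theta> * (4 * S\<^sup>2)) \<ge> ((real C - 1) * C) * (\<theta> * (4 * S\<^sup>2))"
      using \<open>3 / 4 < \<theta>\<close> by (intro mult_right_mono) auto
    moreover have "((real C - 1) * C) * (\<theta> * (4 * S\<^sup>2)) = (1 - 1 / C) * \<theta> * card (sq (C * S) z)"
      using \<open>2 \<le> C\<close> by (simp add: power2_eq_square field_simps)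
    ultimately show ?thesis by linarith
  qed
  ultimately show ?thesis unfolding dense_cluster_def by blast
qed

section \<open>One step of renormalisation on the line\<close>

text \<open>If the blocks with indices \<open>i\<close> and \<open>i + 1\<close> are bad, the good ones before them cover this interval and
  the good ones after them cover \<open>right_part\<close>. The two are separated by a gap of length \<open>S\<close>.\<close>

definition left_part :: "nat \<Rightarrow> int \<Rightarrow> nat \<Rightarrow> int set" where
  "left_part S a i = {a..<a + int S * (int i + 1)}"

definition right_part :: "nat \<Rightarrow> nat \<Rightarrow> int \<Rightarrow> nat \<Rightarrow> int set" where
  "right_part C S a i = {a + int S * (int i + 2)..<a + 2 * int S * int C}"

text \<open>The cluster \<open>X\<close> has density \<open>\<theta>\<close> in each tile \<open>subseg S a (2 * k)\<close> with \<open>k \<in> I\<close>. This is more than a bound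
  on its size: the estimate for edges across the gap needs its points at all distances from the gap.\<close>

definition spread :: "real \<Rightarrow> nat \<Rightarrow> int \<Rightarrow> nat set \<Rightarrow> int set \<Rightarrow> int set \<Rightarrow> (int \<times> int) set \<Rightarrow> bool" where
  "spread \<theta> S a I B X H \<longleftrightarrow> X \<subseteq> B \<and> linked H X \<and>
     (\<forall>k\<in>I. \<theta> * (2 * real S) \<le> card (X \<inter> subseg S a (2 * k)))"

text \<open>The numbers \<open>k\<close> with \<open>2 * k < i\<close>, and below the numbers \<open>k < C\<close> with \<open>i + 2 \<le> 2 * k\<close>.\<close>

abbreviation left_tiles :: "nat \<Rightarrow> nat set" where
  "left_tiles i \<equiv> {..<(i + 1) div 2}"

abbreviation right_tiles :: "nat \<Rightarrow> nat \<Rightarrow> nat set" where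
  "right_tiles C i \<equiv> {(i + 3) div 2..<C}"

abbreviation left_cluster :: "real \<Rightarrow> nat \<Rightarrow> int \<Rightarrow> nat \<Rightarrow> int set \<Rightarrow> (int \<times> int) set \<Rightarrow> bool" where
  "left_cluster \<theta> S a i \<equiv> spread \<theta> S a (left_tiles i) (left_part S a i)"

abbreviation right_cluster :: "real \<Rightarrow> nat \<Rightarrow> nat \<Rightarrow> int \<Rightarrow> nat \<Rightarrow> int set \<Rightarrow> (int \<times> int) set \<Rightarrow> bool" where
  "right_cluster \<theta> C S a i \<equiv> spread \<theta> S a (right_tiles C i) (right_part C S a i)"

lemma spread_of_good_blocks:
  fixes E :: "int \<Rightarrow> int \<Rightarrow> bool" and \<theta> :: real
  assumes "0 < S" "3 / 4 < \<theta>"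
    and good: "\<And>k. k \<in> {l..u} \<Longrightarrow> good_block \<theta> E (subseg S a k)"
    and sub: "\<And>k. k \<in> {l..u} \<Longrightarrow> subseg S a k \<subseteq> B"
    and I: "\<And>k. k \<in> I \<Longrightarrow> 2 * k \<in> {l..u}"
    and "finite B"
  shows "\<exists>X. spread \<theta> S a I B X (induced E B)"
proof -
  define A where "A k = (SOME A. A \<subseteq> subseg S a k \<and> \<theta> * card (subseg S a k) \<le> card A \<and> linked (induced E (subseg S a k)) A)" for k
  have A: "A k \<subseteq> subseg S a k \<and> \<theta> * card (subseg S a k) \<le> card (A k) \<and> linked (induced E (subseg S a k)) (A k)"
    if "k \<in> {l..u}" for k
    unfolding A_def by (rule someI_ex, use good[OF that] in \<open>auto simp: dense_cluster_def\<close>)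
  have meet: "A k \<inter> A (Suc k) \<noteq> {}" if "l \<le> k" "k < u" for k
  proof (rule majority_meet[of "subseg S a k" "subseg S a (Suc k)" _ _ \<theta> "2 * S"])
    show "2 * card (subseg S a k \<union> subseg S a (Suc k)) \<le> 3 * (2 * S)"
      unfolding subseg_Suc_Un by (simp add: nat_mult_distrib)
  qed (use that A[of k] A[of "Suc k"] assms(1,2) in auto)
  let ?X = "\<Union>k\<in>{l..u}. A k"
  have "linked (induced E B) ?X"
  proof (rule linked_chain)
    fix k assume "k \<in> {l..u}"
    then show "linked (induced E B) (A k)"
      using A[of k] linked_mono[OF _ induced_mono[OF sub]] by blast
  qed (rule meet)
  moreover have "?X \<subseteq> B" using A sub by blast
  moreover have "\<theta> * (2 * real S) \<le> card (?X \<inter> subseg S a (2 * k))" if "k \<in> I" for k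
  proof -
    have "card (A (2 * k)) \<le> card (?X \<inter> subseg S a (2 * k))"
    proof (rule card_mono)
      show "A (2 * k) \<subseteq> ?X \<inter> subseg S a (2 * k)"
        using A[OF I[OF that]] UN_I[OF I[OF that], of _ A] by blast
    qed simp
    then show ?thesis using A[OF I[OF that]] by simp
  qed
  ultimately show ?thesis unfolding spread_def by blast
qed

lemma dense_cluster_of_spread:
  fixes E :: "int \<Rightarrow> int \<Rightarrow> bool" and \<theta> :: real
  assumes "spread \<theta> S a I B X (induced E B)" "B \<subseteq> seg (C * S) a" "finite I"
    and "real C - real K \<le> card I" "0 < \<theta>" "0 < C"
  shows "good_block ((1 - K / C) * \<theta>) E (seg (C * S) a)"
proof -
  have "(\<Sum>k\<in>I. card (X \<inter> subseg S a (2 * k))) = card (\<Union>k\<in>I. X \<inter> subseg S a (2 * k))"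
  proof (rule card_UN_disjoint[symmetric])
    have "subseg S a (2 * k) \<inter> subseg S a (2 * l) = {}" if "k \<noteq> l" for k l
      using subseg_disjoint[of "2 * k" "2 * l" S a] subseg_disjoint[of "2 * l" "2 * k" S a] that
      by (cases k l rule: linorder_cases) auto
    then show "\<forall>k\<in>I. \<forall>l\<in>I. k \<noteq> l \<longrightarrow> (X \<inter> subseg S a (2 * k)) \<inter> (X \<inter> subseg S a (2 * l)) = {}"
      by blast
  qed (use assms(3) in auto)
  also have "\<dots> \<le> card X"
    using assms(1,2) finite_subset[OF _ finite_seg] unfolding spread_def by (intro card_mono) blast+
  finally have *: "(\<Sum>k\<in>I. real (card (X \<inter> subseg S a (2 * k)))) \<le> card X"
    by (metis of_nat_le_iff of_nat_sum)
  have "(1 - K / C) * \<theta> * card (seg (C * S) a) = (real C - real K) * (\<theta> * (2 * real S))"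
    using assms(6) by (simp add: field_simps)
  also have "\<dots> \<le> card I * (\<theta> * (2 * real S))"
    using assms(4,5) by (intro mult_right_mono) auto
  also have "\<dots> \<le> (\<Sum>k\<in>I. real (card (X \<inter> subseg S a (2 * k))))"
    using assms(1) unfolding spread_def by (intro sum_bounded_below) auto
  also note *
  finally show ?thesis
    using assms(1,2) linked_mono[OF _ induced_mono[OF assms(2)]]
    unfolding dense_cluster_def spread_def by blast
qed

text \<open>If the bad blocks lie within \<open>2 Q\<close> blocks of an end, the shorter side is discarded at a cost of at most
  \<open>2 Q\<close> of the \<open>C\<close> tiles. Otherwise both sides are long, and the hypothesis \<open>bridge\<close> provides an edge between
  their clusters.\<close>

lemma dense_seg_step:
  fixes E :: "int \<Rightarrow> int \<Rightarrow> bool" and \<theta> :: real and S C Q :: nat and a :: int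
  defines "bad \<equiv> {j. j < 2 * C - 1 \<and> \<not> good_block \<theta> E (subseg S a j)}"
  assumes "1 \<le> Q" "2 * Q + 2 \<le> C" "0 < S" "3 / 4 < \<theta>"
    and symE: "\<And>x y. E x y \<Longrightarrow> E y x"
    and close: "\<And>j k. j \<in> bad \<Longrightarrow> k \<in> bad \<Longrightarrow> subseg S a j \<inter> subseg S a k \<noteq> {}"
    and bridge: "\<And>i. 2 * Q \<le> i \<Longrightarrow> i + 2 * Q + 3 \<le> 2 * C \<Longrightarrow>
        \<exists>X. left_cluster \<theta> S a i X (induced E (left_part S a i)) \<Longrightarrow>
        \<exists>Y. right_cluster \<theta> C S a i Y (induced E (right_part C S a i)) \<Longrightarrow>
        \<exists>X Y. left_cluster \<theta> S a i X (induced E (left_part S a i)) \<and>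
          right_cluster \<theta> C S a i Y (induced E (right_part C S a i)) \<and>
          (\<exists>x\<in>X. \<exists>y\<in>Y. E x y)"
  shows "good_block ((1 - (2 * Q) / C) * \<theta>) E (seg (C * S) a)"
proof -
  let ?m = "2 * C - 1"
  obtain i where i: "bad \<subseteq> {i, Suc i}" and ibad: "i \<in> bad \<or> bad = {}"
  proof (rule close_pairs_interval[of bad])
    fix j k assume "j \<in> bad" "k \<in> bad"
    then show "\<not> j + 2 \<le> k"
      using close[of j k] subseg_disjoint[of j k S a] by auto
  qed auto
  have "\<exists>i. bad \<subseteq> {i, Suc i} \<and> i < ?m"
  proof (cases "bad = {}")
    case True
    then show ?thesis using \<open>2 * Q + 2 \<le> C\<close> by (intro exI[of _ 0]) auto
  next
    case False
    then show ?thesis using i ibad unfolding bad_def by blast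
  qed
  then obtain i where i: "bad \<subseteq> {i, Suc i}" and im: "i < ?m" by blast
  have pos: "0 < \<theta>" "0 < C" using assms by auto
  have ScC: "int S * (int k + 2) \<le> 2 * int S * int C" if "k + 2 \<le> 2 * C" for k
  proof -
    have "int S * (int k + 2) \<le> int S * (2 * int C)" using that by (intro mult_left_mono) auto
    then show ?thesis by (simp add: ac_simps)
  qed
  have subL: "left_part S a i \<subseteq> seg (C * S) a"
    using ScC[of "i - 1"] ScC[of 0] im pos unfolding left_part_def seg_def
    by (cases "i = 0") (auto simp: algebra_simps of_nat_diff)
  have subR: "right_part C S a i \<subseteq> seg (C * S) a"
  proof -
    have "0 \<le> int S * (int i + 2)" by simp
    then show ?thesis unfolding right_part_def seg_def by (auto simp: algebra_simps)
  qed
  have good: "good_block \<theta> E (subseg S a k)" if "k < ?m" "k \<notin> {i, Suc i}" for k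
    using that i unfolding bad_def by blast
  have L: "\<exists>X. left_cluster \<theta> S a i X (induced E (left_part S a i))"
  proof (cases "i = 0")
    case True
    then show ?thesis by (auto simp: spread_def linked_def intro!: exI[of _ "{}"])
  next
    case False
    show ?thesis
    proof (rule spread_of_good_blocks[OF \<open>0 < S\<close> \<open>3 / 4 < \<theta>\<close>, of 0 "i - 1"])
      fix k assume k: "k \<in> {0..i - 1}"
      then show "good_block \<theta> E (subseg S a k)"
      proof (intro good)
        show "k < ?m" "k \<notin> {i, Suc i}" using k im False by auto
      qed
      have "int S * (int k + 2) \<le> int S * (int i + 1)" using k False by (intro mult_left_mono) auto
      then show "subseg S a k \<subseteq> left_part S a i"
        unfolding left_part_def seg_def by (auto simp: algebra_simps)
    qed (use False in \<open>auto simp: left_part_def\<close>)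
  qed
  have R: "\<exists>Y. right_cluster \<theta> C S a i Y (induced E (right_part C S a i))"
  proof (rule spread_of_good_blocks[OF \<open>0 < S\<close> \<open>3 / 4 < \<theta>\<close>, of "i + 2" "2 * C - 2"])
    fix k assume k: "k \<in> {i + 2..2 * C - 2}"
    then show "good_block \<theta> E (subseg S a k)"
      using good[of k] pos by auto
    have "int S * (int k + 2) \<le> 2 * int S * int C" using k pos by (intro ScC) auto
    moreover have "int S * (int i + 2) \<le> int S * int k" using k by (intro mult_left_mono) auto
    ultimately show "subseg S a k \<subseteq> right_part C S a i"
      unfolding right_part_def seg_def by (auto simp: algebra_simps)
  qed (auto simp: right_part_def)
  (* Both sides are long in the first case; otherwise one of them alone has enough tiles. *)
  show ?thesis
  proof (cases "2 * Q \<le> i \<and> i + 2 * Q + 3 \<le> 2 * C")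
    case True
    then obtain X Y x y where X: "left_cluster \<theta> S a i X (induced E (left_part S a i))"
      and Y: "right_cluster \<theta> C S a i Y (induced E (right_part C S a i))"
      and xy: "x \<in> X" "y \<in> Y" "E x y"
      using bridge[OF _ _ L R] by blast
    let ?B = "seg (C * S) a"
    have sub: "X \<subseteq> ?B" "Y \<subseteq> ?B" using X Y subL subR unfolding spread_def by blast+
    have "linked (induced E ?B) (X \<union> Y)"
    proof (rule linked_Un_edge)
      show "linked (induced E ?B) X" using X linked_mono[OF _ induced_mono[OF subL]] unfolding spread_def by blast
      show "linked (induced E ?B) Y" using Y linked_mono[OF _ induced_mono[OF subR]] unfolding spread_def by blast
      show "(x, y) \<in> induced E ?B" "(y, x) \<in> induced E ?B"
        using xy symE sub unfolding induced_def by auto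
    qed (use xy in auto)
    moreover have "\<theta> * (2 * real S) \<le> card ((X \<union> Y) \<inter> subseg S a (2 * k))"
      if "k \<in> left_tiles i \<union> right_tiles C i" for k
    proof -
      have fin: "finite ((X \<union> Y) \<inter> subseg S a (2 * k))" by simp
      have "card (X \<inter> subseg S a (2 * k)) \<le> card ((X \<union> Y) \<inter> subseg S a (2 * k))"
        and "card (Y \<inter> subseg S a (2 * k)) \<le> card ((X \<union> Y) \<inter> subseg S a (2 * k))"
        by (intro card_mono fin; blast)+
      then have "real (card (X \<inter> subseg S a (2 * k))) \<le> card ((X \<union> Y) \<inter> subseg S a (2 * k))"
        and "real (card (Y \<inter> subseg S a (2 * k))) \<le> card ((X \<union> Y) \<inter> subseg S a (2 * k))"
        by (simp_all only: of_nat_le_iff)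
      then show ?thesis using that X Y unfolding spread_def by (meson UnE order_trans)
    qed
    ultimately have "spread \<theta> S a (left_tiles i \<union> right_tiles C i) ?B (X \<union> Y) (induced E ?B)"
      using sub unfolding spread_def by blast
    moreover have "card (left_tiles i \<union> right_tiles C i) = (i + 1) div 2 + (C - (i + 3) div 2)"
      by (subst card_Un_disjoint) auto
    then have "real C - real (2 * Q) \<le> card (left_tiles i \<union> right_tiles C i)"
      using \<open>1 \<le> Q\<close> True by linarith
    ultimately show ?thesis
      using dense_cluster_of_spread[where K = "2 * Q" and B = ?B] pos by auto
  next
    case False
    then consider "i < 2 * Q" | "2 * C < i + 2 * Q + 3" by linarith
    then show ?thesis
    proof cases
      case 1
      then have "C \<le> card (right_tiles C i) + 2 * Q"
        using \<open>1 \<le> Q\<close> by simp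
      then have "real C - real (2 * Q) \<le> card (right_tiles C i)" by linarith
      then show ?thesis
        using R dense_cluster_of_spread[OF _ subR _ _ pos, where K = "2 * Q" and I = "right_tiles C i"] by auto
    next
      case 2
      then have "C \<le> card (left_tiles i) + 2 * Q"
        using \<open>1 \<le> Q\<close> by simp
      then have "real C - real (2 * Q) \<le> card (left_tiles i)" by linarith
      then show ?thesis
        using L dense_cluster_of_spread[OF _ subL _ _ pos, where K = "2 * Q" and I = "left_tiles i"] by auto
    qed
  qed
qed

text \<open>The tiles at positions \<open>p\<close> and \<open>q\<close> counted from the gap contain \<open>(2 \<theta> S)\<^sup>2\<close> pairs at distance at most
  \<open>2 S (p + q + 3)\<close>. So \<open>S\<close> cancels, and the sum over \<open>q \<le> p < Q\<close> is a harmonic sum. This logarithm is where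
  the exponent \<open>2\<close> is critical.\<close>

lemma bridge_energy:
  fixes \<theta> :: real and S C Q i :: nat and a :: int
  assumes "1 \<le> Q" "2 * Q \<le> i" "i + 2 * Q + 3 \<le> 2 * C" "0 < S" "3 / 4 \<le> \<theta>"
    and X: "left_cluster \<theta> S a i X H"
    and Y: "right_cluster \<theta> C S a i Y H'"
  shows "ln Q / 16 \<le> (\<Sum>x\<in>X. \<Sum>y\<in>Y. 1 / (real_of_int (x - y))\<^sup>2)"
proof -
  (* The tiles 2 k0 and 2 l0 are the nearest ones on either side of the gap. *)
  define k0 where "k0 = (i + 1) div 2 - 1"
  define l0 where "l0 = (i + 3) div 2"
  have k0: "Q \<le> k0 + 1" "k0 < (i + 1) div 2" and l0: "l0 + Q \<le> C" "l0 \<le> k0 + 2" "k0 < l0"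
    using assms(1-3) unfolding k0_def l0_def by auto
  have finX: "finite X" and finY: "finite Y"
    using X Y finite_subset unfolding spread_def left_part_def right_part_def by blast+
  let ?f = "\<lambda>x y. 1 / (real_of_int (x - y))\<^sup>2"
  let ?X = "\<lambda>p. X \<inter> subseg S a (2 * (k0 - p))" and ?Y = "\<lambda>q. Y \<inter> subseg S a (2 * (l0 + q))"
  have disj: "subseg S a (2 * k) \<inter> subseg S a (2 * l) = {}" if "k \<noteq> l" for k l
    using subseg_disjoint[of "2 * k" "2 * l" S a] subseg_disjoint[of "2 * l" "2 * k" S a] that
    by (cases k l rule: linorder_cases) auto
  (* The pairs between the tiles at positions p and q from the gap. *)
  have cell: "\<theta>\<^sup>2 / (real p + real q + 3)\<^sup>2 \<le> (\<Sum>x\<in>?X p. \<Sum>y\<in>?Y q. ?f x y)" if p: "p < Q" and q: "q < Q" for p q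
  proof -
    have "(1 / (2 * real S * (real p + real q + 3))\<^sup>2) \<le> ?f x y" if "x \<in> ?X p" "y \<in> ?Y q" for x y
    proof -
      let ?k = "k0 - p"
      have kp: "int ?k = int k0 - int p" using p k0 by simp
      have x: "a + int S * (2 * int ?k) \<le> x" "x < a + int S * (2 * int ?k) + 2 * int S"
        and y: "a + int S * (2 * int (l0 + q)) \<le> y" "y < a + int S * (2 * int (l0 + q)) + 2 * int S"
        using that unfolding seg_def by auto
      have "int S * (2 * int ?k + 2) \<le> int S * (2 * int (l0 + q))"
        using l0 p k0 by (intro mult_left_mono) auto
      then have "x < y" using x y by (simp add: algebra_simps)
      have "y - x \<le> int S * (2 * int (l0 + q) + 2 - 2 * int ?k)"
        using x y by (simp add: algebra_simps)
      also have "\<dots> \<le> int S * (2 * (int p + int q + 3))"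
        using l0 kp by (intro mult_left_mono) auto
      finally have "y - x \<le> int S * (2 * (int p + int q + 3))" .
      then have "real_of_int (y - x) \<le> real_of_int (int S * (2 * (int p + int q + 3)))"
        by (simp only: of_int_le_iff)
      then have "real_of_int (y - x) \<le> 2 * real S * (real p + real q + 3)" by (simp add: algebra_simps)
      then have "(real_of_int (y - x))\<^sup>2 \<le> (2 * real S * (real p + real q + 3))\<^sup>2"
        using \<open>x < y\<close> by (intro power_mono) auto
      then have "1 / (2 * real S * (real p + real q + 3))\<^sup>2 \<le> 1 / (real_of_int (y - x))\<^sup>2"
        using \<open>x < y\<close> \<open>0 < S\<close> by (intro divide_left_mono) (auto intro!: mult_pos_pos)
      then show ?thesis by (simp add: power2_commute)
    qed
    then have "(\<Sum>x\<in>?X p. \<Sum>y\<in>?Y q. (1 / (2 * real S * (real p + real q + 3))\<^sup>2)) \<le> (\<Sum>x\<in>?X p. \<Sum>y\<in>?Y q. ?f x y)"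
      by (intro sum_mono)
    moreover have "(\<Sum>x\<in>?X p. \<Sum>y\<in>?Y q. (1 / (2 * real S * (real p + real q + 3))\<^sup>2))
        = real (card (?X p)) * real (card (?Y q)) * (1 / (2 * real S * (real p + real q + 3))\<^sup>2)"
      by simp
    moreover have "(\<theta> * (2 * real S)) * (\<theta> * (2 * real S)) \<le> real (card (?X p)) * real (card (?Y q))"
    proof (rule mult_mono)
      have "k0 - p \<in> left_tiles i" "l0 + q \<in> right_tiles C i"
        using k0 l0 p q unfolding l0_def by auto
      then show "\<theta> * (2 * real S) \<le> real (card (?X p))" "\<theta> * (2 * real S) \<le> real (card (?Y q))"
        using X Y unfolding spread_def by blast+
    qed (use assms in auto)
    then have "(\<theta> * (2 * real S)) * (\<theta> * (2 * real S)) * (1 / (2 * real S * (real p + real q + 3))\<^sup>2)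
       \<le> real (card (?X p)) * real (card (?Y q)) * (1 / (2 * real S * (real p + real q + 3))\<^sup>2)"
      by (rule mult_right_mono) auto
    moreover have "(\<theta> * (2 * real S)) * (\<theta> * (2 * real S)) * (1 / (2 * real S * (real p + real q + 3))\<^sup>2)
       = \<theta>\<^sup>2 / (real p + real q + 3)\<^sup>2"
      using \<open>0 < S\<close> by (simp add: power2_eq_square)
    ultimately show ?thesis by linarith
  qed
  have "ln Q \<le> harm Q"
  proof -
    have "ln Q \<le> ln (real Q + 1)" using \<open>1 \<le> Q\<close> by simp
    then show ?thesis using ln_le_harm[of Q] by simp
  qed
  also have "harm Q = (\<Sum>p<Q. 1 / (real p + 1))"
    unfolding harm_def by (simp add: sum.atLeast1_atMost_eq inverse_eq_divide add.commute)
  finally have "ln Q / 16 \<le> (\<Sum>p<Q. 1 / (real p + 1)) / 16" by simp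
  also have "\<dots> = (\<Sum>p<Q. (1 / 16) * (1 / (real p + 1)))" by (simp add: sum_divide_distrib mult.commute)
  also have "\<dots> \<le> (\<Sum>p<Q. \<Sum>q<Q. \<theta>\<^sup>2 / (real p + real q + 3)\<^sup>2)"
  proof (rule sum_mono)
    fix p assume p: "p \<in> {..<Q}"
    have th: "9 / 16 \<le> \<theta>\<^sup>2" using power_mono[OF assms(5), of 2] by (simp add: power2_eq_square)
    have "(1 / 16) * (1 / t) = t * ((9 / 16) / (3 * t)\<^sup>2)" if "0 < t" for t :: real
      using that by (simp add: power2_eq_square)
    from this[of "real p + 1"]
    have "(1 / 16) * (1 / (real p + 1)) = (\<Sum>q<Suc p. (9 / 16) / (3 * (real p + 1))\<^sup>2)"
      by (simp add: add.commute)
    also have "\<dots> \<le> (\<Sum>q<Suc p. \<theta>\<^sup>2 / (real p + real q + 3)\<^sup>2)"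
    proof (rule sum_mono)
      fix q assume "q \<in> {..<Suc p}"
      then have "(real p + real q + 3)\<^sup>2 \<le> (3 * (real p + 1))\<^sup>2" by (intro power_mono) auto
      then show "(9 / 16) / (3 * (real p + 1))\<^sup>2 \<le> \<theta>\<^sup>2 / (real p + real q + 3)\<^sup>2"
        using th by (intro frac_le) auto
    qed
    also have "\<dots> \<le> (\<Sum>q<Q. \<theta>\<^sup>2 / (real p + real q + 3)\<^sup>2)"
      using p by (intro sum_mono2) auto
    finally show "(1 / 16) * (1 / (real p + 1)) \<le> (\<Sum>q<Q. \<theta>\<^sup>2 / (real p + real q + 3)\<^sup>2)" .
  qed
  also have "\<dots> \<le> (\<Sum>p<Q. \<Sum>q<Q. \<Sum>x\<in>?X p. \<Sum>y\<in>?Y q. ?f x y)"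
    using cell by (intro sum_mono) auto
  also have "\<dots> = (\<Sum>p<Q. \<Sum>x\<in>?X p. \<Sum>q<Q. \<Sum>y\<in>?Y q. ?f x y)"
    by (intro sum.cong sum.swap refl)
  also have "\<dots> = (\<Sum>p<Q. \<Sum>x\<in>?X p. \<Sum>y\<in>(\<Union>q<Q. ?Y q). ?f x y)"
  proof (intro sum.cong refl)
    fix x
    have "\<forall>q\<in>{..<Q}. \<forall>q'\<in>{..<Q}. q \<noteq> q' \<longrightarrow> ?Y q \<inter> ?Y q' = {}"
      using disj by (metis (no_types, lifting) Int_assoc Int_empty_right Int_left_commute add_left_cancel)
    then show "(\<Sum>q<Q. \<Sum>y\<in>?Y q. ?f x y) = (\<Sum>y\<in>(\<Union>q<Q. ?Y q). ?f x y)"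
      by (subst sum.UNION_disjoint) auto
  qed
  also have "\<dots> = (\<Sum>x\<in>(\<Union>p<Q. ?X p). \<Sum>y\<in>(\<Union>q<Q. ?Y q). ?f x y)"
  proof -
    have "k0 - p \<noteq> k0 - p'" if "p < Q" "p' < Q" "p \<noteq> p'" for p p' using that k0 by auto
    then have "\<forall>p\<in>{..<Q}. \<forall>p'\<in>{..<Q}. p \<noteq> p' \<longrightarrow> ?X p \<inter> ?X p' = {}"
      using disj by (metis (no_types, lifting) Int_assoc Int_empty_right Int_left_commute lessThan_iff)
    then show ?thesis by (subst sum.UNION_disjoint) auto
  qed
  also have "\<dots> \<le> (\<Sum>x\<in>X. \<Sum>y\<in>(\<Union>q<Q. ?Y q). ?f x y)"
    using finX by (intro sum_mono2) (auto intro!: sum_nonneg)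
  also have "\<dots> \<le> (\<Sum>x\<in>X. \<Sum>y\<in>Y. ?f x y)"
    using finY by (intro sum_mono sum_mono2) auto
  finally show ?thesis .
qed

section \<open>Renormalised random graphs\<close>

text \<open>A finite region has finitely many induced graphs, so every property of them is measurable.\<close>

lemma induced_event:
  assumes "\<And>x y. {\<omega> \<in> space P. E \<omega> x y} \<in> sets P" and "finite B"
  shows "{\<omega> \<in> space P. Q (induced (E \<omega>) B)} \<in> sets P"
proof -
  have "{\<omega> \<in> space P. induced (E \<omega>) B = H} \<in> sets P" if "H \<in> Pow (B \<times> B)" for H
  proof -
    have "{\<omega> \<in> space P. induced (E \<omega>) B = H} =
      {\<omega> \<in> space P. \<forall>e\<in>B \<times> B. E \<omega> (fst e) (snd e) \<longleftrightarrow> e \<in> H}"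
      using that unfolding induced_def by (auto 0 3)
    also have "\<dots> \<in> sets P"
      using assms by (intro sets.sets_Collect_finite_All sets.sets_Collect) auto
    finally show ?thesis .
  qed
  then have "(\<Union>H\<in>{H \<in> Pow (B \<times> B). Q H}. {\<omega> \<in> space P. induced (E \<omega>) B = H}) \<in> sets P"
    using assms by (intro sets.finite_UN) auto
  also have "(\<Union>H\<in>{H \<in> Pow (B \<times> B). Q H}. {\<omega> \<in> space P. induced (E \<omega>) B = H}) =
      {\<omega> \<in> space P. Q (induced (E \<omega>) B)}"
    unfolding induced_def by auto
  finally show ?thesis .
qed

text \<open>Independence is required only for graphs induced on disjoint regions. This leaves room for
  correlated edges at a common vertex, which the random weights produce.\<close>

locale random_graph = prob_space P for P :: "'w measure" +
  fixes E :: "'w \<Rightarrow> 'v \<Rightarrow> 'v \<Rightarrow> bool"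
  assumes edge_event [measurable]: "\<And>x y. {\<omega> \<in> space P. E \<omega> x y} \<in> events"
    and edge_sym: "\<And>\<omega> x y. E \<omega> x y \<Longrightarrow> E \<omega> y x"
    and indep_regions: "\<And>B B' Q Q'. finite B \<Longrightarrow> finite B' \<Longrightarrow> B \<inter> B' = {} \<Longrightarrow>
      prob {\<omega> \<in> space P. Q (induced (E \<omega>) B) \<and> Q' (induced (E \<omega>) B')} =
      prob {\<omega> \<in> space P. Q (induced (E \<omega>) B)} * prob {\<omega> \<in> space P. Q' (induced (E \<omega>) B')}"
begin

lemma region_event: "finite B \<Longrightarrow> {\<omega> \<in> space P. Q (induced (E \<omega>) B)} \<in> events"
  by (rule induced_event[OF edge_event])

abbreviation bad_event :: "real \<Rightarrow> 'v set \<Rightarrow> 'w set" where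
  "bad_event \<theta> B \<equiv> {\<omega> \<in> space P. \<not> good_block \<theta> (E \<omega>) B}"

definition two_failures :: "real \<Rightarrow> ('j \<Rightarrow> 'v set) \<Rightarrow> 'j set \<Rightarrow> 'w set" where
  "two_failures \<theta> sub J = {\<omega> \<in> space P. \<exists>j\<in>J. \<exists>k\<in>J. sub j \<inter> sub k = {} \<and>
     \<not> good_block \<theta> (E \<omega>) (sub j) \<and> \<not> good_block \<theta> (E \<omega>) (sub k)}"

lemma two_disjoint_failures:
  fixes sub :: "'j \<Rightarrow> 'v set" and p \<theta> :: real
  assumes "finite J" and fin: "\<And>j. j \<in> J \<Longrightarrow> finite (sub j)"
    and p: "\<And>j. j \<in> J \<Longrightarrow> prob (bad_event \<theta> (sub j)) \<le> p"
  shows "prob (two_failures \<theta> sub J) \<le> (card J)\<^sup>2 * p\<^sup>2" and "two_failures \<theta> sub J \<in> events"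
proof -
  define bad where "bad j \<omega> \<longleftrightarrow> \<not> good_block \<theta> (E \<omega>) (sub j)" for j \<omega>
  define T where "T = {(j, k). j \<in> J \<and> k \<in> J \<and> sub j \<inter> sub k = {}}"
  have T: "T \<subseteq> J \<times> J" unfolding T_def by auto
  then have finT: "finite T" using assms(1) finite_subset by blast
  have ev: "{\<omega> \<in> space P. bad j \<omega>} \<in> events" if "j \<in> J" for j
    unfolding bad_def by (rule region_event[OF fin[OF that]])
  have ev2: "{\<omega> \<in> space P. bad (fst t) \<omega> \<and> bad (snd t) \<omega>} \<in> events" if "t \<in> T" for t
    using that T ev by (intro sets.sets_Collect_conj) auto
  have eq: "two_failures \<theta> sub J =
      (\<Union>t\<in>T. {\<omega> \<in> space P. bad (fst t) \<omega> \<and> bad (snd t) \<omega>})"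
    unfolding T_def two_failures_def bad_def[symmetric] by (auto; blast)
  have "prob (\<Union>t\<in>T. {\<omega> \<in> space P. bad (fst t) \<omega> \<and> bad (snd t) \<omega>})
      \<le> (\<Sum>t\<in>T. prob {\<omega> \<in> space P. bad (fst t) \<omega> \<and> bad (snd t) \<omega>})"
    using ev2 by (intro finite_measure_subadditive_finite finT) auto
  also have "\<dots> \<le> (\<Sum>t\<in>T. p\<^sup>2)"
  proof (rule sum_mono)
    fix t assume "t \<in> T"
    then have t: "fst t \<in> J" "snd t \<in> J" "sub (fst t) \<inter> sub (snd t) = {}"
      unfolding T_def by auto
    have "prob {\<omega> \<in> space P. bad (fst t) \<omega> \<and> bad (snd t) \<omega>} =
        prob {\<omega> \<in> space P. bad (fst t) \<omega>} * prob {\<omega> \<in> space P. bad (snd t) \<omega>}"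
      unfolding bad_def by (rule indep_regions[OF fin fin t(3)]) (use t in auto)
    also have "\<dots> \<le> p * p"
      unfolding bad_def by (intro mult_mono p t order_trans[OF measure_nonneg p[OF t(1)]]) auto
    finally show "prob {\<omega> \<in> space P. bad (fst t) \<omega> \<and> bad (snd t) \<omega>} \<le> p\<^sup>2"
      by (simp add: power2_eq_square)
  qed
  also have "\<dots> \<le> (card J)\<^sup>2 * p\<^sup>2"
  proof -
    have "card T \<le> (card J)\<^sup>2"
      using card_mono[OF _ T] assms(1) by (simp add: card_cartesian_product power2_eq_square)
    then have "real (card T) \<le> real ((card J)\<^sup>2)" by (simp only: of_nat_le_iff)
    then show ?thesis by (auto intro!: mult_right_mono)
  qed
  finally show "prob (two_failures \<theta> sub J) \<le> (card J)\<^sup>2 * p\<^sup>2" unfolding eq .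
  show "two_failures \<theta> sub J \<in> events"
    unfolding eq using ev2 by (intro sets.finite_UN finT) auto
qed

end

text \<open>Stays above \<open>3 / 4\<close> and absorbs a relative loss of \<open>(1 / 2) ^ n / 16\<close> at scale \<open>n\<close>, see
  \<open>cluster_density_Suc\<close>.\<close>

definition cluster_density :: "nat \<Rightarrow> real" where "cluster_density n = 7 / 8 + (1 / 8) * (1 / 2) ^ n"

lemma cluster_density_bounds: "7 / 8 \<le> cluster_density n" "cluster_density n \<le> 1"
proof -
  have "(1 / 2 :: real) ^ n \<le> 1" by (rule power_le_one) auto
  then show "7 / 8 \<le> cluster_density n" "cluster_density n \<le> 1" by (auto simp: cluster_density_def)
qed

lemma cluster_density_Suc: "cluster_density (Suc n) \<le> (1 - (1 / 2) ^ n / 16) * cluster_density n"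
proof -
  have "cluster_density (Suc n) = cluster_density n - (1 / 2) ^ n / 16" by (simp add: cluster_density_def)
  also have "\<dots> \<le> cluster_density n - (1 / 2) ^ n / 16 * cluster_density n"
    using cluster_density_bounds[of n] mult_left_le[of "cluster_density n" "(1 / 2) ^ n / 16"] by auto
  finally show ?thesis by (simp add: algebra_simps)
qed

text \<open>The number of tiles per side at step \<open>n\<close> is \<open>16 * 2 ^ n\<close> in the plane, where a fraction \<open>1 / C\<close> is lost. On the
  line it is \<open>64 * 4 ^ n\<close>, where a fraction \<open>2 Q / C\<close> with \<open>Q = 2 * 2 ^ n\<close> is lost. Both losses equal
  \<open>(1 / 2) ^ n / 16\<close>.\<close>

primrec plane_scale :: "nat \<Rightarrow> nat" where
  "plane_scale 0 = 1" | "plane_scale (Suc n) = (16 * 2 ^ n) * plane_scale n"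

primrec line_scale :: "nat \<Rightarrow> nat" where
  "line_scale 0 = 1" | "line_scale (Suc n) = (64 * 4 ^ n) * line_scale n"

lemma plane_scale_ge: "2 ^ n \<le> plane_scale n"
proof (induction n)
  case (Suc n)
  have "1 * (2 * 2 ^ n) \<le> 2 ^ n * (16 * plane_scale n)" using Suc by (intro mult_mono) auto
  then show ?case by simp
qed simp

lemma line_scale_ge: "2 ^ n \<le> line_scale n"
proof (induction n)
  case (Suc n)
  have "1 * (2 * 2 ^ n) \<le> 4 ^ n * (64 * line_scale n)" using Suc by (intro mult_mono) auto
  then show ?case by simp
qed simp

text \<open>With fewer than \<open>32 * 2 ^ n\<close> sub-blocks per side, the bound \<open>p\<close> at scale \<open>n\<close> becomes
  \<open>(32 * 2 ^ n) ^ 4 * p\<^sup>2\<close> at scale \<open>n + 1\<close>. The sequence \<open>(1 / 2) ^ 24 * (1 / 16) ^ n\<close> is a fixed point of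
  this recursion, which explains the bound in \<open>base\<close>.\<close>

locale plane_graph = random_graph P E for P :: "'w measure" and E :: "'w \<Rightarrow> int \<times> int \<Rightarrow> int \<times> int \<Rightarrow> bool" +
  assumes base: "\<And>z. prob (bad_event 1 (sq 1 z)) \<le> (1 / 2) ^ 24"
begin

lemma sparse_sq_prob:
  "prob (bad_event (cluster_density n) (sq (plane_scale n) z))
     \<le> (1 / 2) ^ 24 * (1 / 16) ^ n"
proof (induction n arbitrary: z)
  case 0
  then show ?case using base by (simp add: cluster_density_def)
next
  case (Suc n)
  define S where "S = plane_scale n"
  define C :: nat where "C = 16 * 2 ^ n"
  define \<theta> where "\<theta> = cluster_density n"
  define sub where "sub p = subseg S (fst z) (fst p) \<times> subseg S (snd z) (snd p)" for p :: "nat \<times> nat"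
  define J where "J = {..<2 * C - 1} \<times> {..<2 * C - 1}"
  let ?bad = "\<lambda>\<omega> p. \<not> good_block \<theta> (E \<omega>) (sub p)"
  let ?F = "two_failures \<theta> sub J"
  have "2 \<le> C" "0 < S" "3 / 4 < \<theta>"
    using cluster_density_bounds[of n] plane_scale_ge[of n] by (auto simp: C_def S_def \<theta>_def Suc_le_eq intro: less_le_trans[rotated])
  have sub_sq: "sub p = sq S (fst z + int S * int (fst p), snd z + int S * int (snd p))" for p
    by (simp add: sub_def sq_def)
  have IH: "prob {\<omega> \<in> space P. ?bad \<omega> p} \<le> (1 / 2) ^ 24 * (1 / 16) ^ n" for p
    using Suc.IH unfolding sub_sq S_def \<theta>_def by blast
  have "bad_event (cluster_density (Suc n)) (sq (plane_scale (Suc n)) z) \<subseteq> ?F"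
  proof (safe, rule ccontr)
    fix \<omega> assume \<omega>: "\<omega> \<in> space P"
      and no: "\<not> good_block (cluster_density (Suc n)) (E \<omega>) (sq (plane_scale (Suc n)) z)"
      and close: "\<omega> \<notin> ?F"
    have "good_block ((1 - 1 / C) * \<theta>) (E \<omega>) (sq (C * S) z)"
    proof (rule dense_sq_step[OF \<open>2 \<le> C\<close> \<open>0 < S\<close> \<open>3 / 4 < \<theta>\<close>], fold sub_def)
      fix p q
      assume "p \<in> {p. fst p < 2 * C - 1 \<and> snd p < 2 * C - 1 \<and> ?bad \<omega> p}"
        and "q \<in> {p. fst p < 2 * C - 1 \<and> snd p < 2 * C - 1 \<and> ?bad \<omega> p}"
      then have "p \<in> J" "q \<in> J" "?bad \<omega> p" "?bad \<omega> q" unfolding J_def by (auto simp: mem_Times_iff)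
      then show "sub p \<inter> sub q \<noteq> {}" using close \<omega> unfolding two_failures_def by blast
    qed
    moreover have "cluster_density (Suc n) \<le> (1 - 1 / C) * \<theta>"
      using cluster_density_Suc[of n] by (simp add: C_def \<theta>_def power_one_over mult.commute)
    moreover have "C * S = plane_scale (Suc n)" by (simp add: C_def S_def)
    ultimately show False using no dense_cluster_mono by metis
  qed
  then have "prob (bad_event (cluster_density (Suc n)) (sq (plane_scale (Suc n)) z)) \<le> prob ?F"
    by (rule finite_measure_mono) (rule two_disjoint_failures(2)[OF _ _ IH]; simp add: J_def sub_sq)
  also have "\<dots> \<le> (card J)\<^sup>2 * ((1 / 2) ^ 24 * (1 / 16) ^ n)\<^sup>2"
    by (rule two_disjoint_failures(1)) (auto simp: J_def sub_sq IH[unfolded sub_sq])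
  also have "\<dots> \<le> ((32 * 2 ^ n)\<^sup>2)\<^sup>2 * ((1 / 2) ^ 24 * (1 / 16) ^ n)\<^sup>2"
  proof (intro mult_right_mono)
    have "real (2 * C - 1) \<le> 32 * 2 ^ n" unfolding C_def by (simp add: of_nat_diff)
    then have "(real (2 * C - 1) * real (2 * C - 1))\<^sup>2 \<le> ((32 * 2 ^ n) * (32 * 2 ^ n))\<^sup>2"
      by (intro power_mono mult_mono) auto
    then show "real ((card J)\<^sup>2) \<le> ((32 * 2 ^ n)\<^sup>2)\<^sup>2"
      by (simp add: J_def card_cartesian_product power2_eq_square)
  qed auto
  also have "\<dots> = (1 / 2) ^ 28 * ((2 ^ n)^4 * ((1 / 16) ^ n)\<^sup>2)"
  proof -
    have "((32 * x)\<^sup>2)\<^sup>2 * ((1 / 2) ^ 24 * y)\<^sup>2 = (1 / 2) ^ 28 * (x ^ 4 * y\<^sup>2)" for x y :: real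
      by (simp add: power_mult_distrib power2_eq_square power4_eq_xxxx power_divide)
    then show ?thesis .
  qed
  also have "(2 ^ n)^4 * ((1 / 16) ^ n)\<^sup>2 = (1 / 16 :: real) ^ n"
  proof -
    have "(2 ^ n)^4 * ((1 / 16) ^ n)\<^sup>2 = (16 :: real) ^ n * (1 / 256) ^ n"
      by (simp add: power_mult[symmetric] mult.commute[of n] power_mult power_one_over)
    then show ?thesis by (simp add: power_mult_distrib[symmetric])
  qed
  also have "(1 / 2) ^ 28 * (1 / 16 :: real) ^ n = (1 / 2) ^ 24 * (1 / 16) ^ Suc n" by (simp add: power_divide)
  finally show ?case .
qed

end

text \<open>The hypothesis \<open>crossing\<close> says that, given the graphs inside two regions, the edges between them are
  absent at most as often as for independent edges with connection probabilities
  \<open>1 - exp (- \<beta> / (x - y)\<^sup>2)\<close>. A gap at scale \<open>n\<close> then stays unbridged with probability at most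
  \<open>Q powr (- \<beta> / 16)\<close> with \<open>Q = 2 * 2 ^ n\<close>. The value \<open>496 = 16 * 31\<close> makes the exponent \<open>31\<close>, which beats
  the number of possible gaps and the required decay \<open>(1 / 16) ^ n\<close>.\<close>

locale line_graph = random_graph P E for P :: "'w measure" and E :: "'w \<Rightarrow> int \<Rightarrow> int \<Rightarrow> bool" +
  fixes \<beta> :: real
  assumes base: "\<And>z. prob (bad_event 1 (seg 1 z)) \<le> (1 / 2) ^ 19"
    and crossing: "\<And>A B X Y Q Q'. finite A \<Longrightarrow> finite B \<Longrightarrow> A \<inter> B = {} \<Longrightarrow> X \<subseteq> A \<Longrightarrow> Y \<subseteq> B \<Longrightarrow>
      prob {\<omega> \<in> space P. (Q (induced (E \<omega>) A) \<and> Q' (induced (E \<omega>) B)) \<and> (\<forall>x\<in>X. \<forall>y\<in>Y. \<not> E \<omega> x y)} \<le>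
      prob {\<omega> \<in> space P. Q (induced (E \<omega>) A) \<and> Q' (induced (E \<omega>) B)} *
        exp (- \<beta> * (\<Sum>x\<in>X. \<Sum>y\<in>Y. 1 / (real_of_int (x - y))\<^sup>2))"
    and beta: "496 \<le> \<beta>"
begin

text \<open>Once a cluster on each side is selected as a function of the graph on that side, the edges
  across the gap are independent of the selection. Conditioning on the selected pair, of which there
  are finitely many, avoids a union bound over all pairs of clusters.\<close>

lemma bridge_failure_prob:
  fixes \<theta> :: real and S C Q i :: nat and a :: int
  assumes "1 \<le> Q" "2 * Q \<le> i" "i + 2 * Q + 3 \<le> 2 * C" "0 < S" "3 / 4 \<le> \<theta>"
  defines "A \<equiv> left_part S a i" and "B \<equiv> right_part C S a i"
  defines "L \<equiv> \<lambda>H. SOME X. spread \<theta> S a (left_tiles i) A X H"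
    and "R \<equiv> \<lambda>H. SOME Y. spread \<theta> S a (right_tiles C i) B Y H"
  defines "F \<equiv> {\<omega> \<in> space P. spread \<theta> S a (left_tiles i) A (L (induced (E \<omega>) A)) (induced (E \<omega>) A) \<and>
      spread \<theta> S a (right_tiles C i) B (R (induced (E \<omega>) B)) (induced (E \<omega>) B) \<and>
      (\<forall>x\<in>L (induced (E \<omega>) A). \<forall>y\<in>R (induced (E \<omega>) B). \<not> E \<omega> x y)}"
  shows "prob F \<le> exp (- \<beta> * (ln Q / 16))" and "F \<in> events"
proof -
  have fin: "finite A" "finite B" and disj: "A \<inter> B = {}"
    unfolding A_def B_def left_part_def right_part_def by (auto simp: algebra_simps)
  let ?T = "Pow A \<times> Pow B"
  (* G fixes the selected clusters, and N says that no edge joins them. *)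
  define G where "G = (\<lambda>(X, Y). {\<omega> \<in> space P.
      ((spread \<theta> S a (left_tiles i) A X (induced (E \<omega>) A) \<and> L (induced (E \<omega>) A) = X) \<and>
       (spread \<theta> S a (right_tiles C i) B Y (induced (E \<omega>) B) \<and> R (induced (E \<omega>) B) = Y))})"
  define N where "N = (\<lambda>(X, Y). {\<omega> \<in> space P. \<forall>x\<in>X. \<forall>y\<in>Y. \<not> E \<omega> x y})"
  have Gev: "G t \<in> events" if "t \<in> ?T" for t
    unfolding G_def using region_event[OF fin(1)] region_event[OF fin(2)]
    by (auto intro!: sets.sets_Collect_conj split: prod.split)
  have Nev: "N t \<in> events" if "t \<in> ?T" for t
    unfolding N_def using that fin
    by (auto intro!: sets.sets_Collect_finite_All sets.sets_Collect_neg edge_event finite_subset split: prod.splits)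
  have finT: "finite ?T" using fin by simp
  have F: "F = (\<Union>t\<in>?T. G t \<inter> N t)"
    unfolding F_def G_def N_def spread_def by auto
  show "F \<in> events" unfolding F using Gev Nev finT by (intro sets.finite_UN) auto
  have GN: "prob (G t \<inter> N t) \<le> prob (G t) * exp (- \<beta> * (ln Q / 16))" if "t \<in> ?T" for t
  proof (cases "G t = {}")
    case True
    then show ?thesis by simp
  next
    case False
    obtain X Y where t: "t = (X, Y)" by (cases t)
    with that have XY: "X \<subseteq> A" "Y \<subseteq> B" by auto
    from False obtain \<omega> where
      "spread \<theta> S a (left_tiles i) A X (induced (E \<omega>) A)"
      "spread \<theta> S a (right_tiles C i) B Y (induced (E \<omega>) B)"
      unfolding t G_def by auto
    then have en: "ln Q / 16 \<le> (\<Sum>x\<in>X. \<Sum>y\<in>Y. 1 / (real_of_int (x - y))\<^sup>2)"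
      using bridge_energy[OF assms(1-5)] unfolding A_def B_def by blast
    have "prob (G t \<inter> N t) = prob {\<omega> \<in> space P.
      ((spread \<theta> S a (left_tiles i) A X (induced (E \<omega>) A) \<and> L (induced (E \<omega>) A) = X) \<and>
       (spread \<theta> S a (right_tiles C i) B Y (induced (E \<omega>) B) \<and> R (induced (E \<omega>) B) = Y)) \<and>
       (\<forall>x\<in>X. \<forall>y\<in>Y. \<not> E \<omega> x y)}"
      unfolding t G_def N_def by (rule arg_cong[where f = prob]) auto
    also have "\<dots> \<le> prob (G t) * exp (- \<beta> * (\<Sum>x\<in>X. \<Sum>y\<in>Y. 1 / (real_of_int (x - y))\<^sup>2))"
      unfolding t G_def prod.case by (rule crossing[OF fin disj XY])
    also have "\<dots> \<le> prob (G t) * exp (- \<beta> * (ln Q / 16))"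
    proof -
      have "\<beta> * (ln Q / 16) \<le> \<beta> * (\<Sum>x\<in>X. \<Sum>y\<in>Y. 1 / (real_of_int (x - y))\<^sup>2)"
        using en beta by (intro mult_left_mono) auto
      then show ?thesis by (intro mult_left_mono) auto
    qed
    finally show ?thesis .
  qed
  have "prob F \<le> (\<Sum>t\<in>?T. prob (G t \<inter> N t))"
    unfolding F using Gev Nev finT by (intro finite_measure_subadditive_finite) auto
  also have "\<dots> \<le> (\<Sum>t\<in>?T. prob (G t) * exp (- \<beta> * (ln Q / 16)))"
    by (intro sum_mono GN)
  also have "\<dots> = (\<Sum>t\<in>?T. prob (G t)) * exp (- \<beta> * (ln Q / 16))"
    by (rule sum_distrib_right[symmetric])
  also have "(\<Sum>t\<in>?T. prob (G t)) = prob (\<Union>t\<in>?T. G t)"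
    using Gev by (intro finite_measure_finite_Union[symmetric] finT) (auto simp: disjoint_family_on_def G_def)
  also have "prob (\<Union>t\<in>?T. G t) * exp (- \<beta> * (ln Q / 16)) \<le> 1 * exp (- \<beta> * (ln Q / 16))"
    by (intro mult_right_mono prob_le_1) auto
  finally show "prob F \<le> exp (- \<beta> * (ln Q / 16))" by simp
qed

text \<open>A failure at scale \<open>n + 1\<close> requires two disjoint bad sub-blocks or an unbridged gap. Each of the
  two contributes at most \<open>(1 / 2) ^ 24 * (1 / 16) ^ n\<close>, and these add up to
  \<open>(1 / 2) ^ 19 * (1 / 16) ^ (n + 1)\<close>.\<close>

lemma sparse_seg_prob:
  "prob (bad_event (cluster_density n) (seg (line_scale n) a))
     \<le> (1 / 2) ^ 19 * (1 / 16) ^ n"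
proof (induction n arbitrary: a)
  case 0
  then show ?case using base by (simp add: cluster_density_def)
next
  case (Suc n)
  define S where "S = line_scale n"
  define C :: nat where "C = 64 * 4 ^ n"
  define Q :: nat where "Q = 2 * 2 ^ n"
  define \<theta> where "\<theta> = cluster_density n"
  define m where "m = 2 * C - 1"
  define A where "A = left_part S a"
  define B where "B = right_part C S a"
  define L where "L i H = (SOME X. spread \<theta> S a (left_tiles i) (A i) X H)" for i H
  define R where "R i H = (SOME Y. spread \<theta> S a (right_tiles C i) (B i) Y H)" for i H
  define F where "F i = {\<omega> \<in> space P. spread \<theta> S a (left_tiles i) (A i) (L i (induced (E \<omega>) (A i))) (induced (E \<omega>) (A i)) \<and>
      spread \<theta> S a (right_tiles C i) (B i) (R i (induced (E \<omega>) (B i))) (induced (E \<omega>) (B i)) \<and>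
      (\<forall>x\<in>L i (induced (E \<omega>) (A i)). \<forall>y\<in>R i (induced (E \<omega>) (B i)). \<not> E \<omega> x y)}" for i
  define I where "I = {i. 2 * Q \<le> i \<and> i + 2 * Q + 3 \<le> 2 * C}"
  define sub where "sub = subseg S a"
  let ?bad = "\<lambda>\<omega> p. \<not> good_block \<theta> (E \<omega>) (sub p)"
  let ?D = "two_failures \<theta> sub {..<m}"
  have th: "3 / 4 < \<theta>" using cluster_density_bounds[of n] by (auto simp: \<theta>_def)
  have S: "0 < S" using less_le_trans[OF _ line_scale_ge[of n], of 0] by (simp add: S_def)
  have Q: "1 \<le> Q" by (simp add: Q_def)
  have QC: "2 * Q + 2 \<le> C"
  proof -
    have "(2::nat) ^ n \<le> 4 ^ n" by (rule power_mono) auto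
    moreover have "(1::nat) \<le> 4 ^ n" by simp
    ultimately show ?thesis unfolding Q_def C_def by linarith
  qed
  have finI: "finite I" and cardI: "card I \<le> m"
  proof -
    have "I \<subseteq> {..<m}" unfolding I_def m_def by auto
    then show "finite I" "card I \<le> m" using finite_subset card_mono[of "{..<m}" I] by auto
  qed
  have F: "prob (F i) \<le> exp (- \<beta> * (ln Q / 16))" "F i \<in> events" if "i \<in> I" for i
    using bridge_failure_prob[OF Q _ _ S, of i C \<theta> a] that th
    unfolding F_def L_def R_def A_def B_def I_def by auto
  have IH: "prob {\<omega> \<in> space P. ?bad \<omega> p} \<le> (1 / 2) ^ 19 * (1 / 16) ^ n" for p
    using Suc.IH unfolding sub_def S_def \<theta>_def by blast
  have D: "?D \<in> events" "prob ?D \<le> (card {..<m})\<^sup>2 * ((1 / 2) ^ 19 * (1 / 16) ^ n)\<^sup>2"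
    by (rule two_disjoint_failures; use IH in \<open>auto simp: sub_def\<close>)+
  have "bad_event (cluster_density (Suc n)) (seg (line_scale (Suc n)) a) \<subseteq> ?D \<union> (\<Union>i\<in>I. F i)"
  proof (rule subsetI, rule ccontr)
    fix \<omega> assume "\<omega> \<in> bad_event (cluster_density (Suc n)) (seg (line_scale (Suc n)) a)"
    then have \<omega>: "\<omega> \<in> space P"
      and no: "\<not> good_block (cluster_density (Suc n)) (E \<omega>) (seg (line_scale (Suc n)) a)"
      by auto
    assume nD: "\<omega> \<notin> ?D \<union> (\<Union>i\<in>I. F i)"
    have "good_block ((1 - (2 * Q) / C) * \<theta>) (E \<omega>) (seg (C * S) a)"
    proof (rule dense_seg_step[OF Q QC S th edge_sym])
      fix j k assume "j \<in> {j. j < 2 * C - 1 \<and> \<not> good_block \<theta> (E \<omega>) (subseg S a j)}"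
        "k \<in> {j. j < 2 * C - 1 \<and> \<not> good_block \<theta> (E \<omega>) (subseg S a j)}"
      then show "subseg S a j \<inter> subseg S a k \<noteq> {}"
        using nD \<omega> unfolding two_failures_def sub_def m_def by blast
    next
      fix i :: nat
      assume i: "2 * Q \<le> i" "i + 2 * Q + 3 \<le> 2 * C"
        and l: "\<exists>X. left_cluster \<theta> S a i X (induced (E \<omega>) (left_part S a i))"
        and r: "\<exists>Y. right_cluster \<theta> C S a i Y (induced (E \<omega>) (right_part C S a i))"
      have "spread \<theta> S a (left_tiles i) (A i) (L i (induced (E \<omega>) (A i))) (induced (E \<omega>) (A i))"
        unfolding L_def using someI_ex[OF l] unfolding A_def .
      moreover have "spread \<theta> S a (right_tiles C i) (B i) (R i (induced (E \<omega>) (B i))) (induced (E \<omega>) (B i))"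
        unfolding R_def using someI_ex[OF r] unfolding B_def .
      moreover have "\<omega> \<notin> F i" using nD i unfolding I_def by blast
      ultimately show "\<exists>X Y. left_cluster \<theta> S a i X (induced (E \<omega>) (left_part S a i)) \<and>
          right_cluster \<theta> C S a i Y (induced (E \<omega>) (right_part C S a i)) \<and>
          (\<exists>x\<in>X. \<exists>y\<in>Y. E \<omega> x y)"
        using \<omega> unfolding F_def A_def B_def by blast
    qed
    moreover have "cluster_density (Suc n) \<le> (1 - (2 * Q) / C) * \<theta>"
    proof -
      have "real (2 * Q) / C = (1 / 2) ^ n / 16"
      proof -
        have "(4::real) ^ n = 2 ^ n * 2 ^ n" by (simp add: power_mult_distrib[symmetric])
        then show ?thesis by (simp add: Q_def C_def power_one_over)
      qed
      then show ?thesis using cluster_density_Suc[of n] unfolding \<theta>_def by (simp only:)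
    qed
    moreover have "C * S = line_scale (Suc n)" by (simp add: C_def S_def)
    ultimately show False using no dense_cluster_mono by metis
  qed
  then have "prob (bad_event (cluster_density (Suc n)) (seg (line_scale (Suc n)) a))
     \<le> prob (?D \<union> (\<Union>i\<in>I. F i))"
    using D(1) F(2) finI by (intro finite_measure_mono) auto
  also have "\<dots> \<le> prob ?D + prob (\<Union>i\<in>I. F i)"
    using D(1) F(2) finI by (intro measure_Un_le) auto
  also have "prob (\<Union>i\<in>I. F i) \<le> (\<Sum>i\<in>I. prob (F i))"
    using F(2) finI by (intro finite_measure_subadditive_finite) auto
  also have "\<dots> \<le> (\<Sum>i\<in>I. exp (- \<beta> * (ln Q / 16)))" using F(1) by (intro sum_mono) auto
  also have "\<dots> \<le> real m * exp (- \<beta> * (ln Q / 16))" using cardI by (auto intro!: mult_right_mono)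
  also have "prob ?D \<le> (real m)\<^sup>2 * ((1 / 2) ^ 19 * (1 / 16) ^ n)\<^sup>2" using D(2) by simp
  finally have *: "prob (bad_event (cluster_density (Suc n)) (seg (line_scale (Suc n)) a))
     \<le> (real m)\<^sup>2 * ((1 / 2) ^ 19 * (1 / 16) ^ n)\<^sup>2 + real m * exp (- \<beta> * (ln Q / 16))"
    by simp
  (* First the two disjoint bad sub-blocks, then the unbridged gaps. *)
  have m: "real m \<le> 128 * 4 ^ n" unfolding m_def C_def by (simp add: of_nat_diff)
  have "(real m)\<^sup>2 * ((1 / 2) ^ 19 * (1 / 16) ^ n)\<^sup>2 \<le> (128 * 4 ^ n)\<^sup>2 * ((1 / 2) ^ 19 * (1 / 16) ^ n)\<^sup>2"
    using m by (intro mult_right_mono power_mono) auto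
  also have "\<dots> = (1 / 2) ^ 24 * ((4 ^ n)\<^sup>2 * ((1 / 16) ^ n)\<^sup>2)"
  proof -
    have "(128 * x)\<^sup>2 * ((1 / 2) ^ 19 * y)\<^sup>2 = (1 / 2) ^ 24 * (x\<^sup>2 * y\<^sup>2)" for x y :: real
      by (simp add: power_mult_distrib power2_eq_square power_divide)
    then show ?thesis .
  qed
  also have "(4 ^ n)\<^sup>2 * ((1 / 16) ^ n)\<^sup>2 = (1 / 16 :: real) ^ n"
  proof -
    have "(4 ^ n)\<^sup>2 * ((1 / 16) ^ n)\<^sup>2 = (16 :: real) ^ n * (1 / 256) ^ n"
      by (simp add: power_mult[symmetric] mult.commute[of n] power_mult power_one_over)
    then show ?thesis by (simp add: power_mult_distrib[symmetric])
  qed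
  finally have 1: "(real m)\<^sup>2 * ((1 / 2) ^ 19 * (1 / 16) ^ n)\<^sup>2 \<le> (1 / 2) ^ 24 * (1 / 16) ^ n" .
  have "exp (- \<beta> * (ln Q / 16)) \<le> exp (- 496 * (ln Q / 16))"
  proof -
    have "0 \<le> ln (real Q)" using Q by simp
    then have "496 * (ln Q / 16) \<le> \<beta> * (ln Q / 16)" using beta by (intro mult_right_mono) auto
    then show ?thesis by simp
  qed
  also have "- 496 * (ln (real Q) / 16) = - (real 31 * ln Q)" by simp
  also have "exp (- (real 31 * ln Q)) = (1 / Q) ^ 31"
    unfolding exp_minus exp_of_nat_mult using Q by (simp add: power_one_over inverse_eq_divide)
  also have "\<dots> = (1 / 2) ^ 31 * ((1 / 2) ^ 31) ^ n"
  proof -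
    have "1 / real Q = (1 / 2) * (1 / 2) ^ n" by (simp add: Q_def power_one_over)
    moreover have "((1 / 2 :: real) ^ n) ^ 31 = ((1 / 2) ^ 31) ^ n"
      by (simp only: power_mult[symmetric] mult.commute)
    ultimately show ?thesis by (simp only: power_mult_distrib)
  qed
  also have "\<dots> \<le> (1 / 2) ^ 31 * ((1 / 2) ^ 6) ^ n"
    by (intro mult_left_mono power_mono power_decreasing) auto
  finally have "real m * exp (- \<beta> * (ln Q / 16)) \<le> (128 * 4 ^ n) * ((1 / 2) ^ 31 * ((1 / 2) ^ 6) ^ n)"
    using m by (intro mult_mono) auto
  also have "\<dots> = (1 / 2) ^ 24 * (4 ^ n * (1 / 64) ^ n)" by (simp add: power_divide)
  also have "4 ^ n * (1 / 64) ^ n = (1 / 16 :: real) ^ n" by (simp add: power_mult_distrib[symmetric])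
  finally have 2: "real m * exp (- \<beta> * (ln Q / 16)) \<le> (1 / 2) ^ 24 * (1 / 16) ^ n" .
  have "(1 / 2) ^ 24 * (1 / 16) ^ n + (1 / 2) ^ 24 * (1 / 16) ^ n = (1 / 2) ^ 19 * (1 / 16 :: real) ^ Suc n" by (simp add: power_divide)
  then show ?case using * 1 2 by linarith
qed

end

section \<open>Scale-free percolation on a product space\<close>

lemma (in product_prob_space) coordinates_indep_vars:
  "P.indep_vars M (\<lambda>i z. z i) I" if "I \<noteq> {}"
proof (rule P.indep_vars_iff_distr_eq_PiM'[OF that, THEN iffD2])
  show "(\<lambda>z. z i) \<in> Pi\<^sub>M I M \<rightarrow>\<^sub>M M i" if "i \<in> I" for i
    using that by (rule measurable_component_singleton)
  have "distr (Pi\<^sub>M I M) (Pi\<^sub>M I M) (\<lambda>z. \<lambda>i\<in>I. z i) = distr (Pi\<^sub>M I M) (Pi\<^sub>M I M) (\<lambda>z. z)"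
  proof (rule distr_cong[OF refl refl])
    fix z assume "z \<in> space (Pi\<^sub>M I M)"
    then show "(\<lambda>i\<in>I. z i) = z" by (simp add: space_PiM PiE_iff extensional_restrict)
  qed
  also have "\<dots> = Pi\<^sub>M I M" by (rule distr_id2) simp
  also have "\<dots> = (\<Pi>\<^sub>M i\<in>I. distr (Pi\<^sub>M I M) (M i) (\<lambda>z. z i))"
    by (rule PiM_cong[OF refl PiM_component[symmetric]])
  finally show "distr (Pi\<^sub>M I M) (Pi\<^sub>M I M) (\<lambda>z. \<lambda>i\<in>I. z i) = (\<Pi>\<^sub>M i\<in>I. distr (Pi\<^sub>M I M) (M i) (\<lambda>z. z i))" .
qed

text \<open>An event that depends only on the coordinates in \<open>J\<close> is the preimage of its section at a fixed
  point under the projection to \<open>J\<close>, so the independence of the two projections applies.\<close>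

lemma (in product_prob_space) prob_Int_disjoint_coordinates:
  assumes ne: "I \<noteq> {}"
    and A: "A \<in> sets (Pi\<^sub>M I M)" and B: "B \<in> sets (Pi\<^sub>M I M)"
    and JK: "J \<subseteq> I" "K \<subseteq> I" "J \<inter> K = {}"
    and depA: "\<And>z z'. z \<in> A \<Longrightarrow> z' \<in> space (Pi\<^sub>M I M) \<Longrightarrow> (\<And>i. i \<in> J \<Longrightarrow> z i = z' i) \<Longrightarrow> z' \<in> A"
    and depB: "\<And>z z'. z \<in> B \<Longrightarrow> z' \<in> space (Pi\<^sub>M I M) \<Longrightarrow> (\<And>i. i \<in> K \<Longrightarrow> z i = z' i) \<Longrightarrow> z' \<in> B"
  shows "measure (Pi\<^sub>M I M) (A \<inter> B) = measure (Pi\<^sub>M I M) A * measure (Pi\<^sub>M I M) B"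
proof -
  let ?P = "Pi\<^sub>M I M"
  obtain z0 where z0: "z0 \<in> space ?P" using P.not_empty by (metis ex_in_conv)
  (* Completes a point of the projection to L by the coordinates of z0. *)
  define fill where "fill L y = (\<lambda>i. if i \<in> L then y i else z0 i)" for L y
  have fill_meas: "fill L \<in> measurable (Pi\<^sub>M L M) ?P" if "L \<subseteq> I" for L
  proof (rule measurable_PiM_single')
    show "(\<lambda>y. fill L y i) \<in> measurable (Pi\<^sub>M L M) (M i)" if "i \<in> I" for i
      using z0 that by (cases "i \<in> L") (auto simp: fill_def space_PiM PiE_iff)
    show "fill L \<in> space (Pi\<^sub>M L M) \<rightarrow> (\<Pi>\<^sub>E i\<in>I. space (M i))"
      using z0 that by (auto simp: fill_def space_PiM PiE_iff extensional_def)
  qed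
  have ind: "P.indep_var (Pi\<^sub>M J M) (\<lambda>z. restrict (\<lambda>i. z i) J) (Pi\<^sub>M K M) (\<lambda>z. restrict (\<lambda>i. z i) K)"
    by (rule P.indep_var_restrict[OF coordinates_indep_vars[OF ne] JK(3,1,2)])
  define A' where "A' = fill J -` A \<inter> space (Pi\<^sub>M J M)"
  define B' where "B' = fill K -` B \<inter> space (Pi\<^sub>M K M)"
  have A': "A' \<in> sets (Pi\<^sub>M J M)" and B': "B' \<in> sets (Pi\<^sub>M K M)"
    unfolding A'_def B'_def
    by (rule measurable_sets[OF fill_meas[OF JK(1)] A] measurable_sets[OF fill_meas[OF JK(2)] B])+
  have restr: "restrict z L \<in> space (Pi\<^sub>M L M)" "fill L (restrict z L) \<in> space ?P"
    if "z \<in> space ?P" "L \<subseteq> I" for z L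
  proof -
    show *: "restrict z L \<in> space (Pi\<^sub>M L M)"
      using that by (auto simp: space_PiM PiE_iff)
    show "fill L (restrict z L) \<in> space ?P"
      by (rule measurable_space[OF fill_meas[OF that(2)] *])
  qed
  have recover: "(\<lambda>z. restrict (\<lambda>i. z i) L) -` (fill L -` X \<inter> space (Pi\<^sub>M L M)) \<inter> space ?P = X"
    if X: "X \<in> sets ?P" and L: "L \<subseteq> I"
      and dep: "\<And>z z'. z \<in> X \<Longrightarrow> z' \<in> space ?P \<Longrightarrow> (\<And>i. i \<in> L \<Longrightarrow> z i = z' i) \<Longrightarrow> z' \<in> X" for X L
  proof (intro set_eqI iffI)
    fix z assume "z \<in> (\<lambda>z. restrict (\<lambda>i. z i) L) -` (fill L -` X \<inter> space (Pi\<^sub>M L M)) \<inter> space ?P"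
    then have "fill L (restrict z L) \<in> X" "z \<in> space ?P" by auto
    then show "z \<in> X" by (rule dep) (simp add: fill_def)
  next
    fix z assume z: "z \<in> X"
    then have zs: "z \<in> space ?P" using sets.sets_into_space[OF X] by blast
    have "fill L (restrict z L) \<in> X"
      using z restr(2)[OF zs L] by (rule dep) (simp add: fill_def)
    then show "z \<in> (\<lambda>z. restrict (\<lambda>i. z i) L) -` (fill L -` X \<inter> space (Pi\<^sub>M L M)) \<inter> space ?P"
      using zs restr(1)[OF zs L] by simp
  qed
  have AA: "(\<lambda>z. restrict (\<lambda>i. z i) J) -` A' \<inter> space ?P = A"
    unfolding A'_def using A JK(1) depA by (rule recover)
  have BB: "(\<lambda>z. restrict (\<lambda>i. z i) K) -` B' \<inter> space ?P = B"
    unfolding B'_def using B JK(2) depB by (rule recover)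
  have "(\<lambda>z. (restrict (\<lambda>i. z i) J, restrict (\<lambda>i. z i) K)) -` (A' \<times> B') \<inter> space ?P = A \<inter> B"
    using AA BB by blast
  with P.indep_varD[OF ind A' B'] show ?thesis unfolding AA BB by (simp only:)
qed

definition unit_uniform :: "real measure" where
  "unit_uniform = uniform_measure lborel {0..1}"

lemma prob_space_unit_uniform: "prob_space unit_uniform"
  unfolding unit_uniform_def by (intro prob_space_uniform_measure) auto

lemma sets_unit_uniform [measurable_cong, simp]: "sets unit_uniform = sets borel"
  by (simp add: unit_uniform_def)

lemma space_unit_uniform [simp]: "space unit_uniform = UNIV"
  by (simp add: unit_uniform_def)

lemma measure_unit_uniform_less:
  assumes "0 \<le> p" "p \<le> 1"
  shows "measure unit_uniform {..<p} = p"
proof -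
  have "{0..1} \<inter> {..<p} = {0..<p}" using assms by auto
  then show ?thesis unfolding unit_uniform_def using assms
    by (subst measure_uniform_measure) auto
qed

lemma distr_unit_uniform_less:
  assumes "0 \<le> p" "p \<le> 1"
  shows "distr unit_uniform (count_space UNIV) (\<lambda>u. u < p) = measure_pmf (bernoulli_pmf p)"
proof -
  interpret U: prob_space unit_uniform by (rule prob_space_unit_uniform)
  have m [measurable]: "(\<lambda>u. u < p) \<in> measurable unit_uniform (count_space UNIV)" by measurable
  have T: "measure unit_uniform {u. u < p} = p"
    using measure_unit_uniform_less[OF assms] by (simp add: lessThan_def)
  have F: "measure unit_uniform {u. \<not> u < p} = 1 - p"
    using U.prob_neg[of "\<lambda>u. u < p"] T by simp
  show ?thesis
  proof (rule measure_eqI_countable[where A = UNIV])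
    fix b :: bool assume "b \<in> UNIV"
    have pre: "(\<lambda>u. u < p) -` {True} = {u. u < p}" "(\<lambda>u. u < p) -` {False} = {u. \<not> u < p}" by auto
    have "emeasure (distr unit_uniform (count_space UNIV) (\<lambda>u. u < p)) {b} = ennreal (if b then p else 1 - p)"
      by (cases b) (simp_all add: emeasure_distr pre U.emeasure_eq_measure T F)
    also have "ennreal (if b then p else 1 - p) = emeasure (measure_pmf (bernoulli_pmf p)) {b}"
      using assms by (cases b) (simp_all add: emeasure_pmf_single)
    finally show "emeasure (distr unit_uniform (count_space UNIV) (\<lambda>u. u < p)) {b} = emeasure (measure_pmf (bernoulli_pmf p)) {b}" .
  qed auto
qed

type_synonym 'v site_or_edge = "'v + 'v set"

text \<open>The coordinate \<open>Inl x\<close> is the weight of the vertex \<open>x\<close>, and \<open>Inr e\<close> is the uniform variable of the edge \<open>e\<close>.\<close>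

definition coordinate_law :: "real measure \<Rightarrow> 'v site_or_edge \<Rightarrow> real measure" where
  "coordinate_law D i = (case i of Inl _ \<Rightarrow> D | Inr _ \<Rightarrow> unit_uniform)"

definition open_edge :: "real \<Rightarrow> real \<Rightarrow> ((int ^ 'd) site_or_edge \<Rightarrow> real) \<Rightarrow> (int ^ 'd) set \<Rightarrow> bool" where
  "open_edge \<alpha> lam z e \<longleftrightarrow> z (Inr e) < edge_prob \<alpha> lam (\<lambda>x. z (Inl x)) e"

lemma edges_cases:
  assumes "e \<in> edges" obtains x y where "e = {x, y}" "x \<noteq> y"
  using assms by (auto simp: edges_def)

locale iid_weights = prob_space M for M :: "'a measure" +
  fixes W :: "int ^ 'd \<Rightarrow> 'a \<Rightarrow> real" and D :: "real measure"
  assumes indep: "indep_vars (\<lambda>_. borel) W UNIV"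
    and law: "\<And>x. distr M borel (W x) = D"
    and nonneg: "\<And>x \<omega>. \<omega> \<in> space M \<Longrightarrow> 0 \<le> W x \<omega>"
begin

text \<open>Fixes the type of the vertices, which \<open>coordinate_law\<close> leaves open.\<close>

abbreviation site_edge_law :: "(int ^ 'd) site_or_edge \<Rightarrow> real measure" where
  "site_edge_law \<equiv> coordinate_law D"

abbreviation seeds :: "((int ^ 'd) site_or_edge \<Rightarrow> real) measure" where
  "seeds \<equiv> PiM UNIV site_edge_law"

lemma W_measurable [measurable]: "W x \<in> borel_measurable M"
  using indep by (simp add: indep_vars_def)

lemma prob_space_D: "prob_space D"
  unfolding law[of 0, symmetric] by (rule prob_space_distr[OF W_measurable])

lemma sets_D [measurable_cong, simp]: "sets D = sets borel"
  unfolding law[of 0, symmetric] by (rule sets_distr)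

lemma space_D [simp]: "space D = UNIV"
  using sets_eq_imp_space_eq[OF sets_D] by simp

lemma sets_coordinate [measurable_cong, simp]: "sets (site_edge_law i) = sets borel"
  by (cases i) (auto simp: coordinate_law_def)

lemma space_coordinate [simp]: "space (site_edge_law i) = UNIV"
  using sets_eq_imp_space_eq[OF sets_coordinate] by simp

lemma space_seeds [simp]: "space seeds = UNIV"
  by (simp add: space_PiM)

sublocale seed: product_prob_space site_edge_law UNIV
proof -
  have "prob_space (site_edge_law i)" for i
    by (cases i) (auto simp: coordinate_law_def prob_space_D prob_space_unit_uniform)
  then show "product_prob_space site_edge_law"
    by (intro product_prob_spaceI)
qed

lemma coordinate_measurable: "(\<lambda>z. z i) \<in> borel_measurable seeds"
proof -
  have "(\<lambda>z. z i) \<in> measurable seeds (site_edge_law i)" by simp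
  then show ?thesis using measurable_cong_sets[OF refl sets_coordinate] by blast
qed

abbreviation uniforms :: "((int ^ 'd) set \<Rightarrow> real) measure" where
  "uniforms \<equiv> PiM UNIV (\<lambda>_. unit_uniform)"

definition seed_of :: "'a \<times> ((int ^ 'd) set \<Rightarrow> real) \<Rightarrow> (int ^ 'd) site_or_edge \<Rightarrow> real" where
  "seed_of p i = (case i of Inl x \<Rightarrow> W x (fst p) | Inr e \<Rightarrow> snd p e)"

lemma seed_of_measurable [measurable]: "seed_of \<in> measurable (M \<Otimes>\<^sub>M uniforms) seeds"
proof (rule measurable_PiM_single')
  fix i :: "(int ^ 'd) site_or_edge"
  have "(\<lambda>p. seed_of p i) \<in> borel_measurable (M \<Otimes>\<^sub>M uniforms)"
  proof (cases i)
    case (Inl x)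
    then show ?thesis unfolding seed_of_def by simp
  next
    case (Inr e)
    have "(\<lambda>u. u e) \<in> borel_measurable uniforms"
      using measurable_component_singleton[of e UNIV "\<lambda>_. unit_uniform"]
        measurable_cong_sets[OF refl sets_unit_uniform] by blast
    then show ?thesis unfolding seed_of_def Inr sum.case by measurable
  qed
  then show "(\<lambda>p. seed_of p i) \<in> measurable (M \<Otimes>\<^sub>M uniforms) (site_edge_law i)"
    using measurable_cong_sets[OF refl sets_coordinate] by blast
qed auto

text \<open>The given weights, together with uniform variables from a separate factor, have the product law. This
  carries over results from the abstract space \<open>M\<close> to the concrete one.\<close>

lemma distr_seed_of: "distr (M \<Otimes>\<^sub>M uniforms) seeds seed_of = seeds"
proof (rule seed.PiM_eq)
  interpret U: product_prob_space "\<lambda>_::(int ^ 'd) set. unit_uniform" UNIV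
    by (intro product_prob_spaceI prob_space_unit_uniform)
  interpret D: prob_space D by (rule prob_space_D)
  fix J :: "(int ^ 'd) site_or_edge set" and F
  assume J: "finite J" "J \<subseteq> UNIV" and F: "\<And>j. j \<in> J \<Longrightarrow> F j \<in> sets (site_edge_law j)"
  define J1 where "J1 = Inl -` J"
  define J2 where "J2 = Inr -` J"
  have fin: "finite J1" "finite J2" unfolding J1_def J2_def using J by (auto intro!: finite_vimageI)
  have JJ: "J = Inl ` J1 \<union> Inr ` J2" unfolding J1_def J2_def
    by (auto simp: image_iff) (metis sum.exhaust)
  have F1: "F (Inl x) \<in> sets borel" if "x \<in> J1" for x
    using F[of "Inl x"] that unfolding J1_def by (simp add: )
  have F2: "F (Inr e) \<in> sets unit_uniform" if "e \<in> J2" for e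
    using F[of "Inr e"] that unfolding J2_def by (simp add: )
  let ?A = "{\<omega> \<in> space M. \<forall>x\<in>J1. W x \<omega> \<in> F (Inl x)}"
  let ?B = "{u \<in> space uniforms. \<forall>e\<in>J2. u e \<in> F (Inr e)}"
  have "{\<omega> \<in> space M. W x \<omega> \<in> F (Inl x)} \<in> events" if "x \<in> J1" for x
    by (rule measurable_sets_Collect[OF W_measurable]) (use F1[OF that] in simp)
  then have A: "?A \<in> events"
    using fin by (intro sets.sets_Collect_finite_All) auto
  have "{u \<in> space uniforms. u e \<in> F (Inr e)} \<in> sets uniforms" if "e \<in> J2" for e
    by (rule measurable_sets_Collect[OF measurable_component_singleton]) (use F2[OF that] in simp_all)
  then have B: "?B \<in> sets uniforms"
    using fin by (intro sets.sets_Collect_finite_All) auto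
  have "emeasure M ?A = (\<Prod>x\<in>J1. emeasure D (F (Inl x)))"
  proof (cases "J1 = {}")
    case True
    then show ?thesis by (simp add: emeasure_space_1)
  next
    case False
    have "prob ?A = prob (\<Inter>x\<in>J1. W x -` F (Inl x) \<inter> space M)"
      using False by (intro arg_cong[where f = prob]) auto
    also have "\<dots> = (\<Prod>x\<in>J1. prob (W x -` F (Inl x) \<inter> space M))"
      by (rule indep_varsD[OF indep False fin(1)]) (use F1 in auto)
    also have "\<dots> = (\<Prod>x\<in>J1. measure D (F (Inl x)))"
    proof (intro prod.cong refl)
      fix x assume "x \<in> J1"
      then show "prob (W x -` F (Inl x) \<inter> space M) = measure D (F (Inl x))"
        using measure_distr[OF W_measurable F1, of x x] law[of x] by simp
    qed
    finally show ?thesis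
      by (simp add: emeasure_eq_measure D.emeasure_eq_measure prod_ennreal)
  qed
  moreover have "emeasure uniforms ?B = (\<Prod>e\<in>J2. emeasure unit_uniform (F (Inr e)))"
    by (rule U.emeasure_PiM_Collect) (use fin F2 in auto)
  moreover have "seed_of -` prod_emb UNIV site_edge_law J (Pi\<^sub>E J F) \<inter> space (M \<Otimes>\<^sub>M uniforms) = ?A \<times> ?B"
  proof -
    have "(\<forall>j\<in>J. seed_of p j \<in> F j) \<longleftrightarrow> (\<forall>x\<in>J1. W x (fst p) \<in> F (Inl x)) \<and> (\<forall>e\<in>J2. snd p e \<in> F (Inr e))" for p
      unfolding JJ ball_Un by (simp add: seed_of_def)
    moreover have "z \<in> prod_emb UNIV site_edge_law J (Pi\<^sub>E J F) \<longleftrightarrow> (\<forall>j\<in>J. z j \<in> F j)" for z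
      by (simp add: prod_emb_def PiE_iff)
    ultimately show ?thesis by (auto simp: space_pair_measure)
  qed
  moreover have "prod_emb UNIV site_edge_law J (Pi\<^sub>E J F) \<in> sets seeds"
    using J F by (intro sets_PiM_I) auto
  ultimately have "emeasure (distr (M \<Otimes>\<^sub>M uniforms) seeds seed_of) (prod_emb UNIV site_edge_law J (Pi\<^sub>E J F))
     = (\<Prod>x\<in>J1. emeasure D (F (Inl x))) * (\<Prod>e\<in>J2. emeasure unit_uniform (F (Inr e)))"
    by (simp add: emeasure_distr U.P.emeasure_pair_measure_Times[OF A B])
  also have "\<dots> = (\<Prod>j\<in>J. emeasure (site_edge_law j) (F j))"
    unfolding JJ using fin
    by (subst prod.union_disjoint) (auto simp: prod.reindex coordinate_law_def)
  finally show "emeasure (distr (M \<Otimes>\<^sub>M uniforms) seeds seed_of) (prod_emb UNIV site_edge_law J (Pi\<^sub>E J F))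
     = (\<Prod>j\<in>J. emeasure (site_edge_law j) (F j))" .
qed simp

text \<open>Given the weights, comparing independent uniform variables with the edge probabilities yields
  independent Bernoulli variables.\<close>

lemma edge_law_uniforms:
  assumes p: "\<And>e. e \<in> edges \<Longrightarrow> 0 \<le> edge_prob \<alpha> lam w e \<and> edge_prob \<alpha> lam w e \<le> 1"
  shows "edge_law \<alpha> lam w = distr uniforms (\<Pi>\<^sub>M e\<in>edges. count_space UNIV) (\<lambda>u. \<lambda>e\<in>edges. u e < edge_prob \<alpha> lam w e)"
proof -
  interpret U: product_prob_space "\<lambda>_::(int ^ 'd) set. unit_uniform" UNIV
    by (intro product_prob_spaceI prob_space_unit_uniform)
  have "{0, 1 :: int ^ 'd} \<in> edges" unfolding edges_def by (intro CollectI exI[of _ 0] exI[of _ 1]) auto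
  then have ne: "edges \<noteq> ({} :: (int ^ 'd) set set)" by blast
  let ?X = "\<lambda>e u. u e < edge_prob \<alpha> lam w e"
  have "U.P.indep_vars (\<lambda>_. count_space UNIV) (\<lambda>e u. (\<lambda>v. v < edge_prob \<alpha> lam w e) (u e)) edges"
    by (rule U.P.indep_vars_compose2[OF U.P.indep_vars_subset[OF U.coordinates_indep_vars]]) auto
  then have ind: "U.P.indep_vars (\<lambda>_. count_space UNIV) ?X edges" by simp
  have rv: "?X e \<in> measurable uniforms (count_space UNIV)" if "e \<in> edges" for e
    using ind that by (auto simp: U.P.indep_vars_def)
  have "distr uniforms (\<Pi>\<^sub>M e\<in>edges. count_space UNIV) (\<lambda>u. \<lambda>e\<in>edges. ?X e u) = (\<Pi>\<^sub>M e\<in>edges. distr uniforms (count_space UNIV) (?X e))"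
    using U.P.indep_vars_iff_distr_eq_PiM'[OF ne rv] ind by simp
  also have "\<dots> = (\<Pi>\<^sub>M e\<in>edges. measure_pmf (bernoulli_pmf (edge_prob \<alpha> lam w e)))"
  proof (intro PiM_cong refl)
    fix e :: "(int ^ 'd) set" assume e: "e \<in> edges"
    have "distr uniforms (count_space UNIV) (?X e) = distr (distr uniforms unit_uniform (\<lambda>u. u e)) (count_space UNIV) (\<lambda>v. v < edge_prob \<alpha> lam w e)"
      by (subst distr_distr) (auto simp: comp_def)
    also have "distr uniforms unit_uniform (\<lambda>u. u e) = unit_uniform" by (rule U.PiM_component) simp
    also have "distr unit_uniform (count_space UNIV) (\<lambda>v. v < edge_prob \<alpha> lam w e) = measure_pmf (bernoulli_pmf (edge_prob \<alpha> lam w e))"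
      using p[OF e] by (intro distr_unit_uniform_less) auto
    finally show "distr uniforms (count_space UNIV) (?X e) = measure_pmf (bernoulli_pmf (edge_prob \<alpha> lam w e))" .
  qed
  finally show ?thesis unfolding edge_law_def by simp
qed

lemma open_edge_event:
  assumes "e \<in> edges" shows "{z \<in> space seeds. open_edge \<alpha> lam z e} \<in> sets seeds"
proof -
  obtain x y where e: "e = {x, y}" using assms by (rule edges_cases)
  note [measurable] = coordinate_measurable[of "Inl x"] coordinate_measurable[of "Inl y"] coordinate_measurable[of "Inr {x, y}"]
  have "(\<lambda>z. conn_prob \<alpha> lam (\<lambda>x. z (Inl x)) x y) \<in> borel_measurable seeds"
    unfolding conn_prob_def by measurable
  then show ?thesis unfolding open_edge_def e edge_prob_doubleton
    by (rule borel_measurable_less[OF coordinate_measurable])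
qed

lemma open_edges_measurable [measurable]:
  "(\<lambda>z. restrict (open_edge \<alpha> lam z) edges) \<in> measurable seeds (\<Pi>\<^sub>M e\<in>edges. count_space UNIV)"
proof (rule measurable_restrict[where X = "\<lambda>e z. open_edge \<alpha> lam z e"])
  fix e :: "(int ^ 'd) set" assume "e \<in> edges"
  from open_edge_event[OF this] show "(\<lambda>z. open_edge \<alpha> lam z e) \<in> measurable seeds (count_space UNIV)"
    unfolding pred_def .
qed

lemma edge_prob_bounds:
  assumes "\<omega> \<in> space M" "0 \<le> lam" "e \<in> edges"
  shows "0 \<le> edge_prob \<alpha> lam (\<lambda>x. W x \<omega>) e \<and> edge_prob \<alpha> lam (\<lambda>x. W x \<omega>) e \<le> 1"
proof -
  obtain x y where e: "e = {x, y}" using assms(3) by (rule edges_cases)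
  show ?thesis unfolding e edge_prob_doubleton
    using conn_prob_bounds[of lam "\<lambda>x. W x \<omega>" x y \<alpha>] nonneg[OF assms(1)] assms(2) by auto
qed

text \<open>By Fubini: mixing the conditional laws over the weights is the same as drawing weights and
  uniform variables at once.\<close>

lemma graph_law_seed:
  assumes "0 \<le> lam"
  shows "graph_law M W \<alpha> lam = distr seeds (\<Pi>\<^sub>M e\<in>edges. count_space UNIV) (\<lambda>z. restrict (open_edge \<alpha> lam z) edges)"
    (is "_ = distr _ ?C ?g")
proof (rule measure_eqI)
  interpret U: product_prob_space "\<lambda>_::(int ^ 'd) set. unit_uniform" UNIV
    by (intro product_prob_spaceI prob_space_unit_uniform)
  show "sets (graph_law M W \<alpha> lam) = sets (distr seeds ?C ?g)"
    using sets_graph_law[OF prob_space_axioms, of W \<alpha> lam] W_measurable by simp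
  fix A assume "A \<in> sets (graph_law M W \<alpha> lam)"
  then have A: "A \<in> sets ?C"
    using sets_graph_law[OF prob_space_axioms, of W \<alpha> lam] W_measurable by simp
  have pre: "?g -` A \<inter> space seeds \<in> sets seeds"
    using A by (rule measurable_sets[OF open_edges_measurable])
  let ?Y = "seed_of -` (?g -` A \<inter> space seeds) \<inter> space (M \<Otimes>\<^sub>M uniforms)"
  have "emeasure (graph_law M W \<alpha> lam) A = (\<integral>\<^sup>+\<omega>. emeasure (edge_law \<alpha> lam (\<lambda>x. W x \<omega>)) A \<partial>M)"
    unfolding graph_law_def
    by (rule emeasure_bind[OF not_empty measurable_prob_algebraD[OF measurable_edge_law[OF W_measurable]] A])
  also have "\<dots> = (\<integral>\<^sup>+\<omega>. emeasure uniforms (Pair \<omega> -` ?Y) \<partial>M)"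
  proof (rule nn_integral_cong)
    fix \<omega> assume \<omega>: "\<omega> \<in> space M"
    have meas: "(\<lambda>u. \<lambda>e\<in>edges. u e < edge_prob \<alpha> lam (\<lambda>x. W x \<omega>) e) \<in> measurable uniforms ?C"
    proof (rule measurable_restrict)
      fix e :: "(int ^ 'd) set"
      have "(\<lambda>u. u e) \<in> borel_measurable uniforms"
        using measurable_component_singleton[of e UNIV "\<lambda>_. unit_uniform"]
          measurable_cong_sets[OF refl sets_unit_uniform] by blast
      then show "(\<lambda>u. u e < edge_prob \<alpha> lam (\<lambda>x. W x \<omega>) e) \<in> measurable uniforms (count_space UNIV)" by measurable
    qed
    have "(\<lambda>u. \<lambda>e\<in>edges. u e < edge_prob \<alpha> lam (\<lambda>x. W x \<omega>) e) -` A \<inter> space uniforms = Pair \<omega> -` ?Y"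
    proof -
      have "restrict (open_edge \<alpha> lam (seed_of (\<omega>, u))) edges = (\<lambda>e\<in>edges. u e < edge_prob \<alpha> lam (\<lambda>x. W x \<omega>) e)" for u
        by (simp add: open_edge_def seed_of_def fun_eq_iff restrict_def)
      then show ?thesis using \<omega> by (auto simp: space_pair_measure space_PiM)
    qed
    then show "emeasure (edge_law \<alpha> lam (\<lambda>x. W x \<omega>)) A = emeasure uniforms (Pair \<omega> -` ?Y)"
      using edge_law_uniforms[OF edge_prob_bounds[OF \<omega> assms]] emeasure_distr[OF meas A] by simp
  qed
  also have "\<dots> = emeasure (M \<Otimes>\<^sub>M uniforms) ?Y"
    by (rule U.P.emeasure_pair_measure_alt[symmetric]) (rule measurable_sets[OF seed_of_measurable pre])
  also have "\<dots> = emeasure (distr (M \<Otimes>\<^sub>M uniforms) seeds seed_of) (?g -` A \<inter> space seeds)"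
    by (rule emeasure_distr[OF seed_of_measurable pre, symmetric])
  also have "\<dots> = emeasure (distr seeds ?C ?g) A"
    unfolding distr_seed_of by (rule emeasure_distr[OF open_edges_measurable A, symmetric])
  finally show "emeasure (graph_law M W \<alpha> lam) A = emeasure (distr seeds ?C ?g) A" .
qed

end

section \<open>Translation invariance and the density of large clusters\<close>

lemma cluster_cong:
  assumes "\<And>e. e \<in> edges \<Longrightarrow> \<eta> e \<longleftrightarrow> \<eta>' e"
  shows "cluster \<eta> x = cluster \<eta>' x"
proof -
  have "(\<lambda>u v. u \<noteq> v \<and> \<eta> {u, v}) = (\<lambda>u v. u \<noteq> v \<and> \<eta>' {u, v})"
    using assms unfolding edges_def by blast
  then show ?thesis unfolding cluster_def by simp
qed

lemma edge_prob_translate: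
  assumes "e \<in> edges"
  shows "edge_prob \<alpha> lam (\<lambda>x. w (x + v)) e = edge_prob \<alpha> lam w ((\<lambda>x. x + v) ` e)"
proof -
  obtain x y where e: "e = {x, y}" using assms by (rule edges_cases)
  have "(\<lambda>x. x + v) ` {x, y} = {x + v, y + v}" by auto
  then show ?thesis unfolding e by (simp only: edge_prob_doubleton) (simp add: conn_prob_def lattice_dist_def)
qed

definition translate_index :: "int ^ 'd \<Rightarrow> (int ^ 'd) site_or_edge \<Rightarrow> (int ^ 'd) site_or_edge" where
  "translate_index v i = (case i of Inl x \<Rightarrow> Inl (x + v) | Inr e \<Rightarrow> Inr ((\<lambda>x. x + v) ` e))"

lemma inj_translate_index: "inj (translate_index v)"
proof (rule injI)
  fix i j assume "translate_index v i = translate_index v j"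
  moreover have "inj (\<lambda>x. x + v)" by (simp add: inj_on_def)
  ultimately show "i = j"
    by (auto simp: translate_index_def inj_image_eq_iff split: sum.splits)
qed

context iid_weights
begin

lemma distr_translate: "distr seeds seeds (\<lambda>z i. z (translate_index v i)) = seeds"
proof -
  have law_inv: "site_edge_law (translate_index v i) = site_edge_law i" for i
    by (cases i) (auto simp: translate_index_def coordinate_law_def)
  have "distr seeds (\<Pi>\<^sub>M i\<in>UNIV. site_edge_law (translate_index v i)) (\<lambda>z. \<lambda>n\<in>UNIV. z (translate_index v n))
      = (\<Pi>\<^sub>M i\<in>UNIV. site_edge_law (translate_index v i))"
    by (rule distr_PiM_reindex) (auto simp: inj_translate_index seed.prob_space)
  then show ?thesis unfolding law_inv restrict_UNIV by simp
qed

lemma percolation_prob_seed: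
  assumes "0 \<le> lam"
  shows "percolation_prob M W \<alpha> lam = measure seeds {z. infinite (cluster (open_edge \<alpha> lam z) 0)}"
    and "{z. infinite (cluster (open_edge \<alpha> lam z) x)} \<in> sets seeds"
proof -
  let ?C = "(\<Pi>\<^sub>M e\<in>edges. count_space UNIV) :: ((int ^ 'd) set \<Rightarrow> bool) measure"
  let ?g = "\<lambda>z. restrict (open_edge \<alpha> lam z) edges"
  have cl: "cluster (?g z) x = cluster (open_edge \<alpha> lam z) x" for z x
    by (rule cluster_cong) auto
  have pre: "?g -` {\<eta> \<in> space ?C. infinite (cluster \<eta> x)} \<inter> space seeds = {z. infinite (cluster (open_edge \<alpha> lam z) x)}" for x
  proof (intro set_eqI)
    fix z
    have "?g z \<in> space ?C" by (rule measurable_space[OF open_edges_measurable]) simp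
    then show "z \<in> ?g -` {\<eta> \<in> space ?C. infinite (cluster \<eta> x)} \<inter> space seeds \<longleftrightarrow> z \<in> {z. infinite (cluster (open_edge \<alpha> lam z) x)}"
      by (simp add: cl)
  qed
  show "{z. infinite (cluster (open_edge \<alpha> lam z) x)} \<in> sets seeds"
    using measurable_sets[OF open_edges_measurable measurable_infinite_cluster, of \<alpha> lam x] unfolding pre .
  have "percolation_prob M W \<alpha> lam = measure (distr seeds ?C ?g) {\<eta> \<in> space ?C. infinite (cluster \<eta> 0)}"
    unfolding percolation_prob_def graph_law_seed[OF assms] by simp
  also have "\<dots> = measure seeds {z. infinite (cluster (open_edge \<alpha> lam z) 0)}"
    using measure_distr[OF open_edges_measurable measurable_infinite_cluster, of \<alpha> lam 0] unfolding pre .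
  finally show "percolation_prob M W \<alpha> lam = measure seeds {z. infinite (cluster (open_edge \<alpha> lam z) 0)}" .
qed

lemma cluster_event: "{z. y \<in> cluster (open_edge \<alpha> lam z) x} \<in> sets seeds"
proof -
  let ?R = "\<lambda>z u v. u \<noteq> v \<and> open_edge \<alpha> lam z {u, v}"
  have step: "{z. ?R z u v} \<in> sets seeds" for u v
  proof (cases "u = v")
    case False
    then have "{u, v} \<in> edges" by (auto simp: edges_def)
    from open_edge_event[OF this] show ?thesis using False by simp
  qed simp
  have path: "{z. (?R z ^^ n) x y} \<in> sets seeds" for n y
  proof (induction n arbitrary: y)
    case 0
    then show ?case using sets.top[of seeds] by simp
  next
    case (Suc n)
    have "{z. (?R z ^^ Suc n) x y} = (\<Union>u. {z. (?R z ^^ n) x u} \<inter> {z. ?R z u y})" by auto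
    also have "\<dots> \<in> sets seeds"
      using Suc step by (intro sets.countable_UN'' countable_lattice sets.Int) auto
    finally show ?case .
  qed
  have "{z. y \<in> cluster (open_edge \<alpha> lam z) x} = (\<Union>n. {z. (?R z ^^ n) x y})"
    unfolding cluster_def by (auto simp: rtranclp_power)
  then show ?thesis using path by (simp add: sets.countable_UN image_subset_iff)
qed

definition cluster_ge :: "real \<Rightarrow> real \<Rightarrow> nat \<Rightarrow> int ^ 'd \<Rightarrow> ((int ^ 'd) site_or_edge \<Rightarrow> real) set" where
  "cluster_ge \<alpha> lam m x = {z. \<exists>A. finite A \<and> card A = m \<and> A \<subseteq> cluster (open_edge \<alpha> lam z) x}"

lemma cluster_ge_event: "cluster_ge \<alpha> lam m x \<in> sets seeds"
proof -
  have "countable {A :: (int ^ 'd) set. finite A}"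
    using countable_Collect_finite_subset[OF countable_lattice] by simp
  then have count: "countable {A :: (int ^ 'd) set. finite A \<and> card A = m}"
    by (rule countable_subset[rotated]) auto
  have "{z. A \<subseteq> cluster (open_edge \<alpha> lam z) x} \<in> sets seeds" if "finite A" for A
  proof -
    have "{z \<in> space seeds. \<forall>y\<in>A. y \<in> cluster (open_edge \<alpha> lam z) x} \<in> sets seeds"
      using that cluster_event by (intro sets.sets_Collect_finite_All) auto
    then show ?thesis by (simp add: subset_eq)
  qed
  then have "(\<Union>A\<in>{A. finite A \<and> card A = m}. {z. A \<subseteq> cluster (open_edge \<alpha> lam z) x}) \<in> sets seeds"
    by (intro sets.countable_UN'' count) auto
  also have "(\<Union>A\<in>{A. finite A \<and> card A = m}. {z. A \<subseteq> cluster (open_edge \<alpha> lam z) x}) = cluster_ge \<alpha> lam m x"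
    unfolding cluster_ge_def by auto
  finally show ?thesis .
qed

text \<open>The cluster of \<open>x\<close> for the translated seeds is a translate of the cluster of \<open>x + v\<close> for the original
  ones. The reverse inequality follows by translating \<open>x + v\<close> by \<open>- v\<close>.\<close>

lemma cluster_ge_prob_le: "measure seeds (cluster_ge \<alpha> lam m x) \<le> measure seeds (cluster_ge \<alpha> lam m (x + v))"
proof -
  let ?t = "\<lambda>z i. z (translate_index v i)"
  have t: "?t \<in> measurable seeds seeds"
  proof (rule measurable_PiM_single')
    fix i :: "(int ^ 'd) site_or_edge"
    show "(\<lambda>z. z (translate_index v i)) \<in> measurable seeds (site_edge_law i)"
      using coordinate_measurable measurable_cong_sets[OF refl sets_coordinate] by blast
  qed auto
  have op: "open_edge \<alpha> lam (?t z) e \<longleftrightarrow> open_edge \<alpha> lam z ((\<lambda>x. x + v) ` e)" if "e \<in> edges" for z e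
    using edge_prob_translate[OF that, of \<alpha> lam "\<lambda>x. z (Inl x)" v]
    by (simp add: open_edge_def translate_index_def)
  have cl: "y + v \<in> cluster (open_edge \<alpha> lam z) (x + v)" if "y \<in> cluster (open_edge \<alpha> lam (?t z)) x" for z y
    using that unfolding cluster_def mem_Collect_eq
  proof (induction rule: rtranclp_induct)
    case (step a b)
    then have "{a, b} \<in> edges" by (auto simp: edges_def)
    with step.hyps(2) op[of "{a, b}" z] have "a + v \<noteq> b + v \<and> open_edge \<alpha> lam z {a + v, b + v}" by simp
    with step.IH show ?case by (rule rtranclp.rtrancl_into_rtrancl)
  qed simp
  have "?t -` cluster_ge \<alpha> lam m x \<inter> space seeds \<subseteq> cluster_ge \<alpha> lam m (x + v)"
  proof
    fix z assume "z \<in> ?t -` cluster_ge \<alpha> lam m x \<inter> space seeds"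
    then obtain A where A: "finite A" "card A = m" "A \<subseteq> cluster (open_edge \<alpha> lam (?t z)) x"
      unfolding cluster_ge_def by auto
    have "card ((\<lambda>x. x + v) ` A) = card A" by (intro card_image) (simp add: inj_on_def)
    then show "z \<in> cluster_ge \<alpha> lam m (x + v)"
      unfolding cluster_ge_def using A cl by (intro CollectI exI[of _ "(\<lambda>x. x + v) ` A"]) auto
  qed
  then have "measure seeds (?t -` cluster_ge \<alpha> lam m x \<inter> space seeds) \<le> measure seeds (cluster_ge \<alpha> lam m (x + v))"
    by (rule seed.P.finite_measure_mono[OF _ cluster_ge_event])
  also have "measure seeds (?t -` cluster_ge \<alpha> lam m x \<inter> space seeds) = measure (distr seeds seeds ?t) (cluster_ge \<alpha> lam m x)"
    by (rule measure_distr[OF t cluster_ge_event, symmetric])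
  finally show ?thesis unfolding distr_translate .
qed

lemma cluster_ge_prob: "measure seeds (cluster_ge \<alpha> lam m x) = measure seeds (cluster_ge \<alpha> lam m 0)"
  using cluster_ge_prob_le[of \<alpha> lam m x "- x"] cluster_ge_prob_le[of \<alpha> lam m 0 x] by simp

lemma infinite_iff_cluster_ge: "{z. infinite (cluster (open_edge \<alpha> lam z) x)} = (\<Inter>m. cluster_ge \<alpha> lam m x)"
proof (intro set_eqI iffI)
  fix z assume z: "z \<in> (\<Inter>m. cluster_ge \<alpha> lam m x)"
  show "z \<in> {z. infinite (cluster (open_edge \<alpha> lam z) x)}"
  proof (rule CollectI, rule notI)
    assume fin: "finite (cluster (open_edge \<alpha> lam z) x)"
    have "z \<in> cluster_ge \<alpha> lam (Suc (card (cluster (open_edge \<alpha> lam z) x))) x" using z by blast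
    then obtain A where A: "card A = Suc (card (cluster (open_edge \<alpha> lam z) x))" "A \<subseteq> cluster (open_edge \<alpha> lam z) x"
      unfolding cluster_ge_def by blast
    then show False using card_mono[OF fin A(2)] by simp
  qed
next
  fix z assume "z \<in> {z. infinite (cluster (open_edge \<alpha> lam z) x)}"
  then have inf: "infinite (cluster (open_edge \<alpha> lam z) x)" by simp
  show "z \<in> (\<Inter>m. cluster_ge \<alpha> lam m x)"
    unfolding cluster_ge_def using infinite_arbitrarily_large[OF inf] by blast
qed

lemma cluster_ge_antimono: "m \<le> n \<Longrightarrow> cluster_ge \<alpha> lam n x \<subseteq> cluster_ge \<alpha> lam m x"
  unfolding cluster_ge_def
  by (clarify, erule obtain_subset_with_card_n) (auto intro: finite_subset)

text \<open>Each of the at least \<open>m\<close> points of the dense cluster has a cluster of at least \<open>m\<close> points. Hence the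
  expected number of such points in \<open>B\<close> is at least \<open>m / 2\<close>, and by translation invariance it equals
  \<open>card B\<close> times the probability that the cluster of the origin has at least \<open>m\<close> points.\<close>

lemma percolation_from_dense_clusters:
  fixes \<epsilon> :: real
  assumes "0 \<le> lam" "0 < \<epsilon>"
    and "\<And>N. \<exists>B m S. finite B \<and> N \<le> m \<and> \<epsilon> * real (card B) \<le> real m \<and> S \<in> sets seeds \<and> 1 / 2 \<le> measure seeds S \<and>
        (\<forall>z\<in>S. \<exists>A\<subseteq>B. m \<le> card A \<and> (\<forall>x\<in>A. A \<subseteq> cluster (open_edge \<alpha> lam z) x))"
  shows "0 < percolation_prob M W \<alpha> lam"
proof -
  have "\<epsilon> / 2 \<le> measure seeds (cluster_ge \<alpha> lam n 0)" for n
  proof -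
    obtain B m S where B: "finite B" "Suc n \<le> m" "\<epsilon> * card B \<le> m" "S \<in> sets seeds" "1 / 2 \<le> measure seeds S"
      and S: "\<And>z. z \<in> S \<Longrightarrow> \<exists>A\<subseteq>B. m \<le> card A \<and> (\<forall>x\<in>A. A \<subseteq> cluster (open_edge \<alpha> lam z) x)"
      using assms(3)[of "Suc n"] by blast
    let ?c = "\<lambda>x. cluster_ge \<alpha> lam m x"
    (* On S at least m points of B lie in clusters of at least m points. *)
    have count: "real m * (indicator S z :: real) \<le> (\<Sum>x\<in>B. indicator (?c x) z)" for z
    proof (cases "z \<in> S")
      case True
      obtain A where A: "A \<subseteq> B" "m \<le> card A" "\<forall>x\<in>A. A \<subseteq> cluster (open_edge \<alpha> lam z) x"
        using S[OF True] by blast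
      obtain A' where A': "A' \<subseteq> A" "card A' = m" "finite A'"
        using obtain_subset_with_card_n[OF A(2)] by blast
      have "z \<in> ?c x" if "x \<in> A" for x
        unfolding cluster_ge_def
        by (intro CollectI exI[of _ A'] conjI A'(3) A'(2) order_trans[OF A'(1)] A(3)[rule_format] that)
      then have "real (card A) = (\<Sum>x\<in>A. indicator (?c x) z)" by simp
      also have "\<dots> \<le> (\<Sum>x\<in>B. indicator (?c x) z :: real)"
        by (rule sum_mono2[OF B(1) A(1)]) simp
      finally have "real m \<le> (\<Sum>x\<in>B. indicator (?c x) z :: real)" using A(2) by simp
      then show ?thesis using True by simp
    qed (simp add: sum_nonneg)
    have int: "integrable seeds (indicator X :: _ \<Rightarrow> real)" if "X \<in> sets seeds" for X
    proof (rule integrable_real_indicator[OF that])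
      show "emeasure seeds X < \<infinity>" unfolding seed.P.emeasure_eq_measure infinity_ennreal_def by (rule ennreal_less_top)
    qed
    have "m * (1 / 2) \<le> m * measure seeds S" using B(5) by (intro mult_left_mono) auto
    also have "\<dots> = (\<integral>z. real m * (indicator S z :: real) \<partial>seeds)" using B(4) by simp
    also have "\<dots> \<le> (\<integral>z. (\<Sum>x\<in>B. indicator (?c x) z) \<partial>seeds)"
    proof (rule integral_mono)
      show "integrable seeds (\<lambda>z. real m * (indicator S z :: real))" by (rule integrable_mult_right[OF int[OF B(4)]])
      show "integrable seeds (\<lambda>z. \<Sum>x\<in>B. indicator (?c x) z :: real)"
        by (rule Bochner_Integration.integrable_sum[OF int[OF cluster_ge_event]])
    qed (rule count)
    also have "\<dots> = (\<Sum>x\<in>B. measure seeds (?c x))"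
    proof -
      have "(\<integral>z. (\<Sum>x\<in>B. indicator (?c x) z :: real) \<partial>seeds) = (\<Sum>x\<in>B. \<integral>z. indicator (?c x) z \<partial>seeds)"
        by (rule Bochner_Integration.integral_sum[OF int[OF cluster_ge_event]])
      also have "\<dots> = (\<Sum>x\<in>B. measure seeds (?c x))"
        by (rule sum.cong[OF refl]) simp
      finally show ?thesis .
    qed
    also have "\<dots> = (\<Sum>x\<in>B. measure seeds (?c 0))" by (rule sum.cong[OF refl cluster_ge_prob])
    also have "\<dots> = card B * measure seeds (?c 0)" by simp
    finally have le: "m * (1 / 2) \<le> card B * measure seeds (?c 0)" .
    then have c: "0 < real (card B)" using B(2) by (cases "card B = 0") auto
    have "real (card B) * (\<epsilon> / 2) = \<epsilon> * card B * (1 / 2)" by simp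
    also have "\<dots> \<le> m * (1 / 2)" using B(3) by simp
    also note le
    finally have "\<epsilon> / 2 \<le> measure seeds (?c 0)" using c by (rule mult_left_le_imp_le)
    also have "\<dots> \<le> measure seeds (cluster_ge \<alpha> lam n 0)"
      using B(2) by (intro seed.P.finite_measure_mono cluster_ge_antimono cluster_ge_event) auto
    finally show ?thesis .
  qed
  then have lower: "\<exists>N. \<forall>n\<ge>N. \<epsilon> / 2 \<le> measure seeds (cluster_ge \<alpha> lam n 0)" by simp
  have "(\<lambda>n. measure seeds (cluster_ge \<alpha> lam n 0)) \<longlonglongrightarrow> measure seeds (\<Inter>n. cluster_ge \<alpha> lam n 0)"
  proof (rule seed.P.finite_Lim_measure_decseq)
    show "range (\<lambda>n. cluster_ge \<alpha> lam n 0) \<subseteq> sets seeds" using cluster_ge_event by blast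
    show "decseq (\<lambda>n. cluster_ge \<alpha> lam n 0)" unfolding decseq_def using cluster_ge_antimono by blast
  qed
  from LIMSEQ_le_const[OF this lower]
  have "\<epsilon> / 2 \<le> measure seeds (\<Inter>n. cluster_ge \<alpha> lam n 0)" .
  then show ?thesis
    unfolding percolation_prob_seed(1)[OF assms(1)] infinite_iff_cluster_ge using assms(2) by simp
qed

end

section \<open>Percolation on the line\<close>

text \<open>Transfers linked sets of a coarse graph \<open>E\<close> to the clusters of the lattice through a choice \<open>f\<close> of one
  vertex per coarse point.\<close>

lemma cluster_of_linked:
  assumes path: "(u, v) \<in> (induced E B)\<^sup>*"
    and step: "\<And>u v. E u v \<Longrightarrow> u \<in> B \<Longrightarrow> v \<in> B \<Longrightarrow> f u \<noteq> f v \<and> \<eta> {f u, f v}"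
  shows "f v \<in> cluster \<eta> (f u)"
  using path
proof (induction rule: rtrancl_induct)
  case base
  then show ?case by (simp add: cluster_def)
next
  case (step y z)
  then have "f y \<noteq> f z \<and> \<eta> {f y, f z}"
    using assms(2)[of y z] by (auto simp: induced_def)
  then show ?case
    using step.IH unfolding cluster_def by (auto intro: rtranclp.rtrancl_into_rtrancl)
qed

text \<open>Connection probabilities increase in the weights and decrease in the distance. A threshold that
  ignores the actual weights makes edges independent of each other, and this lemma brings them back
  into the graph.\<close>

lemma open_edge_if_heavy:
  assumes "x \<noteq> y" "0 \<le> lam" "0 \<le> w" "0 < \<alpha>" "lattice_dist x y \<le> r"
    and "w \<le> z (Inl x)" "w \<le> z (Inl y)" "z (Inr {x, y}) < 1 - exp (- (lam * w * w / r powr \<alpha>))"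
  shows "open_edge \<alpha> lam z {x, y}"
proof -
  have pos: "0 < lattice_dist x y"
    using assms(1) unfolding lattice_dist_def by (auto simp: vec_eq_iff)
  have "w * w \<le> z (Inl x) * z (Inl y)" using assms(3,6,7) by (intro mult_mono) auto
  then have "lam * w * w \<le> lam * z (Inl x) * z (Inl y)"
    using assms(2) by (simp add: mult.assoc mult_left_mono)
  moreover have "lattice_dist x y powr \<alpha> \<le> r powr \<alpha>"
    using pos assms(4,5) by (intro powr_mono2) auto
  moreover have "0 < lattice_dist x y powr \<alpha>" using pos by simp
  ultimately have "lam * w * w / r powr \<alpha> \<le> lam * z (Inl x) * z (Inl y) / lattice_dist x y powr \<alpha>"
    using assms(2,3,6,7) by (intro frac_le) auto
  then have "exp (- (lam * z (Inl x) * z (Inl y) / lattice_dist x y powr \<alpha>)) \<le> exp (- (lam * w * w / r powr \<alpha>))"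
    by (simp only: exp_le_cancel_iff neg_le_iff_le)
  then show ?thesis
    using assms(8) unfolding open_edge_def edge_prob_doubleton conn_prob_def by linarith
qed

context iid_weights
begin

lemma seeds_indep:
  assumes "A \<in> sets seeds" "B \<in> sets seeds" "J \<inter> K = {}"
    and "\<And>z z'. z \<in> A \<Longrightarrow> (\<And>i. i \<in> J \<Longrightarrow> z i = z' i) \<Longrightarrow> z' \<in> A"
    and "\<And>z z'. z \<in> B \<Longrightarrow> (\<And>i. i \<in> K \<Longrightarrow> z i = z' i) \<Longrightarrow> z' \<in> B"
  shows "measure seeds (A \<inter> B) = measure seeds A * measure seeds B"
  by (rule seed.prob_Int_disjoint_coordinates[where J = J and K = K]) (use assms in auto)

text \<open>\<open>K B\<close> is the set of coordinates that determine the graph induced on \<open>B\<close>.\<close>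

lemma random_graph_seeds:
  fixes E :: "((int ^ 'd) site_or_edge \<Rightarrow> real) \<Rightarrow> 'v \<Rightarrow> 'v \<Rightarrow> bool"
  assumes event: "\<And>x y. {z \<in> space seeds. E z x y} \<in> sets seeds"
    and sym: "\<And>z x y. E z x y \<Longrightarrow> E z y x"
    and disj: "\<And>A B. A \<inter> B = {} \<Longrightarrow> K A \<inter> K B = {}"
    and cong: "\<And>B z z'. (\<And>i. i \<in> K B \<Longrightarrow> z i = z' i) \<Longrightarrow> induced (E z) B = induced (E z') B"
  shows "random_graph seeds E"
proof
  fix B B' :: "'v set" and Q Q' :: "('v \<times> 'v) set \<Rightarrow> bool"
  assume fin: "finite B" "finite B'" and BB': "B \<inter> B' = {}"
  let ?A = "{z \<in> space seeds. Q (induced (E z) B)}" and ?B = "{z \<in> space seeds. Q' (induced (E z) B')}"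
  have "measure seeds (?A \<inter> ?B) = measure seeds ?A * measure seeds ?B"
  proof (rule seeds_indep[OF induced_event[OF event fin(1)] induced_event[OF event fin(2)] disj[OF BB']])
    show "z' \<in> ?A" if "z \<in> ?A" "\<And>i. i \<in> K B \<Longrightarrow> z i = z' i" for z z'
      using that(1) cong[of B z z', OF that(2)] by simp
    show "z' \<in> ?B" if "z \<in> ?B" "\<And>i. i \<in> K B' \<Longrightarrow> z i = z' i" for z z'
      using that(1) cong[of B' z z', OF that(2)] by simp
  qed
  then show "measure seeds {z \<in> space seeds. Q (induced (E z) B) \<and> Q' (induced (E z) B')} = measure seeds ?A * measure seeds ?B"
    by (simp add: Collect_conj_eq)
qed (use event sym in auto)

lemma measure_seeds_cylinder:
  assumes "finite I" and inj: "inj_on f I" and X: "\<And>i. i \<in> I \<Longrightarrow> X i \<in> sets borel"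
  shows "measure seeds {z. \<forall>i\<in>I. z (f i) \<in> X i} = (\<Prod>i\<in>I. measure (site_edge_law (f i)) (X i))"
proof -
  let ?Y = "\<lambda>j. X (the_inv_into I f j)"
  have Y: "?Y (f i) = X i" if "i \<in> I" for i
    using the_inv_into_f_f[OF inj that] by simp
  have "{z. \<forall>i\<in>I. z (f i) \<in> X i} = prod_emb UNIV site_edge_law (f ` I) (Pi\<^sub>E (f ` I) ?Y)"
    using Y by (auto simp: prod_emb_def PiE_iff)
  also have "measure seeds \<dots> = (\<Prod>j\<in>f ` I. measure (site_edge_law j) (?Y j))"
    using assms(1) X Y by (intro seed.measure_PiM_emb) auto
  also have "\<dots> = (\<Prod>i\<in>I. measure (site_edge_law (f i)) (X i))"
    using Y by (simp add: prod.reindex[OF inj])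
  finally show ?thesis .
qed

lemma seeds_event:
  assumes "X \<in> sets borel" shows "{z. z i \<in> X} \<in> sets seeds"
  using measurable_sets[OF coordinate_measurable assms, of i] by (simp add: vimage_def)

lemma measure_uniform_ge:
  assumes "0 \<le> t"
  shows "measure unit_uniform {1 - exp (- t)..} = exp (- t)"
proof -
  interpret U: prob_space unit_uniform by (rule prob_space_unit_uniform)
  have "measure unit_uniform (space unit_uniform - {..<1 - exp (- t)}) = 1 - measure unit_uniform {..<1 - exp (- t)}"
    by (rule U.prob_compl) simp
  moreover have "space unit_uniform - {..<1 - exp (- t)} = {1 - exp (- t)..}" by auto
  ultimately show ?thesis using measure_unit_uniform_less[of "1 - exp (- t)"] assms by simp
qed

end

definition on_line :: "int \<Rightarrow> int ^ 'd" where "on_line k = (\<chi> i. k)"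

lemma on_line_eq_iff [simp]: "on_line j = on_line k \<longleftrightarrow> j = k"
  by (auto simp: on_line_def vec_eq_iff)

lemma lattice_dist_on_line:
  assumes "CARD('d) = 1"
  shows "lattice_dist (on_line j :: int ^ 'd) (on_line k) = \<bar>real_of_int (j - k)\<bar>"
  using assms by (simp add: lattice_dist_def on_line_def norm_vec_def L2_set_def)

lemma on_line_pair_eq_iff:
  "{on_line a, on_line b :: int ^ 'd} = {on_line c, on_line e} \<longleftrightarrow> {a, b} = {c, e}"
  by (auto simp: doubleton_eq_iff)

context iid_weights
begin

text \<open>Here \<open>\<beta>\<close> stands for \<open>lam * w * w\<close>, where \<open>w\<close> is a lower bound for the weights. No weight coordinate is
  read, so these edges are independent.\<close>

definition line_edge :: "real \<Rightarrow> real \<Rightarrow> ((int ^ 'd) site_or_edge \<Rightarrow> real) \<Rightarrow> int \<Rightarrow> int \<Rightarrow> bool" where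
  "line_edge \<beta> \<alpha> z j k \<longleftrightarrow> j \<noteq> k \<and> z (Inr {on_line j, on_line k}) < 1 - exp (- (\<beta> / \<bar>real_of_int (j - k)\<bar> powr \<alpha>))"

lemma line_edge_event: "{z \<in> space seeds. line_edge \<beta> \<alpha> z j k} \<in> sets seeds"
  using seeds_event[of "{..<1 - exp (- (\<beta> / \<bar>real_of_int (j - k)\<bar> powr \<alpha>))}" "Inr {on_line j, on_line k}"]
  by (cases "j = k") (auto simp: line_edge_def)

lemma line_edge_sym: "line_edge \<beta> \<alpha> z j k \<Longrightarrow> line_edge \<beta> \<alpha> z k j"
  unfolding line_edge_def by (simp add: insert_commute abs_minus_commute)

definition line_coords :: "int set \<Rightarrow> (int ^ 'd) site_or_edge set" where
  "line_coords B = {Inr {on_line j, on_line k} |j k. j \<in> B \<and> k \<in> B}"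

lemma induced_line_cong:
  assumes "\<And>i. i \<in> line_coords B \<Longrightarrow> z i = z' i"
  shows "induced (line_edge \<beta> \<alpha> z) B = induced (line_edge \<beta> \<alpha> z') B"
proof -
  have "z (Inr {on_line j, on_line k}) = z' (Inr {on_line j, on_line k})" if "j \<in> B" "k \<in> B" for j k
    using that by (intro assms) (auto simp: line_coords_def)
  then show ?thesis unfolding induced_def line_edge_def by auto
qed

lemma line_coords_disjoint:
  assumes "A \<inter> B = {}" shows "line_coords A \<inter> line_coords B = {}"
  using assms by (auto simp: line_coords_def on_line_pair_eq_iff doubleton_eq_iff)

lemma no_line_edge_prob:
  assumes "0 \<le> \<beta>" "finite X" "finite Y" "X \<inter> Y = {}"
  shows "measure seeds {z. \<forall>x\<in>X. \<forall>y\<in>Y. \<not> line_edge \<beta> \<alpha> z x y}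
    = exp (- (\<Sum>x\<in>X. \<Sum>y\<in>Y. \<beta> / \<bar>real_of_int (x - y)\<bar> powr \<alpha>))"
proof -
  let ?t = "\<lambda>p. \<beta> / \<bar>real_of_int (fst p - snd p)\<bar> powr \<alpha>"
  let ?f = "\<lambda>p. Inr {on_line (fst p), on_line (snd p)} :: (int ^ 'd) site_or_edge"
  have "{z. \<forall>x\<in>X. \<forall>y\<in>Y. \<not> line_edge \<beta> \<alpha> z x y} = {z. \<forall>p\<in>X \<times> Y. z (?f p) \<in> {1 - exp (- ?t p)..}}"
  proof -
    have "x \<noteq> y" if "x \<in> X" "y \<in> Y" for x y using that assms(4) by blast
    then show ?thesis unfolding line_edge_def by (auto simp: not_less)
  qed
  also have "measure seeds \<dots> = (\<Prod>p\<in>X \<times> Y. measure (site_edge_law (?f p)) {1 - exp (- ?t p)..})"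
  proof (rule measure_seeds_cylinder)
    show "inj_on ?f (X \<times> Y)"
      using assms(4) by (auto simp: inj_on_def on_line_pair_eq_iff doubleton_eq_iff)
  qed (use assms in auto)
  also have "\<dots> = (\<Prod>p\<in>X \<times> Y. exp (- ?t p))"
  proof (rule prod.cong[OF refl])
    fix p assume p: "p \<in> X \<times> Y"
    have "0 \<le> ?t p" using assms(1) by simp
    then show "measure (site_edge_law (?f p)) {1 - exp (- ?t p)..} = exp (- ?t p)"
      unfolding coordinate_law_def sum.case by (rule measure_uniform_ge)
  qed
  also have "\<dots> = exp (\<Sum>p\<in>X \<times> Y. - ?t p)"
    using assms by (simp add: exp_sum)
  also have "(\<Sum>p\<in>X \<times> Y. - ?t p) = - (\<Sum>x\<in>X. \<Sum>y\<in>Y. \<beta> / \<bar>real_of_int (x - y)\<bar> powr \<alpha>)"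
    unfolding sum_negf sum.cartesian_product by (simp add: case_prod_unfold)
  finally show ?thesis .
qed

lemma line_graph_seeds:
  assumes "0 < \<alpha>" "\<alpha> \<le> 2" "496 \<le> \<beta>"
  shows "line_graph seeds (line_edge \<beta> \<alpha>) \<beta>"
proof -
  let ?E = "line_edge \<beta> \<alpha>"
  have R: "random_graph seeds ?E"
    by (rule random_graph_seeds[where K = line_coords]) (fact line_edge_event line_edge_sym line_coords_disjoint induced_line_cong)+
  show ?thesis
  proof (intro line_graph.intro[OF R] line_graph_axioms.intro)
    fix z :: int
    have "{s \<in> space seeds. \<not> good_block 1 (?E s) (seg 1 z)}
      \<subseteq> {s. \<forall>x\<in>{z}. \<forall>y\<in>{z + 1}. \<not> ?E s x y}"
    proof (rule subsetI, rule ccontr)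
      fix s assume "s \<in> {s \<in> space seeds. \<not> good_block 1 (?E s) (seg 1 z)}"
        and e: "s \<notin> {s. \<forall>x\<in>{z}. \<forall>y\<in>{z + 1}. \<not> ?E s x y}"
      then have no: "\<not> good_block 1 (?E s) (seg 1 z)" by simp
      have seg: "seg 1 z = {z, z + 1}" unfolding seg_def by auto
      from e have "?E s z (z + 1)" "?E s (z + 1) z" using line_edge_sym by auto
      then have "linked (induced (?E s) (seg 1 z)) (seg 1 z)"
        unfolding linked_def seg induced_def by auto
      then show False using no unfolding dense_cluster_def by auto
    qed
    moreover have "{s. \<forall>x\<in>{z}. \<forall>y\<in>{z + 1}. \<not> ?E s x y} \<in> sets seeds"
    proof -
      have "space seeds - {s \<in> space seeds. ?E s z (z + 1)} \<in> sets seeds"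
        by (intro sets.Diff sets.top line_edge_event)
      moreover have "space seeds - {s \<in> space seeds. ?E s z (z + 1)} = {s. \<forall>x\<in>{z}. \<forall>y\<in>{z + 1}. \<not> ?E s x y}"
        by auto
      ultimately show ?thesis by simp
    qed
    ultimately have "measure seeds {s \<in> space seeds. \<not> good_block 1 (?E s) (seg 1 z)}
      \<le> measure seeds {s. \<forall>x\<in>{z}. \<forall>y\<in>{z + 1}. \<not> ?E s x y}"
      by (rule seed.P.finite_measure_mono)
    also have "\<dots> = exp (- (\<Sum>x\<in>{z}. \<Sum>y\<in>{z + 1}. \<beta> / \<bar>real_of_int (x - y)\<bar> powr \<alpha>))"
      by (rule no_line_edge_prob) (use assms in auto)
    also have "\<dots> = exp (- \<beta>)" by simp
    also have "\<dots> \<le> exp (- (real 19 * 1))" using assms(3) by simp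
    also have "\<dots> = (1 / exp 1) ^ 19" unfolding exp_minus exp_of_nat_mult by (simp add: power_one_over inverse_eq_divide)
    also have "\<dots> \<le> (1 / 2) ^ 19"
      using exp_ge_add_one_self[of 1] by (intro power_mono frac_le) auto
    finally show "measure seeds {s \<in> space seeds. \<not> good_block 1 (?E s) (seg 1 z)} \<le> (1 / 2) ^ 19" .
  next
    fix A B X Y :: "int set" and Q Q' :: "(int \<times> int) set \<Rightarrow> bool"
    assume fin: "finite A" "finite B" and disj: "A \<inter> B = {}" and XY: "X \<subseteq> A" "Y \<subseteq> B"
    let ?G = "{z \<in> space seeds. Q (induced (?E z) A) \<and> Q' (induced (?E z) B)}"
    let ?N = "{z. \<forall>x\<in>X. \<forall>y\<in>Y. \<not> ?E z x y}"
    have finXY: "finite X" "finite Y" and disjXY: "X \<inter> Y = {}"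
      using fin XY disj finite_subset by blast+
    have G: "?G \<in> sets seeds"
      by (intro sets.sets_Collect_conj induced_event[OF line_edge_event] fin)
    have N: "?N \<in> sets seeds"
    proof -
      have "{z \<in> space seeds. \<forall>x\<in>X. \<forall>y\<in>Y. \<not> ?E z x y} \<in> sets seeds"
        by (intro sets.sets_Collect_finite_All sets.sets_Collect_neg line_edge_event finXY)
      then show ?thesis by simp
    qed
    define K :: "(int ^ 'd) site_or_edge set" where "K = {Inr {on_line x, on_line y} |x y. x \<in> X \<and> y \<in> Y}"
    have "(line_coords A \<union> line_coords B) \<inter> K = {}"
    proof -
      have "{x, y} \<noteq> {j, k}" if "x \<in> X" "y \<in> Y" "j \<in> A \<and> k \<in> A \<or> j \<in> B \<and> k \<in> B" for x y j k
        using that XY disj by (auto simp: doubleton_eq_iff)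
      then show ?thesis unfolding K_def line_coords_def by (fastforce simp: on_line_pair_eq_iff)
    qed
    then have "measure seeds (?G \<inter> ?N) = measure seeds ?G * measure seeds ?N"
    proof (rule seeds_indep[OF G N])
      show "z' \<in> ?G" if "z \<in> ?G" "\<And>i. i \<in> line_coords A \<union> line_coords B \<Longrightarrow> z i = z' i" for z z'
        using that induced_line_cong[of A z z' \<beta> \<alpha>] induced_line_cong[of B z z' \<beta> \<alpha>] by simp
      show "z' \<in> ?N" if "z \<in> ?N" "\<And>i. i \<in> K \<Longrightarrow> z i = z' i" for z z'
      proof -
        have "z (Inr {on_line x, on_line y}) = z' (Inr {on_line x, on_line y})" if "x \<in> X" "y \<in> Y" for x y
          using that by (intro \<open>\<And>i. i \<in> K \<Longrightarrow> z i = z' i\<close>) (auto simp: K_def)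
        then show ?thesis using that(1) unfolding line_edge_def by simp
      qed
    qed
    moreover have "measure seeds ?N \<le> exp (- \<beta> * (\<Sum>x\<in>X. \<Sum>y\<in>Y. 1 / (real_of_int (x - y))\<^sup>2))"
    proof -
      have "\<beta> * (\<Sum>x\<in>X. \<Sum>y\<in>Y. 1 / (real_of_int (x - y))\<^sup>2) = (\<Sum>x\<in>X. \<Sum>y\<in>Y. \<beta> / (real_of_int (x - y))\<^sup>2)"
        by (simp add: sum_distrib_left)
      also have "\<dots> \<le> (\<Sum>x\<in>X. \<Sum>y\<in>Y. \<beta> / \<bar>real_of_int (x - y)\<bar> powr \<alpha>)"
      proof (intro sum_mono)
        fix x y assume "x \<in> X" "y \<in> Y"
        then have "x \<noteq> y" using disjXY by blast
        then have "1 \<le> \<bar>x - y\<bar>" by linarith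
        then have r: "1 \<le> \<bar>real_of_int (x - y)\<bar>" by linarith
        then have "\<bar>real_of_int (x - y)\<bar> powr \<alpha> \<le> \<bar>real_of_int (x - y)\<bar> powr 2"
          using assms(2) by (intro powr_mono) auto
        also have "\<dots> = (real_of_int (x - y))\<^sup>2" using r by simp
        finally have "\<bar>real_of_int (x - y)\<bar> powr \<alpha> \<le> (real_of_int (x - y))\<^sup>2" .
        moreover have "0 < \<bar>real_of_int (x - y)\<bar> powr \<alpha>" using r by simp
        ultimately show "\<beta> / (real_of_int (x - y))\<^sup>2 \<le> \<beta> / \<bar>real_of_int (x - y)\<bar> powr \<alpha>"
          using assms(3) by (intro divide_left_mono mult_pos_pos) auto
      qed
      finally show ?thesis
        using no_line_edge_prob[OF _ finXY disjXY, of \<beta> \<alpha>] assms(3) by simp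
    qed
    then have "measure seeds ?G * measure seeds ?N \<le> measure seeds ?G * exp (- \<beta> * (\<Sum>x\<in>X. \<Sum>y\<in>Y. 1 / (real_of_int (x - y))\<^sup>2))"
      by (rule mult_left_mono) simp
    moreover have "{z \<in> space seeds. (Q (induced (?E z) A) \<and> Q' (induced (?E z) B)) \<and> (\<forall>x\<in>X. \<forall>y\<in>Y. \<not> ?E z x y)} = ?G \<inter> ?N"
      by auto
    ultimately show "measure seeds {z \<in> space seeds. (Q (induced (?E z) A) \<and> Q' (induced (?E z) B)) \<and> (\<forall>x\<in>X. \<forall>y\<in>Y. \<not> ?E z x y)}
      \<le> measure seeds ?G * exp (- \<beta> * (\<Sum>x\<in>X. \<Sum>y\<in>Y. 1 / (real_of_int (x - y))\<^sup>2))"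
      by simp
  qed (rule assms(3))
qed

text \<open>Almost surely all weights in a finite block are at least \<open>w\<close>, so the edges of \<open>line_edge\<close> are open there.\<close>

lemma percolation_line:
  assumes card: "CARD('d) = 1" and \<alpha>: "0 < \<alpha>" "\<alpha> \<le> 2" and w: "0 < w" "measure D {w..} = 1"
    and lam: "0 \<le> lam" "496 \<le> lam * w * w"
  shows "0 < percolation_prob M W \<alpha> lam"
proof (rule percolation_from_dense_clusters[where \<epsilon> = "1 / 2"])
  fix N :: nat
  define \<beta> where "\<beta> = lam * w * w"
  interpret L: line_graph seeds "line_edge \<beta> \<alpha>" \<beta>
    by (rule line_graph_seeds) (use \<alpha> lam in \<open>auto simp: \<beta>_def\<close>)
  define s where "s = line_scale N"
  define B :: "(int ^ 'd) set" where "B = on_line ` seg s 0"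
  define S1 where "S1 = {z \<in> space seeds. good_block (cluster_density N) (line_edge \<beta> \<alpha> z) (seg s 0)}"
  define S2 :: "((int ^ 'd) site_or_edge \<Rightarrow> real) set" where "S2 = {z. \<forall>x\<in>B. z (Inl x) \<in> {w..}}"
  have cardB: "card B = 2 * s" unfolding B_def by (subst card_image) (auto simp: inj_on_def)
  have finB: "finite B" unfolding B_def by simp
  have S1: "S1 \<in> sets seeds" unfolding S1_def by (rule L.region_event) simp
  have "measure seeds S2 = (\<Prod>x\<in>B. measure (site_edge_law (Inl x)) {w..})"
    unfolding S2_def by (rule measure_seeds_cylinder) (use finB in auto)
  also have "\<dots> = 1" using w(2) by (intro prod.neutral) (auto simp: coordinate_law_def)
  finally have mS2: "measure seeds S2 = 1" .
  have S2: "S2 \<in> sets seeds"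
  proof -
    have "{z \<in> space seeds. \<forall>x\<in>B. z (Inl x) \<in> {w..}} \<in> sets seeds"
      using finB seeds_event[of "{w..}"] by (intro sets.sets_Collect_finite_All) auto
    then show ?thesis unfolding S2_def by simp
  qed
  have "measure seeds (space seeds - S1) \<le> (1 / 2) ^ 19 * (1 / 16) ^ N"
  proof -
    have "space seeds - S1 = {z \<in> space seeds. \<not> good_block (cluster_density N) (line_edge \<beta> \<alpha> z) (seg s 0)}"
      unfolding S1_def by auto
    then show ?thesis using L.sparse_seg_prob[of N 0] unfolding s_def by simp
  qed
  also have "\<dots> \<le> (1 / 2) ^ 19 * 1" by (intro mult_left_mono power_le_one) auto
  also have "\<dots> \<le> 1 / 2" by (simp add: power_divide)
  finally have half: "1 / 2 \<le> measure seeds S1" using seed.P.prob_compl[OF S1] by simp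
  have "measure seeds (S1 \<inter> S2) = measure seeds S1"
  proof (rule measure_eq_AE)
    have "AE z in seeds. z \<in> S2" using mS2 S2 seed.P.AE_prob_1 by blast
    then show "AE z in seeds. z \<in> S1 \<inter> S2 \<longleftrightarrow> z \<in> S1" by auto
  qed (use S1 S2 in auto)
  moreover have "\<exists>A\<subseteq>B. s \<le> card A \<and> (\<forall>x\<in>A. A \<subseteq> cluster (open_edge \<alpha> lam z) x)" if z: "z \<in> S1 \<inter> S2" for z
  proof -
    obtain A where A: "A \<subseteq> seg s 0" "cluster_density N * card (seg s 0) \<le> card A" "linked (induced (line_edge \<beta> \<alpha> z) (seg s 0)) A"
      using z unfolding S1_def dense_cluster_def by auto
    have step: "on_line u \<noteq> (on_line v :: int ^ 'd) \<and> open_edge \<alpha> lam z {on_line u, on_line v}"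
      if e: "line_edge \<beta> \<alpha> z u v" and uv: "u \<in> seg s 0" "v \<in> seg s 0" for u v
    proof -
      have ne: "on_line u \<noteq> (on_line v :: int ^ 'd)" using e by (simp add: line_edge_def)
      have "open_edge \<alpha> lam z {on_line u, on_line v}"
        by (rule open_edge_if_heavy[OF ne lam(1) _ \<alpha>(1), where w = w and r = "\<bar>real_of_int (u - v)\<bar>"])
           (use z uv e w in \<open>auto simp: S2_def B_def line_edge_def \<beta>_def lattice_dist_on_line[OF card]\<close>)
      then show ?thesis using ne by blast
    qed
    have "on_line y \<in> cluster (open_edge \<alpha> lam z) (on_line x)" if "x \<in> A" "y \<in> A" for x y
      using A(3) that cluster_of_linked[of x y "line_edge \<beta> \<alpha> z" "seg s 0" on_line "open_edge \<alpha> lam z", OF _ step]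
      unfolding linked_def by blast
    then have "\<forall>x\<in>on_line ` A. on_line ` A \<subseteq> cluster (open_edge \<alpha> lam z) x" by blast
    moreover have "card (on_line ` A :: (int ^ 'd) set) = card A" by (rule card_image) (simp add: inj_on_def)
    moreover have "s \<le> card A"
    proof -
      have "7 / 8 * (2 * real s) \<le> cluster_density N * (2 * real s)"
        using cluster_density_bounds[of N] by (intro mult_right_mono) auto
      then have "real s \<le> real (card A)" using A(2) by simp
      then show ?thesis by simp
    qed
    ultimately show ?thesis using A(1) unfolding B_def by (intro exI[of _ "on_line ` A"]) auto
  qed
  moreover have "N \<le> s" using line_scale_ge[of N] less_exp[of N] unfolding s_def by linarith
  ultimately show "\<exists>B m S. finite B \<and> N \<le> m \<and> 1 / 2 * real (card B) \<le> real m \<and> S \<in> sets seeds \<and> 1 / 2 \<le> measure seeds S \<and>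
        (\<forall>z\<in>S. \<exists>A\<subseteq>B. m \<le> card A \<and> (\<forall>x\<in>A. A \<subseteq> cluster (open_edge \<alpha> lam z) x))"
    using finB cardB S1 S2 half by (intro exI[of _ B] exI[of _ s] exI[of _ "S1 \<inter> S2"]) auto
qed (use lam in auto)

end

section \<open>Percolation in the plane\<close>

text \<open>The cell \<open>u\<close> is a segment of \<open>L\<close> vertices in direction \<open>i1\<close>, and the cells tile the plane spanned by the
  directions \<open>i1\<close> and \<open>i2\<close>.\<close>

definition in_cell :: "'d \<Rightarrow> 'd \<Rightarrow> nat \<Rightarrow> int \<times> int \<Rightarrow> nat \<Rightarrow> int ^ 'd" where
  "in_cell i1 i2 L u t = (\<chi> i. if i = i1 then fst u * int L + int t else if i = i2 then snd u else 0)"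

lemma in_cell_inject:
  assumes "i1 \<noteq> i2" "t < L" "t' < L" "in_cell i1 i2 L u t = in_cell i1 i2 L v t'"
  shows "u = v \<and> t = t'"
proof -
  have "in_cell i1 i2 L u t $ i1 = in_cell i1 i2 L v t' $ i1" "in_cell i1 i2 L u t $ i2 = in_cell i1 i2 L v t' $ i2"
    using assms(4) by simp_all
  then have 1: "fst u * int L + int t = fst v * int L + int t'" and 2: "snd u = snd v"
    using assms(1) by (simp_all add: in_cell_def split: if_splits)
  have "(fst u * int L + int t) div int L = fst u" "(fst v * int L + int t') div int L = fst v"
    using assms(2,3) by simp_all
  then have "fst u = fst v" using 1 by simp
  then show ?thesis using 1 2 by (simp add: prod_eq_iff)
qed

lemma norm_axis_real: "norm (axis i a :: real ^ 'd::finite) = \<bar>a\<bar>"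
  by (simp add: norm_eq_sqrt_inner inner_axis_axis)

lemma lattice_dist_in_cell:
  fixes i1 i2 :: "'d::finite"
  assumes "i1 \<noteq> i2" "t < L" "t' < L" "\<bar>fst u - fst v\<bar> \<le> 1" "\<bar>snd u - snd v\<bar> \<le> 1"
  shows "lattice_dist (in_cell i1 i2 L u t) (in_cell i1 i2 L v t') \<le> 2 * real L + 1"
proof -
  define a where "a = (fst u - fst v) * int L + (int t - int t')"
  define b where "b = snd u - snd v"
  have "(\<chi> i. real_of_int (in_cell i1 i2 L u t $ i - in_cell i1 i2 L v t' $ i)) = axis i1 (real_of_int a) + axis i2 (real_of_int b)"
    using assms(1) by (auto simp: vec_eq_iff in_cell_def axis_def a_def b_def algebra_simps)
  then have "lattice_dist (in_cell i1 i2 L u t) (in_cell i1 i2 L v t') \<le> \<bar>real_of_int a\<bar> + \<bar>real_of_int b\<bar>"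
    unfolding lattice_dist_def
    using norm_triangle_ineq[of "axis i1 (real_of_int a)" "axis i2 (real_of_int b)"] by (simp add: norm_axis_real)
  moreover have "\<bar>a\<bar> \<le> 2 * int L"
  proof -
    have "\<bar>(fst u - fst v) * int L\<bar> \<le> 1 * int L"
      unfolding abs_mult using assms(4) by (intro mult_mono) auto
    then show ?thesis using assms(2,3) unfolding a_def by linarith
  qed
  then have "\<bar>real_of_int a\<bar> \<le> 2 * real L" by linarith
  moreover have "\<bar>real_of_int b\<bar> \<le> 1" using assms(5) unfolding b_def by linarith
  ultimately show ?thesis by linarith
qed

context iid_weights
begin

definition heavy_cell :: "'d \<Rightarrow> 'd \<Rightarrow> nat \<Rightarrow> real \<Rightarrow> ((int ^ 'd) site_or_edge \<Rightarrow> real) \<Rightarrow> int \<times> int \<Rightarrow> bool" where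
  "heavy_cell i1 i2 L w z u \<longleftrightarrow> (\<exists>t<L. w \<le> z (Inl (in_cell i1 i2 L u t)))"

text \<open>Diagonal neighbours are included, so that any two cells of a square of side two are neighbours. All
  edges between the two cells are required to lie below the threshold, regardless of which vertices are
  heavy. So the edge part of the definition does not depend on the weights.\<close>

definition cell_edge :: "'d \<Rightarrow> 'd \<Rightarrow> nat \<Rightarrow> real \<Rightarrow> real \<Rightarrow> ((int ^ 'd) site_or_edge \<Rightarrow> real) \<Rightarrow> int \<times> int \<Rightarrow> int \<times> int \<Rightarrow> bool" where
  "cell_edge i1 i2 L w b z u v \<longleftrightarrow> u \<noteq> v \<and> \<bar>fst u - fst v\<bar> \<le> 1 \<and> \<bar>snd u - snd v\<bar> \<le> 1 \<and>
     heavy_cell i1 i2 L w z u \<and> heavy_cell i1 i2 L w z v \<and>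
     (\<forall>t<L. \<forall>t'<L. z (Inr {in_cell i1 i2 L u t, in_cell i1 i2 L v t'}) < 1 - exp (- b))"

lemma heavy_cell_event: "{z \<in> space seeds. heavy_cell i1 i2 L w z u} \<in> sets seeds"
proof -
  have eq: "{z \<in> space seeds. heavy_cell i1 i2 L w z u} = (\<Union>t\<in>{..<L}. {z. z (Inl (in_cell i1 i2 L u t)) \<in> {w..}})"
    unfolding heavy_cell_def by auto
  show ?thesis unfolding eq by (intro sets.finite_UN seeds_event) auto
qed

lemma cell_edge_event: "{z \<in> space seeds. cell_edge i1 i2 L w b z u v} \<in> sets seeds"
proof -
  have light: "{z \<in> space seeds. \<forall>t\<in>{..<L}. \<forall>t'\<in>{..<L}. z (Inr {in_cell i1 i2 L u t, in_cell i1 i2 L v t'}) \<in> {..<1 - exp (- b)}} \<in> sets seeds"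
    by (intro sets.sets_Collect_finite_All) (auto intro: seeds_event[unfolded lessThan_def mem_Collect_eq] simp: seeds_event[of "{..<1 - exp (- b)}", simplified])
  have eq: "{z \<in> space seeds. cell_edge i1 i2 L w b z u v} =
     {z \<in> space seeds. u \<noteq> v \<and> \<bar>fst u - fst v\<bar> \<le> 1 \<and> \<bar>snd u - snd v\<bar> \<le> 1} \<inter>
     {z \<in> space seeds. heavy_cell i1 i2 L w z u} \<inter> {z \<in> space seeds. heavy_cell i1 i2 L w z v} \<inter>
     {z \<in> space seeds. \<forall>t\<in>{..<L}. \<forall>t'\<in>{..<L}. z (Inr {in_cell i1 i2 L u t, in_cell i1 i2 L v t'}) \<in> {..<1 - exp (- b)}}"
    unfolding cell_edge_def by auto
  show ?thesis unfolding eq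
    by (intro sets.Int sets.sets_Collect_const heavy_cell_event light)
qed

lemma cell_edge_sym: "cell_edge i1 i2 L w b z u v \<Longrightarrow> cell_edge i1 i2 L w b z v u"
  unfolding cell_edge_def by (auto simp: insert_commute abs_minus_commute)

definition cell_coords :: "'d \<Rightarrow> 'd \<Rightarrow> nat \<Rightarrow> (int \<times> int) set \<Rightarrow> (int ^ 'd) site_or_edge set" where
  "cell_coords i1 i2 L B = {Inl (in_cell i1 i2 L u t) |u t. u \<in> B \<and> t < L} \<union>
     {Inr {in_cell i1 i2 L u t, in_cell i1 i2 L v t'} |u v t t'. u \<in> B \<and> v \<in> B \<and> t < L \<and> t' < L}"

lemma induced_cell_cong:
  assumes "\<And>i. i \<in> cell_coords i1 i2 L B \<Longrightarrow> z i = z' i"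
  shows "induced (cell_edge i1 i2 L w b z) B = induced (cell_edge i1 i2 L w b z') B"
proof -
  have "z (Inr {in_cell i1 i2 L u t, in_cell i1 i2 L v t'}) = z' (Inr {in_cell i1 i2 L u t, in_cell i1 i2 L v t'})"
    if "u \<in> B" "v \<in> B" "t < L" "t' < L" for u v t t'
    using that unfolding cell_coords_def by (intro assms[unfolded cell_coords_def] UnI2) blast
  moreover have "z (Inl (in_cell i1 i2 L u t)) = z' (Inl (in_cell i1 i2 L u t))" if "u \<in> B" "t < L" for u t
    using that unfolding cell_coords_def by (intro assms[unfolded cell_coords_def] UnI1) blast
  ultimately show ?thesis unfolding induced_def cell_edge_def heavy_cell_def by auto
qed

lemma cell_coords_disjoint:
  fixes i1 i2 :: 'd
  assumes "i1 \<noteq> i2" "A \<inter> B = {}" shows "cell_coords i1 i2 L A \<inter> cell_coords i1 i2 L B = {}"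
proof -
  have ne: "in_cell i1 i2 L u t \<noteq> in_cell i1 i2 L v t'" if "u \<in> A" "v \<in> B" "t < L" "t' < L" for u v t t'
    using in_cell_inject[OF assms(1) that(3,4)] that(1,2) assms(2) by blast
  show ?thesis
  proof (rule equals0I)
    fix i assume i: "i \<in> cell_coords i1 i2 L A \<inter> cell_coords i1 i2 L B"
    show False
    proof (cases i)
      case (Inl x)
      then show False using i ne unfolding cell_coords_def by auto
    next
      case (Inr e)
      obtain u v t t' where 1: "e = {in_cell i1 i2 L u t, in_cell i1 i2 L v t'}" "u \<in> A" "v \<in> A" "t < L" "t' < L"
        using i unfolding Inr cell_coords_def by auto
      obtain u' v' s s' where 2: "e = {in_cell i1 i2 L u' s, in_cell i1 i2 L v' s'}" "u' \<in> B" "v' \<in> B" "s < L" "s' < L"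
        using i unfolding Inr cell_coords_def by auto
      have "in_cell i1 i2 L u t \<in> {in_cell i1 i2 L u' s, in_cell i1 i2 L v' s'}" using 1(1) 2(1) by blast
      then show False using ne[of u u' t s] ne[of u v' t s'] 1 2 by blast
    qed
  qed
qed

lemma no_heavy_cell_prob:
  fixes i1 i2 :: 'd
  assumes "i1 \<noteq> i2"
  shows "measure seeds {z \<in> space seeds. \<not> heavy_cell i1 i2 L w z u} = measure D {..<w} ^ L"
proof -
  let ?f = "\<lambda>t. Inl (in_cell i1 i2 L u t) :: (int ^ 'd) site_or_edge"
  have inj: "inj_on ?f {..<L}"
    using in_cell_inject[OF assms] by (intro inj_onI) blast
  have "{z \<in> space seeds. \<not> heavy_cell i1 i2 L w z u} = {z. \<forall>t\<in>{..<L}. z (?f t) \<in> {..<w}}"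
    unfolding heavy_cell_def by (auto simp: not_le)
  also have "measure seeds \<dots> = (\<Prod>t<L. measure (site_edge_law (?f t)) {..<w})"
    by (rule measure_seeds_cylinder[OF _ inj]) auto
  also have "\<dots> = (\<Prod>t<L. measure D {..<w})" by (simp add: coordinate_law_def)
  finally show ?thesis by simp
qed

lemma closed_edge_prob:
  assumes "0 \<le> b"
  shows "measure seeds {z. z (Inr e) \<in> {1 - exp (- b)..}} = exp (- b)"
proof -
  have "measure seeds {z. \<forall>e\<in>{e}. z (Inr e) \<in> {1 - exp (- b)..}} = (\<Prod>e\<in>{e}. measure (site_edge_law (Inr e)) {1 - exp (- b)..})"
    by (rule measure_seeds_cylinder) auto
  then show ?thesis using measure_uniform_ge[OF assms] by (simp add: coordinate_law_def)
qed

text \<open>A square of side two fails to be connected only if one of its four cells is not heavy, or one of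
  the edges between its cells, of which there are at most \<open>16 * L\<^sup>2\<close>, exceeds the threshold.\<close>

lemma plane_graph_seeds:
  fixes i1 i2 :: 'd
  assumes i: "i1 \<noteq> i2" and b: "0 \<le> b"
    and small: "4 * measure D {..<w} ^ L + 16 * (real L)\<^sup>2 * exp (- b) \<le> (1 / 2) ^ 24"
  shows "plane_graph seeds (cell_edge i1 i2 L w b)"
proof -
  let ?E = "cell_edge i1 i2 L w b"
  have R: "random_graph seeds ?E"
    by (rule random_graph_seeds[where K = "cell_coords i1 i2 L"])
       (fact cell_edge_event cell_edge_sym cell_coords_disjoint[OF i] induced_cell_cong)+
  show ?thesis
  proof (intro plane_graph.intro[OF R] plane_graph_axioms.intro)
    fix z :: "int \<times> int"
    let ?T = "(sq 1 z \<times> sq 1 z) \<times> ({..<L} \<times> {..<L})"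
    let ?h = "\<lambda>u. {s \<in> space seeds. \<not> heavy_cell i1 i2 L w s u}"
    let ?c = "\<lambda>((u, v), (t, t')). {s. s (Inr {in_cell i1 i2 L u t, in_cell i1 i2 L v t'}) \<in> {1 - exp (- b)..}} :: ((int ^ 'd) site_or_edge \<Rightarrow> real) set"
    have h: "?h u \<in> sets seeds" for u
      by (intro sets.sets_Collect_neg heavy_cell_event)
    have c: "?c p \<in> sets seeds" for p
      by (cases p) (auto intro!: seeds_event simp del: atLeast_iff)
    have "{s \<in> space seeds. \<not> good_block 1 (?E s) (sq 1 z)} \<subseteq> (\<Union>u\<in>sq 1 z. ?h u) \<union> (\<Union>p\<in>?T. ?c p)"
    proof (rule subsetI, rule ccontr)
      fix s assume "s \<in> {s \<in> space seeds. \<not> good_block 1 (?E s) (sq 1 z)}"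
        and e: "s \<notin> (\<Union>u\<in>sq 1 z. ?h u) \<union> (\<Union>p\<in>?T. ?c p)"
      then have no: "\<not> good_block 1 (?E s) (sq 1 z)" by simp
      have "?E s u v" if uv: "u \<in> sq 1 z" "v \<in> sq 1 z" "u \<noteq> v" for u v
      proof -
        have "heavy_cell i1 i2 L w s u" "heavy_cell i1 i2 L w s v" using e uv by auto
        moreover have "s (Inr {in_cell i1 i2 L u t, in_cell i1 i2 L v t'}) < 1 - exp (- b)" if "t < L" "t' < L" for t t'
        proof (rule ccontr)
          assume "\<not> ?thesis"
          then have "s \<in> ?c ((u, v), (t, t'))" by simp
          moreover have "((u, v), (t, t')) \<in> ?T" using uv that by simp
          ultimately show False using e by blast
        qed
        moreover have "\<bar>fst u - fst v\<bar> \<le> 1" "\<bar>snd u - snd v\<bar> \<le> 1"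
          using uv by (auto simp: sq_def seg_def)
        ultimately show ?thesis using uv(3) unfolding cell_edge_def by blast
      qed
      then have "linked (induced (?E s) (sq 1 z)) (sq 1 z)"
        unfolding linked_def induced_def by (metis (no_types, lifting) case_prodI mem_Collect_eq r_into_rtrancl rtrancl.rtrancl_refl)
      then show False using no unfolding dense_cluster_def by auto
    qed
    then have "measure seeds {s \<in> space seeds. \<not> good_block 1 (?E s) (sq 1 z)}
      \<le> measure seeds ((\<Union>u\<in>sq 1 z. ?h u) \<union> (\<Union>p\<in>?T. ?c p))"
      using h c by (intro seed.P.finite_measure_mono sets.Un sets.finite_UN) auto
    also have "\<dots> \<le> measure seeds (\<Union>u\<in>sq 1 z. ?h u) + measure seeds (\<Union>p\<in>?T. ?c p)"
      using h c by (intro measure_Un_le sets.finite_UN) auto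
    also have "\<dots> \<le> (\<Sum>u\<in>sq 1 z. measure seeds (?h u)) + (\<Sum>p\<in>?T. measure seeds (?c p))"
      using h c by (intro add_mono seed.P.finite_measure_subadditive_finite) auto
    also have "(\<Sum>u\<in>sq 1 z. measure seeds (?h u)) = 4 * measure D {..<w} ^ L"
      unfolding no_heavy_cell_prob[OF i] by simp
    also have "(\<Sum>p\<in>?T. measure seeds (?c p)) = (\<Sum>p\<in>?T. exp (- b))"
    proof (rule sum.cong[OF refl])
      fix p :: "((int \<times> int) \<times> (int \<times> int)) \<times> (nat \<times> nat)"
      obtain u v t t' where p: "p = ((u, v), (t, t'))" by (metis surj_pair)
      show "measure seeds (?c p) = exp (- b)" unfolding p prod.case by (rule closed_edge_prob[OF b])
    qed
    also have "(\<Sum>p\<in>?T. exp (- b)) = 16 * (real L)\<^sup>2 * exp (- b)"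
      by (simp add: card_cartesian_product power2_eq_square)
    finally show "measure seeds {s \<in> space seeds. \<not> good_block 1 (?E s) (sq 1 z)} \<le> (1 / 2) ^ 24"
      using small by linarith
  qed
qed

text \<open>A connected set of cells gives a connected set of heavy vertices, one in each cell, so the density
  drops by a factor of order \<open>L\<close> only.\<close>

lemma percolation_plane:
  fixes i1 i2 :: 'd
  assumes i: "i1 \<noteq> i2" and \<alpha>: "0 < \<alpha>" and w: "0 \<le> w" and lam: "0 \<le> lam" and L: "0 < L"
  defines "b \<equiv> lam * w * w / (2 * real L + 1) powr \<alpha>"
  assumes small: "4 * measure D {..<w} ^ L + 16 * (real L)\<^sup>2 * exp (- b) \<le> (1 / 2) ^ 24"
  shows "0 < percolation_prob M W \<alpha> lam"
proof (rule percolation_from_dense_clusters[where \<epsilon> = "1 / (4 * real L)"])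
  fix N :: nat
  let ?E = "cell_edge i1 i2 L w b"
  have b: "0 \<le> b" using lam w by (simp add: b_def)
  interpret G: plane_graph seeds ?E by (rule plane_graph_seeds[OF i b small])
  define s where "s = plane_scale N"
  let ?Q = "sq s (0, 0)"
  define B :: "(int ^ 'd) set" where "B = (\<lambda>(u, t). in_cell i1 i2 L u t) ` (?Q \<times> {..<L})"
  define S where "S = {z \<in> space seeds. good_block (cluster_density N) (?E z) ?Q}"
  have finB: "finite B" unfolding B_def by simp
  have cardB: "card B \<le> 4 * s\<^sup>2 * L"
    unfolding B_def using card_image_le[of "?Q \<times> {..<L}" "\<lambda>(u, t). in_cell i1 i2 L u t"] by (simp add: card_cartesian_product)
  have S: "S \<in> sets seeds" unfolding S_def by (rule G.region_event) simp
  have "measure seeds (space seeds - S) \<le> (1 / 2) ^ 24 * (1 / 16) ^ N"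
  proof -
    have "space seeds - S = {z \<in> space seeds. \<not> good_block (cluster_density N) (?E z) ?Q}"
      unfolding S_def by auto
    then show ?thesis using G.sparse_sq_prob[of N "(0, 0)"] unfolding s_def by simp
  qed
  also have "\<dots> \<le> (1 / 2) ^ 24 * 1" by (intro mult_left_mono power_le_one) auto
  also have "\<dots> \<le> 1 / 2" by (simp add: power_divide)
  finally have half: "1 / 2 \<le> measure seeds S" using seed.P.prob_compl[OF S] by simp
  have "\<exists>A\<subseteq>B. s\<^sup>2 \<le> card A \<and> (\<forall>x\<in>A. A \<subseteq> cluster (open_edge \<alpha> lam z) x)" if z: "z \<in> S" for z
  proof -
    obtain A where A: "A \<subseteq> ?Q" "cluster_density N * card ?Q \<le> card A" "linked (induced (?E z) ?Q) A"
      using z unfolding S_def dense_cluster_def by auto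
    (* A heavy vertex of the cell if there is one, and otherwise any vertex, so that f is injective. *)
    define t where "t u = (SOME t. t < L \<and> (heavy_cell i1 i2 L w z u \<longrightarrow> w \<le> z (Inl (in_cell i1 i2 L u t))))" for u
    have "\<exists>t. t < L \<and> (heavy_cell i1 i2 L w z u \<longrightarrow> w \<le> z (Inl (in_cell i1 i2 L u t)))" for u
      using L unfolding heavy_cell_def by blast
    from someI_ex[OF this] have t: "t u < L" "heavy_cell i1 i2 L w z u \<Longrightarrow> w \<le> z (Inl (in_cell i1 i2 L u (t u)))" for u
      unfolding t_def by blast+
    define f where "f u = in_cell i1 i2 L u (t u)" for u
    have inj: "f u = f v \<longleftrightarrow> u = v" for u v
      using in_cell_inject[OF i t(1)[of u] t(1)[of v], of u v] unfolding f_def by blast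
    have step: "f u \<noteq> f v \<and> open_edge \<alpha> lam z {f u, f v}" if e: "?E z u v" for u v
    proof -
      have ne: "f u \<noteq> f v" using e inj by (simp add: cell_edge_def)
      have "open_edge \<alpha> lam z {f u, f v}"
      proof (rule open_edge_if_heavy[OF ne lam w \<alpha>])
        show "lattice_dist (f u) (f v) \<le> 2 * real L + 1"
          unfolding f_def using e unfolding cell_edge_def by (intro lattice_dist_in_cell[OF i t(1) t(1)]) blast+
        show "w \<le> z (Inl (f u))" "w \<le> z (Inl (f v))"
          using t(2) e unfolding f_def cell_edge_def by blast+
        show "z (Inr {f u, f v}) < 1 - exp (- (lam * w * w / (2 * real L + 1) powr \<alpha>))"
          using e t(1)[of u] t(1)[of v] unfolding f_def cell_edge_def b_def by blast
      qed
      then show ?thesis using ne by blast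
    qed
    have "f y \<in> cluster (open_edge \<alpha> lam z) (f x)" if "x \<in> A" "y \<in> A" for x y
      using A(3) that cluster_of_linked[of x y "?E z" ?Q f "open_edge \<alpha> lam z", OF _ step]
      unfolding linked_def by blast
    then have "\<forall>x\<in>f ` A. f ` A \<subseteq> cluster (open_edge \<alpha> lam z) x" by blast
    moreover have "card (f ` A) = card A" by (rule card_image) (simp add: inj_on_def inj)
    moreover have "s\<^sup>2 \<le> card A"
    proof -
      have "1 / 4 * (4 * (real s)\<^sup>2) \<le> cluster_density N * (4 * (real s)\<^sup>2)"
        using cluster_density_bounds[of N] by (intro mult_right_mono) auto
      also have "\<dots> \<le> real (card A)" using A(2) by simp
      finally have "real (s\<^sup>2) \<le> real (card A)" by simp
      then show ?thesis by (simp only: of_nat_le_iff)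
    qed
    moreover have "f ` A \<subseteq> B" using A(1) t(1) unfolding B_def f_def by force
    ultimately show ?thesis by (intro exI[of _ "f ` A"]) auto
  qed
  moreover have "N \<le> s\<^sup>2"
  proof -
    have "N \<le> s" using plane_scale_ge[of N] less_exp[of N] unfolding s_def by linarith
    also have "s \<le> s\<^sup>2" by (simp add: power2_eq_square)
    finally show ?thesis .
  qed
  moreover have "1 / (4 * real L) * real (card B) \<le> real (s\<^sup>2)"
  proof -
    have "real (card B) \<le> real (4 * s\<^sup>2 * L)" using cardB by (simp only: of_nat_le_iff)
    then have "1 / (4 * real L) * real (card B) \<le> 1 / (4 * real L) * real (4 * s\<^sup>2 * L)"
      by (intro mult_left_mono) auto
    also have "\<dots> = real (s\<^sup>2)" using L by simp
    finally show ?thesis .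
  qed
  ultimately show "\<exists>B m S. finite B \<and> N \<le> m \<and> 1 / (4 * real L) * real (card B) \<le> real m \<and> S \<in> sets seeds \<and> 1 / 2 \<le> measure seeds S \<and>
        (\<forall>z\<in>S. \<exists>A\<subseteq>B. m \<le> card A \<and> (\<forall>x\<in>A. A \<subseteq> cluster (open_edge \<alpha> lam z) x))"
    using finB S half by (intro exI[of _ B] exI[of _ "s\<^sup>2"] exI[of _ S]) auto
qed (use lam L in auto)

lemma percolation_plane_eventually:
  fixes i1 i2 :: 'd
  assumes i: "i1 \<noteq> i2" and \<alpha>: "0 < \<alpha>" and w: "0 < w" "measure D {..<w} < 1"
  shows "\<exists>lam>0. 0 < percolation_prob M W \<alpha> lam"
proof -
  have "(\<lambda>L. measure D {..<w} ^ L) \<longlonglongrightarrow> 0"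
    using w(2) by (intro LIMSEQ_realpow_zero) auto
  then have "eventually (\<lambda>L. measure D {..<w} ^ L < (1 / 2) ^ 27) sequentially"
    by (rule order_tendstoD) simp
  then have "eventually (\<lambda>L. 0 < L \<and> measure D {..<w} ^ L < (1 / 2) ^ 27) sequentially"
    by (rule eventually_conj[OF eventually_gt_at_top])
  then obtain L :: nat where L: "0 < L" "measure D {..<w} ^ L < (1 / 2) ^ 27"
    by (auto dest: eventually_happens)
  (* Chosen so that 16 * L\<^sup>2 * exp (- x) is at most (1 / 2) ^ 25. *)
  define x where "x = max 1 (ln (16 * (real L)\<^sup>2 * 2 ^ 25))"
  define R where "R = (2 * real L + 1) powr \<alpha>"
  have R: "0 < R" unfolding R_def by simp
  define lam where "lam = x * R / (w * w)"
  have lam: "0 < lam" using R w unfolding lam_def x_def by simp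
  have b: "lam * w * w / R = x" using R w unfolding lam_def by simp
  have "16 * (real L)\<^sup>2 * exp (- x) \<le> (1 / 2) ^ 25"
  proof -
    have "0 < 16 * (real L)\<^sup>2 * 2 ^ 25" using L by simp
    then have "16 * (real L)\<^sup>2 * 2 ^ 25 = exp (ln (16 * (real L)\<^sup>2 * 2 ^ 25))" by simp
    also have "\<dots> \<le> exp x" unfolding x_def by simp
    finally show ?thesis by (simp add: exp_minus field_simps power_divide)
  qed
  then have "4 * measure D {..<w} ^ L + 16 * (real L)\<^sup>2 * exp (- (lam * w * w / (2 * real L + 1) powr \<alpha>)) \<le> (1 / 2) ^ 24"
    using L(2) b unfolding R_def by (simp add: power_divide)
  then have "0 < percolation_prob M W \<alpha> lam"
    by (intro percolation_plane[OF i \<alpha> _ _ L(1), of w]) (use w lam in auto)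
  then show ?thesis using lam by blast
qed

end

section \<open>Weight moments and crossing edges on the line\<close>

lemma one_minus_exp_le_powr:
  fixes t s :: real
  assumes "0 \<le> t" "0 < s" "s \<le> 1"
  shows "1 - exp (- t) \<le> t powr s"
proof (cases "t \<le> 1")
  case True
  have "1 - exp (- t) \<le> t" using exp_ge_add_one_self[of "- t"] by simp
  also have "t \<le> t powr s"
    using powr_mono'[of s 1 t] assms True by (cases "t = 0") auto
  finally show ?thesis .
next
  case False
  have "1 - exp (- t) \<le> 1" by simp
  also have "1 \<le> t powr s" using False assms by (intro ge_one_powr_ge_zero) auto
  finally show ?thesis .
qed

text \<open>Every term is at most \<open>T powr (1 / s)\<close>, so \<open>t i = t i powr s * t i powr (1 - s)\<close> is at most
  \<open>t i powr s * T powr ((1 - s) / s)\<close>.\<close>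

lemma sum_le_of_powr_sum:
  fixes t :: "'i \<Rightarrow> real"
  assumes "finite I" "\<And>i. i \<in> I \<Longrightarrow> 0 \<le> t i" "0 < s" "s \<le> 1" and T: "(\<Sum>i\<in>I. t i powr s) \<le> T"
  shows "(\<Sum>i\<in>I. t i) \<le> T powr (1 / s)"
proof -
  have T0: "0 \<le> T" using T sum_nonneg[of I "\<lambda>i. t i powr s"] by auto
  have "t i \<le> t i powr s * T powr ((1 - s) / s)" if i: "i \<in> I" for i
  proof (cases "t i = 0")
    case False
    then have ti: "0 < t i" using assms(2)[OF i] by simp
    have "t i powr s \<le> T"
      using member_le_sum[OF i, of "\<lambda>i. t i powr s"] assms(1) T by auto
    then have "(t i powr s) powr ((1 - s) / s) \<le> T powr ((1 - s) / s)"
      using assms(3,4) by (intro powr_mono2) auto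
    moreover have "(t i powr s) powr ((1 - s) / s) = t i powr (1 - s)"
      using assms(3) by (simp add: powr_powr)
    moreover have "t i = t i powr s * t i powr (1 - s)"
      using ti by (simp add: powr_add[symmetric])
    ultimately show ?thesis by (metis mult_left_mono powr_ge_zero)
  qed simp
  then have "(\<Sum>i\<in>I. t i) \<le> (\<Sum>i\<in>I. t i powr s * T powr ((1 - s) / s))" by (rule sum_mono)
  also have "\<dots> = (\<Sum>i\<in>I. t i powr s) * T powr ((1 - s) / s)" by (rule sum_distrib_right[symmetric])
  also have "\<dots> \<le> T * T powr ((1 - s) / s)" using T by (intro mult_right_mono) auto
  also have "\<dots> = T powr (1 / s)"
  proof (cases "T = 0")
    case False
    then have "0 < T" using T0 by simp
    then have "T * T powr ((1 - s) / s) = T powr (1 + (1 - s) / s)" by (simp add: powr_add)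
    also have "1 + (1 - s) / s = 1 / s" using assms(3) by (simp add: field_simps)
    finally show ?thesis .
  qed simp
  finally show ?thesis .
qed

lemma dyadic_bound:
  fixes w s :: real
  assumes "0 \<le> w" "0 < s"
  shows "ennreal (w powr s) \<le> 1 + (\<Sum>k. ennreal (2 powr (real (Suc k) * s)) * indicator {2 ^ k<..} w)"
proof (cases "w \<le> 1")
  case True
  then have "w powr s \<le> 1" using assms powr_mono2[of s w 1] by simp
  then have "ennreal (w powr s) \<le> 1" by simp
  then show ?thesis by (rule order_trans) simp
next
  case False
  (* The dyadic interval that contains w. *)
  define k where "k = (LEAST k. w \<le> 2 ^ Suc k)"
  obtain n where "w < 2 ^ n" using real_arch_pow[of 2 w] by auto
  moreover have "(2 :: real) ^ n \<le> 2 ^ Suc n" by simp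
  ultimately have "w \<le> 2 ^ Suc n" by linarith
  then have k: "w \<le> 2 ^ Suc k" unfolding k_def by (rule LeastI)
  have k': "2 ^ k < w"
  proof (cases k)
    case 0
    then show ?thesis using False by simp
  next
    case (Suc j)
    then have "\<not> w \<le> 2 ^ Suc j" unfolding k_def using not_less_Least by (metis lessI)
    then show ?thesis using Suc by simp
  qed
  have "w powr s \<le> (2 ^ Suc k) powr s" using k assms by (intro powr_mono2) auto
  also have "\<dots> = 2 powr (real (Suc k) * s)" by (simp add: powr_powr flip: powr_realpow del: power_Suc)
  finally have "ennreal (w powr s) \<le> ennreal (2 powr (real (Suc k) * s)) * indicator {2 ^ k<..} w"
    using k' by (simp add: ennreal_leI)
  also have "\<dots> \<le> (\<Sum>k. ennreal (2 powr (real (Suc k) * s)) * indicator {2 ^ k<..} w)"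
  proof -
    have "f k \<le> (\<Sum>k. f k)" for f :: "nat \<Rightarrow> ennreal"
      using sum_le_suminf[of f "{k}"] by simp
    then show ?thesis .
  qed
  also have "\<dots> \<le> 1 + (\<Sum>k. ennreal (2 powr (real (Suc k) * s)) * indicator {2 ^ k<..} w)" by simp
  finally show ?thesis .
qed

context iid_weights
begin

text \<open>Cut the range of the weight dyadically: the interval from \<open>2 ^ k\<close> to \<open>2 ^ (k + 1)\<close> contributes a term of a
  geometric series with ratio \<open>2 powr (s - (\<tau> - 1))\<close>.\<close>

lemma weight_moment:
  assumes tail: "\<And>w. 0 < w \<Longrightarrow> measure D {w<..} \<le> c * w powr (- (\<tau> - 1))" and "0 < c" "0 < s" "s < \<tau> - 1"
  shows "integrable M (\<lambda>\<omega>. W x \<omega> powr s)"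
proof (rule integrableI_bounded)
  let ?r = "2 powr (s - (\<tau> - 1))"
  have P: "emeasure M {\<omega> \<in> space M. 2 ^ k < W x \<omega>} \<le> ennreal (c * (2 ^ k) powr (- (\<tau> - 1)))" for k :: nat
  proof -
    have "{\<omega> \<in> space M. 2 ^ k < W x \<omega>} = W x -` {2 ^ k<..} \<inter> space M" by auto
    then have "prob {\<omega> \<in> space M. 2 ^ k < W x \<omega>} = measure D {2 ^ k<..}"
      using measure_distr[OF W_measurable, of "{2 ^ k<..}" x] law[of x] by simp
    then show ?thesis using tail[of "2 ^ k"] by (simp add: emeasure_eq_measure ennreal_leI)
  qed
  have "(\<integral>\<^sup>+\<omega>. ennreal (norm (W x \<omega> powr s)) \<partial>M) \<le> (\<integral>\<^sup>+\<omega>. 1 + (\<Sum>k. ennreal (2 powr (real (Suc k) * s)) * indicator {2 ^ k<..} (W x \<omega>)) \<partial>M)"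
    using nonneg assms(3) by (intro nn_integral_mono) (simp add: dyadic_bound del: of_nat_Suc)
  also have "\<dots> = 1 + (\<integral>\<^sup>+\<omega>. (\<Sum>k. ennreal (2 powr (real (Suc k) * s)) * indicator {2 ^ k<..} (W x \<omega>)) \<partial>M)"
    by (subst nn_integral_add) (auto simp: emeasure_space_1)
  also have "(\<integral>\<^sup>+\<omega>. (\<Sum>k. ennreal (2 powr (real (Suc k) * s)) * indicator {2 ^ k<..} (W x \<omega>)) \<partial>M)
     = (\<Sum>k. \<integral>\<^sup>+\<omega>. ennreal (2 powr (real (Suc k) * s)) * indicator {2 ^ k<..} (W x \<omega>) \<partial>M)"
    by (rule nn_integral_suminf) measurable
  also have "\<dots> \<le> (\<Sum>k. ennreal (c * 2 powr s * ?r ^ k))"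
  proof (rule suminf_le)
    fix k :: nat
    have "(\<integral>\<^sup>+\<omega>. ennreal (2 powr (real (Suc k) * s)) * indicator {2 ^ k<..} (W x \<omega>) \<partial>M)
       = (\<integral>\<^sup>+\<omega>. ennreal (2 powr (real (Suc k) * s)) * indicator {\<omega> \<in> space M. 2 ^ k < W x \<omega>} \<omega> \<partial>M)"
      by (intro nn_integral_cong) (auto simp: indicator_def)
    also have "\<dots> = ennreal (2 powr (real (Suc k) * s)) * emeasure M {\<omega> \<in> space M. 2 ^ k < W x \<omega>}"
      by (rule nn_integral_cmult_indicator) measurable
    also have "\<dots> \<le> ennreal (2 powr (real (Suc k) * s)) * ennreal (c * (2 ^ k) powr (- (\<tau> - 1)))"
      by (intro mult_left_mono P) simp
    also have "\<dots> = ennreal (2 powr (real (Suc k) * s) * (c * (2 ^ k) powr (- (\<tau> - 1))))"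
      by (rule ennreal_mult'[symmetric]) simp
    also have "2 powr (real (Suc k) * s) * (c * (2 ^ k) powr (- (\<tau> - 1))) = c * 2 powr s * ?r ^ k"
    proof -
      have "(2 ^ k) powr (- (\<tau> - 1)) = 2 powr (real k * (- (\<tau> - 1)))" by (simp add: powr_powr flip: powr_realpow)
      moreover have "?r ^ k = 2 powr (real k * (s - (\<tau> - 1)))" by (simp add: powr_powr mult.commute flip: powr_realpow)
      moreover have "2 powr (real (Suc k) * s) * 2 powr (real k * (- (\<tau> - 1))) = 2 powr s * 2 powr (real k * (s - (\<tau> - 1)))"
        unfolding powr_add[symmetric] by (simp add: algebra_simps)
      ultimately show ?thesis by (simp add: mult_ac)
    qed
    finally show "(\<integral>\<^sup>+\<omega>. ennreal (2 powr (real (Suc k) * s)) * indicator {2 ^ k<..} (W x \<omega>) \<partial>M) \<le> ennreal (c * 2 powr s * ?r ^ k)" .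
  qed auto
  also have "\<dots> < \<top>"
  proof -
    have "?r < 1" using assms(4) powr_less_mono[of "s - (\<tau> - 1)" 0 2] by simp
    then have "summable (\<lambda>k. c * 2 powr s * ?r ^ k)" by (intro summable_mult summable_geometric) simp
    then have "(\<Sum>k. ennreal (c * 2 powr s * ?r ^ k)) = ennreal (\<Sum>k. c * 2 powr s * ?r ^ k)"
      using assms(2) by (intro suminf_ennreal2) auto
    then show ?thesis by simp
  qed
  finally show "(\<integral>\<^sup>+\<omega>. ennreal (norm (W x \<omega> powr s)) \<partial>M) < \<infinity>" by simp
qed simp

lemma weight_moment_eq: "expectation (\<lambda>\<omega>. W x \<omega> powr s) = (\<integral>w. w powr s \<partial>D)"
proof -
  have "(\<integral>w. w powr s \<partial>distr M borel (W x)) = expectation (\<lambda>\<omega>. W x \<omega> powr s)"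
    by (rule integral_distr) measurable
  then show ?thesis unfolding law by simp
qed

text \<open>Disintegration: given the weights the edges are independent, so the conditional probability
  is a product.\<close>

lemma emeasure_all_closed:
  assumes "0 \<le> lam" and F: "finite F" "F \<subseteq> edges"
  shows "emeasure seeds {z. \<forall>e\<in>F. \<not> open_edge \<alpha> lam z e} = (\<integral>\<^sup>+\<omega>. ennreal (\<Prod>e\<in>F. 1 - edge_prob \<alpha> lam (\<lambda>x. W x \<omega>) e) \<partial>M)"
proof -
  let ?C = "(\<Pi>\<^sub>M e\<in>edges. count_space UNIV) :: ((int ^ 'd) set \<Rightarrow> bool) measure"
  let ?g = "\<lambda>z. restrict (open_edge \<alpha> lam z) edges"
  let ?A = "{\<eta> \<in> space ?C. \<forall>e\<in>F. \<eta> e \<in> {False}}"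
  have A: "?A \<in> sets ?C"
    using F by (intro sets.sets_Collect_finite_All) (auto intro!: measurable_sets_Collect[OF measurable_component_singleton])
  have pre: "?g -` ?A \<inter> space seeds = {z. \<forall>e\<in>F. \<not> open_edge \<alpha> lam z e}"
  proof (intro set_eqI)
    fix z
    have "?g z \<in> space ?C" by (rule measurable_space[OF open_edges_measurable]) simp
    then show "z \<in> ?g -` ?A \<inter> space seeds \<longleftrightarrow> z \<in> {z. \<forall>e\<in>F. \<not> open_edge \<alpha> lam z e}"
      using F(2) by (auto simp: subset_eq)
  qed
  have "emeasure seeds {z. \<forall>e\<in>F. \<not> open_edge \<alpha> lam z e} = emeasure (distr seeds ?C ?g) ?A"
    using emeasure_distr[OF open_edges_measurable A, of \<alpha> lam] unfolding pre by simp
  also have "\<dots> = emeasure (graph_law M W \<alpha> lam) ?A"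
    unfolding graph_law_seed[OF assms(1)] ..
  also have "\<dots> = (\<integral>\<^sup>+\<omega>. emeasure (edge_law \<alpha> lam (\<lambda>x. W x \<omega>)) ?A \<partial>M)"
    unfolding graph_law_def
    by (rule emeasure_bind[OF not_empty measurable_prob_algebraD[OF measurable_edge_law[OF W_measurable]] A])
  also have "\<dots> = (\<integral>\<^sup>+\<omega>. ennreal (\<Prod>e\<in>F. 1 - edge_prob \<alpha> lam (\<lambda>x. W x \<omega>) e) \<partial>M)"
  proof (rule nn_integral_cong)
    fix \<omega> assume \<omega>: "\<omega> \<in> space M"
    let ?B = "\<lambda>e. measure_pmf (bernoulli_pmf (edge_prob \<alpha> lam (\<lambda>x. W x \<omega>) e))"
    interpret B: product_prob_space ?B edges
      by (intro product_prob_spaceI measure_pmf.prob_space_axioms)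
    have "?A = {\<eta> \<in> space (PiM edges ?B). \<forall>e\<in>F. \<eta> e \<in> {False}}"
      by (simp add: space_PiM)
    then have "emeasure (edge_law \<alpha> lam (\<lambda>x. W x \<omega>)) ?A = (\<Prod>e\<in>F. emeasure (?B e) {False})"
      unfolding edge_law_def using B.emeasure_PiM_Collect[OF F(2,1), of "\<lambda>_. {False}"] by simp
    also have "\<dots> = (\<Prod>e\<in>F. ennreal (1 - edge_prob \<alpha> lam (\<lambda>x. W x \<omega>) e))"
    proof (rule prod.cong[OF refl])
      fix e assume "e \<in> F"
      then have "0 \<le> edge_prob \<alpha> lam (\<lambda>x. W x \<omega>) e \<and> edge_prob \<alpha> lam (\<lambda>x. W x \<omega>) e \<le> 1"
        using edge_prob_bounds[OF \<omega> assms(1)] F(2) by blast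
      then show "emeasure (?B e) {False} = ennreal (1 - edge_prob \<alpha> lam (\<lambda>x. W x \<omega>) e)"
        by (simp add: emeasure_pmf_single)
    qed
    also have "\<dots> = ennreal (\<Prod>e\<in>F. 1 - edge_prob \<alpha> lam (\<lambda>x. W x \<omega>) e)"
      using edge_prob_bounds[OF \<omega> assms(1)] F(2) by (intro prod_ennreal) (auto simp: subset_eq)
    finally show "emeasure (edge_law \<alpha> lam (\<lambda>x. W x \<omega>)) ?A = ennreal (\<Prod>e\<in>F. 1 - edge_prob \<alpha> lam (\<lambda>x. W x \<omega>) e)" .
  qed
  finally show ?thesis .
qed

text \<open>The edges from \<open>{..n}\<close> to \<open>{n<..}\<close>, indexed by the distances of their end points from the cut.\<close>

definition crossing_edge :: "int \<Rightarrow> nat \<times> nat \<Rightarrow> (int ^ 'd) set" where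
  "crossing_edge n p = {on_line (n - int (fst p)), on_line (n + 1 + int (snd p))}"

definition crossing_energy :: "real \<Rightarrow> real \<Rightarrow> int \<Rightarrow> nat \<times> nat \<Rightarrow> 'a \<Rightarrow> real" where
  "crossing_energy \<alpha> lam n p \<omega> =
     lam * W (on_line (n - int (fst p))) \<omega> * W (on_line (n + 1 + int (snd p))) \<omega> / (real (fst p) + real (snd p) + 1) powr \<alpha>"

lemma crossing_edge_in_edges [simp]: "crossing_edge n p \<in> edges"
  unfolding crossing_edge_def edges_def by (auto intro!: exI)

lemma inj_crossing_edge: "inj (crossing_edge n)"
  unfolding crossing_edge_def by (auto simp: inj_on_def on_line_pair_eq_iff doubleton_eq_iff)

lemma edge_prob_crossing:
  assumes "CARD('d) = 1"
  shows "edge_prob \<alpha> lam (\<lambda>x. W x \<omega>) (crossing_edge n p) = 1 - exp (- crossing_energy \<alpha> lam n p \<omega>)"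
  unfolding crossing_edge_def edge_prob_doubleton conn_prob_def crossing_energy_def lattice_dist_on_line[OF assms]
  by (simp add: algebra_simps)

lemma crossing_energy_measurable [measurable]: "crossing_energy \<alpha> lam n p \<in> borel_measurable M"
  unfolding crossing_energy_def by measurable

lemma crossing_energy_nonneg: "0 \<le> lam \<Longrightarrow> \<omega> \<in> space M \<Longrightarrow> 0 \<le> crossing_energy \<alpha> lam n p \<omega>"
  unfolding crossing_energy_def using nonneg by auto

lemma prob_all_closed:
  assumes "CARD('d) = 1" "0 \<le> lam" "finite I"
  shows "measure seeds {z. \<forall>p\<in>I. \<not> open_edge \<alpha> lam z (crossing_edge n p)} = expectation (\<lambda>\<omega>. exp (- (\<Sum>p\<in>I. crossing_energy \<alpha> lam n p \<omega>)))"
proof -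
  have eq: "(\<Prod>e\<in>crossing_edge n ` I. 1 - edge_prob \<alpha> lam (\<lambda>x. W x \<omega>) e) = exp (- (\<Sum>p\<in>I. crossing_energy \<alpha> lam n p \<omega>))" for \<omega>
  proof -
    have "(\<Prod>e\<in>crossing_edge n ` I. 1 - edge_prob \<alpha> lam (\<lambda>x. W x \<omega>) e) = (\<Prod>p\<in>I. 1 - edge_prob \<alpha> lam (\<lambda>x. W x \<omega>) (crossing_edge n p))"
      by (simp add: prod.reindex[OF inj_on_subset[OF inj_crossing_edge subset_UNIV]])
    also have "\<dots> = exp (\<Sum>p\<in>I. - crossing_energy \<alpha> lam n p \<omega>)"
      using assms(3) by (simp add: edge_prob_crossing[OF assms(1)] exp_sum)
    finally show ?thesis by (simp add: sum_negf)
  qed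
  have "{z. \<forall>p\<in>I. \<not> open_edge \<alpha> lam z (crossing_edge n p)} = {z. \<forall>e\<in>crossing_edge n ` I. \<not> open_edge \<alpha> lam z e}" by auto
  also have "emeasure seeds \<dots> = (\<integral>\<^sup>+\<omega>. ennreal (exp (- (\<Sum>p\<in>I. crossing_energy \<alpha> lam n p \<omega>))) \<partial>M)"
    by (subst emeasure_all_closed) (use assms eq in auto)
  finally have *: "emeasure seeds {z. \<forall>p\<in>I. \<not> open_edge \<alpha> lam z (crossing_edge n p)} = (\<integral>\<^sup>+\<omega>. ennreal (exp (- (\<Sum>p\<in>I. crossing_energy \<alpha> lam n p \<omega>))) \<partial>M)" .
  have "expectation (\<lambda>\<omega>. exp (- (\<Sum>p\<in>I. crossing_energy \<alpha> lam n p \<omega>))) = enn2real (\<integral>\<^sup>+\<omega>. ennreal (exp (- (\<Sum>p\<in>I. crossing_energy \<alpha> lam n p \<omega>))) \<partial>M)"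
    by (rule integral_eq_nn_integral) auto
  then show ?thesis unfolding measure_def * by simp
qed

definition moment_bound :: "real \<Rightarrow> real \<Rightarrow> real" where
  "moment_bound lam s = lam powr s * (\<integral>w. w powr s \<partial>D)\<^sup>2"

text \<open>A first moment of the product of two weights need not exist. The moment of order \<open>s\<close> does, and it
  factorises by independence.\<close>

lemma energy_moment:
  assumes "0 \<le> lam" "0 < s" and int: "\<And>x. integrable M (\<lambda>\<omega>. W x \<omega> powr s)"
  shows "integrable M (\<lambda>\<omega>. crossing_energy \<alpha> lam n p \<omega> powr s)"
    and "expectation (\<lambda>\<omega>. crossing_energy \<alpha> lam n p \<omega> powr s) = moment_bound lam s * (real (fst p) + real (snd p) + 1) powr (- (\<alpha> * s))"
proof -
  let ?a = "on_line (n - int (fst p)) :: int ^ 'd" and ?b = "on_line (n + 1 + int (snd p)) :: int ^ 'd"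
  let ?r = "real (fst p) + real (snd p) + 1"
  have ne: "?a \<noteq> ?b" unfolding on_line_eq_iff by linarith
  have "indep_vars (\<lambda>_. borel) (\<lambda>x \<omega>. (\<lambda>w. w powr s) (W x \<omega>)) UNIV"
    by (rule indep_vars_compose2[OF indep, where Y = "\<lambda>_ w. w powr s" and N = "\<lambda>_. borel"]) measurable
  then have ind: "indep_vars (\<lambda>_. borel) (\<lambda>x \<omega>. W x \<omega> powr s) {?a, ?b}"
    by (rule indep_vars_subset[OF _ subset_UNIV])
  have prod: "(\<Prod>x\<in>{?a, ?b}. f x) = f ?a * f ?b" for f :: "int ^ 'd \<Rightarrow> real" using ne by simp
  have iab: "integrable M (\<lambda>\<omega>. W ?a \<omega> powr s * W ?b \<omega> powr s)"
    using indep_vars_integrable[OF _ ind int] by (simp only: prod finite.intros)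
  have eab: "expectation (\<lambda>\<omega>. W ?a \<omega> powr s * W ?b \<omega> powr s) = (\<integral>w. w powr s \<partial>D)\<^sup>2"
    using indep_vars_lebesgue_integral[OF _ ind int] by (simp only: prod finite.intros weight_moment_eq power2_eq_square)
  have eq: "crossing_energy \<alpha> lam n p \<omega> powr s = lam powr s * ?r powr (- (\<alpha> * s)) * (W ?a \<omega> powr s * W ?b \<omega> powr s)"
    if "\<omega> \<in> space M" for \<omega>
  proof -
    have "crossing_energy \<alpha> lam n p \<omega> powr s = (lam * W ?a \<omega> * W ?b \<omega>) powr s / (?r powr \<alpha>) powr s"
      unfolding crossing_energy_def by (rule powr_divide)
    also have "(lam * W ?a \<omega> * W ?b \<omega>) powr s = lam powr s * W ?a \<omega> powr s * W ?b \<omega> powr s"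
      using assms(1) nonneg[OF that] by (simp add: powr_mult)
    also have "(?r powr \<alpha>) powr s = ?r powr (\<alpha> * s)" by (rule powr_powr)
    finally show ?thesis unfolding powr_minus_divide by simp
  qed
  have i2: "integrable M (\<lambda>\<omega>. lam powr s * ?r powr (- (\<alpha> * s)) * (W ?a \<omega> powr s * W ?b \<omega> powr s))"
    using iab by (rule integrable_mult_right)
  show "integrable M (\<lambda>\<omega>. crossing_energy \<alpha> lam n p \<omega> powr s)"
  proof -
    have "integrable M (\<lambda>\<omega>. crossing_energy \<alpha> lam n p \<omega> powr s) \<longleftrightarrow>
        integrable M (\<lambda>\<omega>. lam powr s * ?r powr (- (\<alpha> * s)) * (W ?a \<omega> powr s * W ?b \<omega> powr s))"
      by (rule Bochner_Integration.integrable_cong[OF refl]) (rule eq)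
    then show ?thesis using i2 by (simp only:)
  qed
  have "expectation (\<lambda>\<omega>. crossing_energy \<alpha> lam n p \<omega> powr s) = expectation (\<lambda>\<omega>. lam powr s * ?r powr (- (\<alpha> * s)) * (W ?a \<omega> powr s * W ?b \<omega> powr s))"
    by (rule Bochner_Integration.integral_cong[OF refl eq])
  also have "\<dots> = lam powr s * ?r powr (- (\<alpha> * s)) * (\<integral>w. w powr s \<partial>D)\<^sup>2"
    using iab eab by simp
  finally show "expectation (\<lambda>\<omega>. crossing_energy \<alpha> lam n p \<omega> powr s) = moment_bound lam s * ?r powr (- (\<alpha> * s))"
    by (simp add: moment_bound_def)
qed

end

section \<open>Cut points on the line\<close>

lemma on_line_nth:
  assumes "CARD('d::finite) = 1"
  shows "on_line (v $ i) = (v :: int ^ 'd)"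
proof -
  obtain j where "(UNIV :: 'd set) = {j}" using assms card_1_singletonE by metis
  then have "i = k" for k :: 'd by (metis UNIV_I singletonD)
  then have "v $ i = v $ k" for k by (rule arg_cong)
  then show ?thesis by (simp add: on_line_def vec_eq_iff)
qed

lemma sum_powr_bound:
  assumes "1 < (u::real)"
  obtains Z where "\<And>R. (\<Sum>i<R. (real i + 1) powr - u) \<le> Z" "(\<lambda>R. \<Sum>i<R. (real i + 1) powr - u) \<longlonglongrightarrow> Z" "0 \<le> Z"
proof -
  have "summable (\<lambda>n. real (Suc n) powr - u)"
    using assms summable_real_powr_iff[of "- u"] by (subst summable_Suc_iff) simp
  then have s: "summable (\<lambda>i. (real i + 1) powr - u)" by (simp add: add.commute)
  show thesis
  proof (rule that[of "\<Sum>i. (real i + 1) powr - u"])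
    show "(\<Sum>i<R. (real i + 1) powr - u) \<le> (\<Sum>i. (real i + 1) powr - u)" for R
      by (rule sum_le_suminf[OF s]) auto
    show "(\<lambda>R. \<Sum>i<R. (real i + 1) powr - u) \<longlonglongrightarrow> (\<Sum>i. (real i + 1) powr - u)"
      by (rule summable_LIMSEQ[OF s])
    show "0 \<le> (\<Sum>i. (real i + 1) powr - u)" by (rule suminf_nonneg[OF s]) simp
  qed
qed

text \<open>From \<open>(i + 1) (j + 1) \<le> (i + j + 1)\<^sup>2\<close>. The double sum is dominated by the square of a single sum.\<close>

lemma sum_powr_square:
  assumes "0 \<le> (u::real)" "I \<subseteq> {..<R} \<times> {..<R}"
  shows "(\<Sum>p\<in>I. (real (fst p) + real (snd p) + 1) powr - (2 * u))
      \<le> (\<Sum>p\<in>I. (real (fst p) + 1) powr - u * (real (snd p) + 1) powr - u)"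
proof (rule sum_mono)
  fix p :: "nat \<times> nat"
  have "(real (fst p) + 1) * (real (snd p) + 1) \<le> (real (fst p) + real (snd p) + 1)\<^sup>2"
    by (simp add: power2_eq_square algebra_simps)
  then have "((real (fst p) + 1) * (real (snd p) + 1)) powr u \<le> ((real (fst p) + real (snd p) + 1)\<^sup>2) powr u"
    using assms(1) by (intro powr_mono2) auto
  also have "((real (fst p) + real (snd p) + 1)\<^sup>2) powr u = (real (fst p) + real (snd p) + 1) powr (2 * u)"
    by (simp add: powr_powr flip: powr_numeral)
  finally have "1 / (real (fst p) + real (snd p) + 1) powr (2 * u) \<le> 1 / ((real (fst p) + 1) * (real (snd p) + 1)) powr u"
    by (intro divide_left_mono mult_pos_pos) auto
  then show "(real (fst p) + real (snd p) + 1) powr - (2 * u) \<le> (real (fst p) + 1) powr - u * (real (snd p) + 1) powr - u"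
    unfolding powr_minus_divide by (simp add: powr_mult)
qed

context iid_weights
begin

text \<open>The coordinates that determine the graph induced on \<open>on_line ` B\<close>.\<close>

definition window_coords :: "int set \<Rightarrow> (int ^ 'd) site_or_edge set" where
  "window_coords B = (\<lambda>k. Inl (on_line k)) ` B \<union> line_coords B"

lemma window_coords_disjoint: "A \<inter> B = {} \<Longrightarrow> window_coords A \<inter> window_coords B = {}"
  using line_coords_disjoint[of A B] unfolding window_coords_def by (auto simp: line_coords_def)

lemma open_edge_window_cong:
  assumes "\<And>i. i \<in> window_coords B \<Longrightarrow> z i = z' i" "j \<in> B" "k \<in> B"
  shows "open_edge \<alpha> lam z {on_line j, on_line k} = open_edge \<alpha> lam z' {on_line j, on_line k}"
proof -
  have "z (Inl (on_line j)) = z' (Inl (on_line j))" "z (Inl (on_line k)) = z' (Inl (on_line k))"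
    "z (Inr {on_line j, on_line k}) = z' (Inr {on_line j, on_line k})"
    using assms(2,3) by (intro assms(1); auto simp: window_coords_def line_coords_def)+
  then show ?thesis unfolding open_edge_def edge_prob_doubleton conn_prob_def by simp
qed

definition local_cut :: "real \<Rightarrow> real \<Rightarrow> nat \<Rightarrow> int \<Rightarrow> ((int ^ 'd) site_or_edge \<Rightarrow> real) set" where
  "local_cut \<alpha> lam R n = {z. \<forall>p\<in>{..<R} \<times> {..<R}. \<not> open_edge \<alpha> lam z (crossing_edge n p)}"

definition cut_point :: "real \<Rightarrow> real \<Rightarrow> int \<Rightarrow> ((int ^ 'd) site_or_edge \<Rightarrow> real) set" where
  "cut_point \<alpha> lam n = {z. \<forall>p. \<not> open_edge \<alpha> lam z (crossing_edge n p)}"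

definition long_crossing :: "real \<Rightarrow> real \<Rightarrow> nat \<Rightarrow> nat \<Rightarrow> int \<Rightarrow> ((int ^ 'd) site_or_edge \<Rightarrow> real) set" where
  "long_crossing \<alpha> lam R R' n = (\<Union>p\<in>{..<R'} \<times> {..<R'} - {..<R} \<times> {..<R}. {z. open_edge \<alpha> lam z (crossing_edge n p)})"

lemma crossing_event: "{z. open_edge \<alpha> lam z (crossing_edge n p)} \<in> sets seeds"
  using open_edge_event[OF crossing_edge_in_edges] by simp

lemma local_cut_event: "local_cut \<alpha> lam R n \<in> sets seeds"
proof -
  have "local_cut \<alpha> lam R n = space seeds - (\<Union>p\<in>{..<R} \<times> {..<R}. {z. open_edge \<alpha> lam z (crossing_edge n p)})"
    unfolding local_cut_def by auto
  also have "\<dots> \<in> sets seeds" by (intro sets.Diff sets.top sets.finite_UN crossing_event) auto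
  finally show ?thesis .
qed

lemma long_crossing_event: "long_crossing \<alpha> lam R R' n \<in> sets seeds"
  unfolding long_crossing_def by (intro sets.finite_UN crossing_event) auto

lemma cut_point_event: "cut_point \<alpha> lam n \<in> sets seeds"
proof -
  have "cut_point \<alpha> lam n = space seeds - (\<Union>p. {z. open_edge \<alpha> lam z (crossing_edge n p)})"
    unfolding cut_point_def by auto
  also have "\<dots> \<in> sets seeds" by (intro sets.Diff sets.top sets.countable_UN'' crossing_event) auto
  finally show ?thesis .
qed

lemma no_cut_subset: "- cut_point \<alpha> lam n \<subseteq> - local_cut \<alpha> lam R n \<union> (\<Union>R'. long_crossing \<alpha> lam R R' n)"
proof
  fix z assume "z \<in> - cut_point \<alpha> lam n"
  then obtain p where p: "open_edge \<alpha> lam z (crossing_edge n p)" unfolding cut_point_def by auto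
  show "z \<in> - local_cut \<alpha> lam R n \<union> (\<Union>R'. long_crossing \<alpha> lam R R' n)"
  proof (cases "p \<in> {..<R} \<times> {..<R}")
    case True
    then show ?thesis using p unfolding local_cut_def by blast
  next
    case False
    have "p \<in> {..<Suc (fst p + snd p)} \<times> {..<Suc (fst p + snd p)}" by (auto simp: mem_Times_iff)
    then have "z \<in> long_crossing \<alpha> lam R (Suc (fst p + snd p)) n"
      using p False unfolding long_crossing_def by blast
    then show ?thesis by blast
  qed
qed

text \<open>Uses \<open>1 - exp (- t) \<le> t powr s\<close> inside the expectation over the weights.\<close>

lemma crossing_prob:
  assumes "CARD('d) = 1" "0 \<le> lam" "0 < s" "s \<le> 1" and int: "\<And>x. integrable M (\<lambda>\<omega>. W x \<omega> powr s)"
  shows "measure seeds {z. open_edge \<alpha> lam z (crossing_edge n p)} \<le> moment_bound lam s * (real (fst p) + real (snd p) + 1) powr - (\<alpha> * s)"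
proof -
  let ?e = "crossing_energy \<alpha> lam n p"
  have "measure seeds (space seeds - {z. open_edge \<alpha> lam z (crossing_edge n p)}) = measure seeds {z. \<forall>q\<in>{p}. \<not> open_edge \<alpha> lam z (crossing_edge n q)}"
    by (rule arg_cong[where f = "measure seeds"]) auto
  also have "\<dots> = expectation (\<lambda>\<omega>. exp (- ?e \<omega>))"
    using prob_all_closed[OF assms(1,2), of "{p}" \<alpha> n] by simp
  finally have "measure seeds {z. open_edge \<alpha> lam z (crossing_edge n p)} = 1 - expectation (\<lambda>\<omega>. exp (- ?e \<omega>))"
    using seed.P.prob_compl[OF crossing_event] by simp
  also have "\<dots> = expectation (\<lambda>\<omega>. 1 - exp (- ?e \<omega>))"
  proof -
    have "integrable M (\<lambda>\<omega>. exp (- ?e \<omega>))"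
      by (rule integrable_const_bound[where B = 1]) (auto simp: crossing_energy_nonneg[OF assms(2)])
    then show ?thesis by (simp add: prob_space)
  qed
  also have "\<dots> \<le> expectation (\<lambda>\<omega>. ?e \<omega> powr s)"
  proof (rule integral_mono)
    show "integrable M (\<lambda>\<omega>. 1 - exp (- ?e \<omega>))"
      by (rule integrable_const_bound[where B = 1]) (auto simp: crossing_energy_nonneg[OF assms(2)])
    show "integrable M (\<lambda>\<omega>. ?e \<omega> powr s)" by (rule energy_moment(1)[OF assms(2,3) int])
    show "1 - exp (- ?e \<omega>) \<le> ?e \<omega> powr s" if "\<omega> \<in> space M" for \<omega>
      by (rule one_minus_exp_le_powr[OF crossing_energy_nonneg[OF assms(2) that] assms(3,4)])
  qed
  also have "\<dots> = moment_bound lam s * (real (fst p) + real (snd p) + 1) powr - (\<alpha> * s)"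
    by (rule energy_moment(2)[OF assms(2,3) int])
  finally show ?thesis .
qed

lemma moment_bound_nonneg: "0 \<le> moment_bound lam s"
  by (simp add: moment_bound_def)

text \<open>Given the weights, no edge crosses with probability \<open>exp (- E)\<close>, where \<open>E\<close> is the sum of the energies.
  By Markov's inequality the sum of the powers \<open>s\<close> of the energies is at most \<open>2 K\<close> with probability at least
  one half, and then \<open>E\<close> is at most \<open>(2 * K) powr (1 / s)\<close>. The bound does not depend on \<open>R\<close>.\<close>

lemma local_cut_prob:
  assumes "CARD('d) = 1" "0 \<le> lam" "0 < s" "s \<le> 1" and int: "\<And>x. integrable M (\<lambda>\<omega>. W x \<omega> powr s)"
    and K: "(\<Sum>p\<in>{..<R} \<times> {..<R}. moment_bound lam s * (real (fst p) + real (snd p) + 1) powr - (\<alpha> * s)) \<le> K" "0 < K"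
  shows "exp (- ((2 * K) powr (1 / s))) / 2 \<le> measure seeds (local_cut \<alpha> lam R n)"
proof -
  let ?I = "{..<R} \<times> {..<R}"
  let ?T = "\<lambda>\<omega>. \<Sum>p\<in>?I. crossing_energy \<alpha> lam n p \<omega> powr s"
  let ?X = "{\<omega> \<in> space M. ?T \<omega> \<le> 2 * K}"
  have iT: "integrable M ?T"
    by (intro Bochner_Integration.integrable_sum energy_moment(1)[OF assms(2,3) int])
  have ET: "expectation ?T \<le> K"
    using K(1) by (simp add: Bochner_Integration.integral_sum[OF energy_moment(1)[OF assms(2,3) int]] energy_moment(2)[OF assms(2,3) int])
  have "prob {\<omega> \<in> space M. 2 * K \<le> ?T \<omega>} \<le> expectation ?T / (2 * K)"
    using K(2) iT by (intro integral_Markov_inequality_measure[where A = "space M"]) (auto intro!: sum_nonneg)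
  also have "\<dots> \<le> K / (2 * K)" using ET K(2) by (intro divide_right_mono) auto
  also have "\<dots> = 1 / 2" using K(2) by simp
  finally have mk: "prob {\<omega> \<in> space M. 2 * K \<le> ?T \<omega>} \<le> 1 / 2" .
  have X: "?X \<in> events" by measurable
  have "1 - prob ?X = prob (space M - ?X)" using prob_compl[OF X] by simp
  also have "\<dots> \<le> prob {\<omega> \<in> space M. 2 * K \<le> ?T \<omega>}"
    by (intro finite_measure_mono) auto
  finally have half: "1 / 2 \<le> prob ?X" using mk by linarith
  have "exp (- ((2 * K) powr (1 / s))) / 2 \<le> exp (- ((2 * K) powr (1 / s))) * prob ?X"
    using mult_left_mono[OF half, of "exp (- ((2 * K) powr (1 / s)))"] by simp
  also have "\<dots> = expectation (\<lambda>\<omega>. exp (- ((2 * K) powr (1 / s))) * indicator ?X \<omega>)"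
    using X by simp
  also have "\<dots> \<le> expectation (\<lambda>\<omega>. exp (- (\<Sum>p\<in>?I. crossing_energy \<alpha> lam n p \<omega>)))"
  proof (rule integral_mono)
    show "integrable M (\<lambda>\<omega>. exp (- ((2 * K) powr (1 / s))) * indicator ?X \<omega>)"
      using X by (intro integrable_mult_right integrable_real_indicator) (auto simp: emeasure_eq_measure)
    show "integrable M (\<lambda>\<omega>. exp (- (\<Sum>p\<in>?I. crossing_energy \<alpha> lam n p \<omega>)))"
      by (rule integrable_const_bound[where B = 1]) (auto intro!: sum_nonneg crossing_energy_nonneg[OF assms(2)])
    fix \<omega> assume \<omega>: "\<omega> \<in> space M"
    show "exp (- ((2 * K) powr (1 / s))) * indicator ?X \<omega> \<le> exp (- (\<Sum>p\<in>?I. crossing_energy \<alpha> lam n p \<omega>))"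
    proof (cases "\<omega> \<in> ?X")
      case True
      then have "(\<Sum>p\<in>?I. crossing_energy \<alpha> lam n p \<omega>) \<le> (2 * K) powr (1 / s)"
        using \<omega> by (intro sum_le_of_powr_sum[OF _ crossing_energy_nonneg[OF assms(2)] assms(3,4)]) auto
      then show ?thesis using True by simp
    qed simp
  qed
  also have "\<dots> = measure seeds (local_cut \<alpha> lam R n)"
    unfolding local_cut_def by (rule prob_all_closed[OF assms(1,2), symmetric]) simp
  finally show ?thesis .
qed

lemma local_cut_window:
  assumes "\<And>i. i \<in> window_coords {n - int R <.. n + int R} \<Longrightarrow> z i = z' i"
  shows "z \<in> local_cut \<alpha> lam R n \<longleftrightarrow> z' \<in> local_cut \<alpha> lam R n"
proof -
  have "open_edge \<alpha> lam z (crossing_edge n p) = open_edge \<alpha> lam z' (crossing_edge n p)" if "p \<in> {..<R} \<times> {..<R}" for p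
    unfolding crossing_edge_def by (rule open_edge_window_cong[OF assms]) (use that in auto)
  then show ?thesis unfolding local_cut_def by simp
qed

text \<open>The windows of radius \<open>R\<close> around the points \<open>pos l\<close> are disjoint, so the local cuts are independent.\<close>

lemma no_local_cuts_prob:
  assumes sep: "\<And>l m. l < m \<Longrightarrow> 2 * int R \<le> \<bar>pos l - pos m\<bar>"
    and \<delta>: "\<And>n. \<delta> \<le> measure seeds (local_cut \<alpha> lam R n)" "0 \<le> \<delta>"
  shows "measure seeds (\<Inter>l<k. - local_cut \<alpha> lam R (pos l)) \<le> (1 - \<delta>) ^ k"
    and "(\<Inter>l<k. - local_cut \<alpha> lam R (pos l)) \<in> sets seeds"
proof -
  have ev: "- local_cut \<alpha> lam R n \<in> sets seeds" for n
  proof -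
    have "space seeds - local_cut \<alpha> lam R n \<in> sets seeds" by (intro sets.Diff sets.top local_cut_event)
    then show ?thesis by (simp add: Compl_eq_Diff_UNIV)
  qed
  have single: "measure seeds (- local_cut \<alpha> lam R n) \<le> 1 - \<delta>" for n
    using seed.P.prob_compl[OF local_cut_event, of \<alpha> lam R n] \<delta>(1)[of n] by (simp add: Compl_eq_Diff_UNIV)
  have le1: "0 \<le> 1 - \<delta>" using \<delta>(1)[of 0] seed.P.prob_le_1[of "local_cut \<alpha> lam R 0"] by linarith
  let ?w = "\<lambda>l. {pos l - int R <.. pos l + int R}"
  have "(\<Inter>l<k. - local_cut \<alpha> lam R (pos l)) \<in> sets seeds \<and> measure seeds (\<Inter>l<k. - local_cut \<alpha> lam R (pos l)) \<le> (1 - \<delta>) ^ k"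
  proof (induction k)
    case 0
    have "(UNIV :: ((int ^ 'd) site_or_edge \<Rightarrow> real) set) = space seeds" by simp
    then show ?case using sets.top[of seeds] seed.P.prob_space by simp
  next
    case (Suc k)
    let ?A = "\<Inter>l<k. - local_cut \<alpha> lam R (pos l)" and ?B = "- local_cut \<alpha> lam R (pos k)"
    have eq: "(\<Inter>l<Suc k. - local_cut \<alpha> lam R (pos l)) = ?A \<inter> ?B"
      by (simp add: lessThan_Suc Int_commute)
    have disj: "window_coords (\<Union>l<k. ?w l) \<inter> window_coords (?w k) = {}"
    proof (rule window_coords_disjoint)
      have "?w l \<inter> ?w k = {}" if "l < k" for l using sep[OF that] by auto
      then show "(\<Union>l<k. ?w l) \<inter> ?w k = {}" by blast
    qed
    have "measure seeds (?A \<inter> ?B) = measure seeds ?A * measure seeds ?B"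
    proof (rule seeds_indep[OF conjunct1[OF Suc.IH] ev disj])
      fix z z' assume z: "z \<in> ?A" and same: "\<And>i. i \<in> window_coords (\<Union>l<k. ?w l) \<Longrightarrow> z i = z' i"
      have "z' \<notin> local_cut \<alpha> lam R (pos l)" if l: "l < k" for l
      proof -
        have "window_coords (?w l) \<subseteq> window_coords (\<Union>l<k. ?w l)"
          using l unfolding window_coords_def line_coords_def by blast
        then have "z \<in> local_cut \<alpha> lam R (pos l) \<longleftrightarrow> z' \<in> local_cut \<alpha> lam R (pos l)"
          by (intro local_cut_window same) blast
        then show ?thesis using z l by blast
      qed
      then show "z' \<in> ?A" by blast
    next
      fix z z' assume "z \<in> ?B" "\<And>i. i \<in> window_coords (?w k) \<Longrightarrow> z i = z' i"
      then show "z' \<in> ?B" using local_cut_window[of "pos k" R z z' \<alpha> lam] by blast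
    qed
    also have "\<dots> \<le> (1 - \<delta>) ^ k * (1 - \<delta>)"
      using Suc.IH single le1 by (intro mult_mono) auto
    finally have "measure seeds (?A \<inter> ?B) \<le> (1 - \<delta>) ^ Suc k" by (simp add: mult.commute)
    moreover have "?A \<inter> ?B \<in> sets seeds" using Suc.IH ev by blast
    ultimately show ?case unfolding eq by blast
  qed
  then show "measure seeds (\<Inter>l<k. - local_cut \<alpha> lam R (pos l)) \<le> (1 - \<delta>) ^ k"
    and "(\<Inter>l<k. - local_cut \<alpha> lam R (pos l)) \<in> sets seeds" by auto
qed

lemma no_cut_points_prob:
  assumes sep: "\<And>l m. l < m \<Longrightarrow> 2 * int R \<le> \<bar>pos l - pos m\<bar>"
    and \<delta>: "\<And>n. \<delta> \<le> measure seeds (local_cut \<alpha> lam R n)" "0 \<le> \<delta>"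
    and \<eta>: "\<And>n R'. measure seeds (long_crossing \<alpha> lam R R' n) \<le> \<eta>"
  shows "measure seeds (\<Inter>l<k. - cut_point \<alpha> lam (pos l)) \<le> (1 - \<delta>) ^ k + real k * \<eta>"
proof -
  let ?L = "\<lambda>n. \<Union>R'. long_crossing \<alpha> lam R R' n"
  have L: "?L n \<in> sets seeds" for n using long_crossing_event by (intro sets.countable_UN) auto
  have mL: "measure seeds (?L n) \<le> \<eta>" for n
  proof -
    have "incseq (\<lambda>R'. long_crossing \<alpha> lam R R' n)"
    proof (rule incseq_SucI)
      fix R'
      have "{..<R'} \<times> {..<R'} - {..<R} \<times> {..<R} \<subseteq> {..<Suc R'} \<times> {..<Suc R'} - {..<R} \<times> {..<R}" by auto
      then show "long_crossing \<alpha> lam R R' n \<subseteq> long_crossing \<alpha> lam R (Suc R') n"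
        unfolding long_crossing_def by (rule UN_mono) blast
    qed
    then have "(\<lambda>R'. measure seeds (long_crossing \<alpha> lam R R' n)) \<longlonglongrightarrow> measure seeds (?L n)"
      by (intro seed.P.finite_Lim_measure_incseq) (use long_crossing_event in blast)
    then show ?thesis by (rule LIMSEQ_le_const2) (intro exI allI impI \<eta>)
  qed
  have no_local: "measure seeds (\<Inter>l<k. - local_cut \<alpha> lam R (pos l)) \<le> (1 - \<delta>) ^ k"
    "(\<Inter>l<k. - local_cut \<alpha> lam R (pos l)) \<in> sets seeds"
    by (rule no_local_cuts_prob[where pos = pos and R = R and \<delta> = \<delta> and \<alpha> = \<alpha> and lam = lam]; (erule sep | rule \<delta>))+
  have "measure seeds (\<Inter>l<k. - cut_point \<alpha> lam (pos l)) \<le> measure seeds ((\<Inter>l<k. - local_cut \<alpha> lam R (pos l)) \<union> (\<Union>l<k. ?L (pos l)))"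
  proof (rule seed.P.finite_measure_mono)
    show "(\<Inter>l<k. - cut_point \<alpha> lam (pos l)) \<subseteq> (\<Inter>l<k. - local_cut \<alpha> lam R (pos l)) \<union> (\<Union>l<k. ?L (pos l))"
    proof
      fix z assume z: "z \<in> (\<Inter>l<k. - cut_point \<alpha> lam (pos l))"
      have "z \<in> - local_cut \<alpha> lam R (pos l) \<or> z \<in> ?L (pos l)" if "l < k" for l
      proof -
        have "z \<in> - cut_point \<alpha> lam (pos l)" using z that by simp
        from subsetD[OF no_cut_subset this, of R] show ?thesis by (simp only: Un_iff)
      qed
      then show "z \<in> (\<Inter>l<k. - local_cut \<alpha> lam R (pos l)) \<union> (\<Union>l<k. ?L (pos l))" by blast
    qed
    show "(\<Inter>l<k. - local_cut \<alpha> lam R (pos l)) \<union> (\<Union>l<k. ?L (pos l)) \<in> sets seeds"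
      by (intro sets.Un sets.finite_UN no_local(2) L) simp
  qed
  also have "\<dots> \<le> measure seeds (\<Inter>l<k. - local_cut \<alpha> lam R (pos l)) + measure seeds (\<Union>l<k. ?L (pos l))"
    by (intro measure_Un_le sets.finite_UN no_local(2) L) simp
  also have "measure seeds (\<Union>l<k. ?L (pos l)) \<le> (\<Sum>l<k. measure seeds (?L (pos l)))"
    by (intro seed.P.finite_measure_subadditive_finite) (use L in blast)+
  also have "\<dots> \<le> real k * \<eta>" using sum_mono[of "{..<k}" "\<lambda>l. measure seeds (?L (pos l))" "\<lambda>_. \<eta>"] mL by simp
  also have "measure seeds (\<Inter>l<k. - local_cut \<alpha> lam R (pos l)) \<le> (1 - \<delta>) ^ k"
    by (rule no_local(1))
  finally show ?thesis by simp
qed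

text \<open>No edge leaves the vertices between the two cuts.\<close>

lemma cluster_between_cuts:
  assumes card: "CARD('d) = 1" and z: "z \<in> cut_point \<alpha> lam n" "z \<in> cut_point \<alpha> lam m" and "m < 0" "0 \<le> n"
  shows "finite (cluster (open_edge \<alpha> lam z) (0 :: int ^ 'd))"
proof -
  have no: "\<not> open_edge \<alpha> lam z {on_line a, on_line b}" if "a \<le> c" "c < b" "z \<in> cut_point \<alpha> lam c" for a b c
  proof -
    have "{on_line a, on_line b} = crossing_edge c (nat (c - a), nat (b - c - 1))"
      using that(1,2) unfolding crossing_edge_def by simp
    then show ?thesis using that(3) unfolding cut_point_def by simp
  qed
  have "v \<in> on_line ` {m<..n}" if "v \<in> cluster (open_edge \<alpha> lam z) 0" for v :: "int ^ 'd"
    using that unfolding cluster_def mem_Collect_eq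
  proof (induction rule: rtranclp_induct)
    case base
    have "(0 :: int ^ 'd) = on_line 0" by (simp add: on_line_def vec_eq_iff)
    then show ?case using assms(4,5) by auto
  next
    case (step y x)
    then obtain a where a: "y = on_line a" "m < a" "a \<le> n" by auto
    obtain b where b: "x = on_line b" using on_line_nth[OF card, of x] by metis
    have o: "open_edge \<alpha> lam z {on_line a, on_line b}" "open_edge \<alpha> lam z {on_line b, on_line a}"
      using step.hyps(2) a b by (auto simp: insert_commute)
    have "b \<le> n" using no[of a n b] a z(1) o by force
    moreover have "m < b" using no[of b m a] a z(2) o by force
    ultimately show ?case using b by auto
  qed
  then have "cluster (open_edge \<alpha> lam z) 0 \<subseteq> on_line ` {m<..n}" by blast
  then show ?thesis by (rule finite_subset) simp
qed

text \<open>An infinite cluster at the origin excludes cuts on one of the two sides. Among \<open>k\<close> candidates at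
  mutual distance \<open>2 R\<close> there is no cut with probability at most \<open>(1 - \<delta>) ^ k + k \<eta>\<^sub>R\<close>, where \<open>\<eta>\<^sub>R\<close> bounds the
  probability of a crossing edge that leaves the window. Let \<open>R\<close> tend to infinity first, and then \<open>k\<close>.\<close>

lemma no_percolation_line:
  assumes card: "CARD('d) = 1" and lam: "0 \<le> lam" and s: "0 < s" "s \<le> 1" "2 < \<alpha> * s"
    and int: "\<And>x. integrable M (\<lambda>\<omega>. W x \<omega> powr s)"
  shows "percolation_prob M W \<alpha> lam = 0"
proof -
  (* Half of the exponent, because the double sum over the edges is bounded by a square. *)
  define u where "u = \<alpha> * s / 2"
  have u: "1 < u" using s(3) by (simp add: u_def)
  obtain Z where Z: "\<And>R. (\<Sum>i<R. (real i + 1) powr - u) \<le> Z" "(\<lambda>R. \<Sum>i<R. (real i + 1) powr - u) \<longlonglongrightarrow> Z" "0 \<le> Z"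
    using sum_powr_bound[OF u] by blast
  let ?a = "\<lambda>R. \<Sum>i<R. (real i + 1) powr - u"
  let ?m = "moment_bound lam s"
  let ?f = "\<lambda>p::nat \<times> nat. ?m * (real (fst p) + real (snd p) + 1) powr - (\<alpha> * s)"
  let ?g = "\<lambda>p::nat \<times> nat. (real (fst p) + 1) powr - u * (real (snd p) + 1) powr - u"
  have a0: "0 \<le> ?a R" for R by (rule sum_nonneg) simp
  have sq: "(\<Sum>p\<in>{..<R} \<times> {..<R}. ?g p) = (?a R)\<^sup>2" for R
    unfolding power2_eq_square sum_product sum.cartesian_product by (simp add: case_prod_unfold)
  have fg: "(\<Sum>p\<in>I. ?f p) \<le> ?m * (\<Sum>p\<in>I. ?g p)" if "I \<subseteq> {..<R} \<times> {..<R}" for I R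
  proof -
    have "(\<Sum>p\<in>I. ?f p) = ?m * (\<Sum>p\<in>I. (real (fst p) + real (snd p) + 1) powr - (2 * u))"
      by (simp add: sum_distrib_left u_def)
    also have "\<dots> \<le> ?m * (\<Sum>p\<in>I. ?g p)"
      by (intro mult_left_mono sum_powr_square[OF _ that] moment_bound_nonneg) (use u in auto)
    finally show ?thesis .
  qed
  define K where "K = ?m * Z\<^sup>2 + 1"
  have K: "0 < K" unfolding K_def using moment_bound_nonneg[of lam s] by (intro add_nonneg_pos mult_nonneg_nonneg) auto
  have KR: "(\<Sum>p\<in>{..<R} \<times> {..<R}. ?f p) \<le> K" for R
  proof -
    have "(\<Sum>p\<in>{..<R} \<times> {..<R}. ?f p) \<le> ?m * (?a R)\<^sup>2" using fg[of "{..<R} \<times> {..<R}" R] sq by simp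
    also have "\<dots> \<le> ?m * Z\<^sup>2" by (intro mult_left_mono power_mono Z a0 moment_bound_nonneg)
    finally show ?thesis by (simp add: K_def)
  qed
  define \<delta> where "\<delta> = exp (- ((2 * K) powr (1 / s))) / 2"
  have \<delta>: "0 < \<delta>" "\<And>R n. \<delta> \<le> measure seeds (local_cut \<alpha> lam R n)"
    using local_cut_prob[OF card lam s(1,2) int KR K] by (auto simp: \<delta>_def)
  have \<delta>1: "\<delta> \<le> 1" using \<delta>(2)[of 0 0] seed.P.prob_le_1 order_trans by blast
  have \<eta>: "measure seeds (long_crossing \<alpha> lam R R' n) \<le> ?m * (Z\<^sup>2 - (?a R)\<^sup>2)" for R R' n
  proof (cases "R \<le> R'")
    case True
    let ?I = "{..<R'} \<times> {..<R'} - {..<R} \<times> {..<R}"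
    have "measure seeds (long_crossing \<alpha> lam R R' n) \<le> (\<Sum>p\<in>?I. measure seeds {z. open_edge \<alpha> lam z (crossing_edge n p)})"
      unfolding long_crossing_def by (intro seed.P.finite_measure_subadditive_finite) (auto simp: crossing_event)
    also have "\<dots> \<le> (\<Sum>p\<in>?I. ?f p)" by (intro sum_mono crossing_prob[OF card lam s(1,2) int])
    also have "\<dots> \<le> ?m * (\<Sum>p\<in>?I. ?g p)" by (rule fg) auto
    also have "(\<Sum>p\<in>?I. ?g p) = (?a R')\<^sup>2 - (?a R)\<^sup>2"
      using True by (subst sum_diff) (auto simp: sq)
    also have "?m * ((?a R')\<^sup>2 - (?a R)\<^sup>2) \<le> ?m * (Z\<^sup>2 - (?a R)\<^sup>2)"
      by (intro mult_left_mono diff_right_mono power_mono Z a0 moment_bound_nonneg)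
    finally show ?thesis .
  next
    case False
    then have "long_crossing \<alpha> lam R R' n = {}" unfolding long_crossing_def by auto
    moreover have "0 \<le> ?m * (Z\<^sup>2 - (?a R)\<^sup>2)"
      using power_mono[OF Z(1)[of R] a0, of 2] by (intro mult_nonneg_nonneg moment_bound_nonneg) simp
    ultimately show ?thesis by simp
  qed
  have "(\<lambda>R. ?m * (Z\<^sup>2 - (?a R)\<^sup>2)) \<longlonglongrightarrow> ?m * (Z\<^sup>2 - Z\<^sup>2)" by (intro tendsto_intros Z(2))
  then have \<eta>lim: "(\<lambda>R. ?m * (Z\<^sup>2 - (?a R)\<^sup>2)) \<longlonglongrightarrow> 0" by simp
  let ?inf = "{z. infinite (cluster (open_edge \<alpha> lam z) (0 :: int ^ 'd))}"
  have bound: "measure seeds ?inf \<le> 2 * (1 - \<delta>) ^ k + 2 * real k * (?m * (Z\<^sup>2 - (?a R)\<^sup>2))" for k R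
  proof -
    (* Candidates for cuts to the right and to the left of the origin. *)
    let ?p = "\<lambda>l. 2 * int R * int l" and ?q = "\<lambda>l. - 1 - 2 * int R * int l"
    have sep: "2 * int R \<le> \<bar>2 * int R * int l - 2 * int R * int m\<bar>" if "l < m" for l m :: nat
    proof -
      have "2 * int R * 1 \<le> 2 * int R * (int m - int l)" using that by (intro mult_left_mono) auto
      then show ?thesis by (simp add: algebra_simps)
    qed
    let ?P = "\<Inter>l<k. - cut_point \<alpha> lam (?p l)" and ?N = "\<Inter>l<k. - cut_point \<alpha> lam (?q l)"
    have ev: "(\<Inter>l<k. - cut_point \<alpha> lam (pos l)) \<in> sets seeds" for pos
    proof -
      have "(\<Inter>l<k. - cut_point \<alpha> lam (pos l)) = space seeds - (\<Union>l<k. cut_point \<alpha> lam (pos l))" by auto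
      also have "\<dots> \<in> sets seeds" by (intro sets.Diff sets.top sets.finite_UN cut_point_event) auto
      finally show ?thesis .
    qed
    have "?inf \<subseteq> ?P \<union> ?N"
    proof
      fix z assume z: "z \<in> ?inf"
      show "z \<in> ?P \<union> ?N"
      proof (rule ccontr)
        assume "z \<notin> ?P \<union> ?N"
        then obtain l m where "z \<in> cut_point \<alpha> lam (?p l)" "z \<in> cut_point \<alpha> lam (?q m)" by auto
        moreover have "?q m < 0" "0 \<le> ?p l"
        proof -
          have "0 \<le> 2 * int R * int j" for j by simp
          from this[of l] this[of m] show "?q m < 0" "0 \<le> ?p l" by linarith+
        qed
        ultimately show False using cluster_between_cuts[OF card] z by blast
      qed
    qed
    then have "measure seeds ?inf \<le> measure seeds (?P \<union> ?N)"
      using ev by (intro seed.P.finite_measure_mono sets.Un)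
    also have "\<dots> \<le> measure seeds ?P + measure seeds ?N"
      using ev by (intro measure_Un_le)
    also have "measure seeds ?P \<le> (1 - \<delta>) ^ k + real k * (?m * (Z\<^sup>2 - (?a R)\<^sup>2))"
      by (rule no_cut_points_prob[OF sep \<delta>(2) _ \<eta>]) (use \<delta>(1) in auto)
    also have "measure seeds ?N \<le> (1 - \<delta>) ^ k + real k * (?m * (Z\<^sup>2 - (?a R)\<^sup>2))"
    proof (rule no_cut_points_prob[OF _ \<delta>(2) _ \<eta>])
      show "2 * int R \<le> \<bar>?q l - ?q m\<bar>" if "l < m" for l m using sep[OF that] by linarith
    qed (use \<delta>(1) in auto)
    finally show ?thesis by simp
  qed
  have "measure seeds ?inf \<le> 2 * (1 - \<delta>) ^ k" for k
  proof (rule LIMSEQ_le_const)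
    have "(\<lambda>R. 2 * (1 - \<delta>) ^ k + 2 * real k * (?m * (Z\<^sup>2 - (?a R)\<^sup>2))) \<longlonglongrightarrow> 2 * (1 - \<delta>) ^ k + 2 * real k * 0"
      by (intro tendsto_add tendsto_const tendsto_mult_left \<eta>lim)
    then show "(\<lambda>R. 2 * (1 - \<delta>) ^ k + 2 * real k * (?m * (Z\<^sup>2 - (?a R)\<^sup>2))) \<longlonglongrightarrow> 2 * (1 - \<delta>) ^ k" by simp
  qed (use bound in blast)
  moreover have "(\<lambda>k. 2 * (1 - \<delta>) ^ k) \<longlonglongrightarrow> 2 * 0"
    using \<delta>(1) \<delta>1 by (intro tendsto_mult_left LIMSEQ_realpow_zero) auto
  ultimately have "measure seeds ?inf \<le> 2 * 0"
    by (intro LIMSEQ_le_const) blast+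
  then show ?thesis
    unfolding percolation_prob_seed(1)[OF lam] using measure_nonneg[of seeds ?inf] by simp
qed

end

section \<open>The critical value\<close>

lemma iid_weights_distr:
  assumes "prob_space M" "prob_space.indep_vars M (\<lambda>_. borel) W UNIV"
    and "\<And>x. cdf (distr M borel (W x)) = F"
    and "\<And>x \<omega>. \<omega> \<in> space M \<Longrightarrow> W x \<omega> \<ge> 0"
  shows "iid_weights M W (distr M borel (W 0))"
proof -
  interpret prob_space M by fact
  have rv: "W x \<in> borel_measurable M" for x
    using assms(2) unfolding indep_vars_def by blast
  show ?thesis
  proof (intro iid_weights.intro iid_weights_axioms.intro assms(1,2,4))
    fix x
    show "distr M borel (W x) = distr M borel (W 0)"
      by (rule cdf_unique[OF real_distribution_distr[OF rv] real_distribution_distr[OF rv]]) (simp add: assms(3))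
  qed
qed

context iid_weights
begin

lemma measure_D:
  assumes "X \<in> sets borel"
  shows "measure D X = prob {\<omega> \<in> space M. W 0 \<omega> \<in> X}"
proof -
  have "measure (distr M borel (W 0)) X = prob (W 0 -` X \<inter> space M)"
    by (rule measure_distr[OF W_measurable assms])
  also have "W 0 -` X \<inter> space M = {\<omega> \<in> space M. W 0 \<omega> \<in> X}" by auto
  finally show ?thesis unfolding law .
qed

lemma upper_tail_eq: "measure D {w<..} = 1 - cdf D w"
proof -
  interpret D: prob_space D by (rule prob_space_D)
  have "measure D (space D - {..w}) = 1 - measure D {..w}" by (rule D.prob_compl) simp
  moreover have "space D - {..w} = {w<..}" by auto
  ultimately show ?thesis by (simp add: cdf_def)
qed

text \<open>Otherwise the weight would vanish almost surely, by continuity from above.\<close>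

lemma positive_weight_threshold:
  assumes "prob {\<omega> \<in> space M. W 0 \<omega> = 0} < 1"
  shows "\<exists>w>0. measure D {..<w} < 1"
proof (rule ccontr)
  interpret D: prob_space D by (rule prob_space_D)
  assume "\<not> ?thesis"
  then have one: "measure D {..<w} = 1" if "0 < w" for w
    using that D.prob_le_1[of "{..<w}"] by (meson antisym not_less)
  have "(\<lambda>n. measure D {..<1 / real (Suc n)}) \<longlonglongrightarrow> measure D (\<Inter>n. {..<1 / real (Suc n)})"
    by (rule D.finite_Lim_measure_decseq) (auto simp: decseq_def intro: less_le_trans frac_le)
  then have "(\<lambda>n. 1 :: real) \<longlonglongrightarrow> measure D (\<Inter>n. {..<1 / real (Suc n)})"
    using one by simp
  then have "measure D (\<Inter>n. {..<1 / real (Suc n)}) = 1"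
    using LIMSEQ_unique tendsto_const by blast
  moreover have "(\<Inter>n. {..<1 / real (Suc n)}) = {..0}"
  proof (intro set_eqI iffI)
    fix x :: real assume x: "x \<in> (\<Inter>n. {..<1 / real (Suc n)})"
    show "x \<in> {..0}"
    proof (rule ccontr)
      assume "x \<notin> {..0}"
      then obtain n where "1 / real (Suc n) < x" using nat_approx_posE[of x] by (auto simp: not_le)
      moreover have "x < 1 / real (Suc n)" using x by blast
      ultimately show False by linarith
    qed
  next
    fix x :: real assume "x \<in> {..0}"
    then have "x < 1 / real (Suc n)" for n by (auto intro: le_less_trans)
    then show "x \<in> (\<Inter>n. {..<1 / real (Suc n)})" by blast
  qed
  ultimately have "prob {\<omega> \<in> space M. W 0 \<omega> \<in> {..0}} = 1" using measure_D[of "{..0}"] by simp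
  moreover have "{\<omega> \<in> space M. W 0 \<omega> \<in> {..0}} = {\<omega> \<in> space M. W 0 \<omega> = 0}"
    using nonneg[of _ 0] by (auto intro: antisym)
  ultimately show False using assms by simp
qed

lemma critical_value_finite:
  assumes "0 < lam" "0 < percolation_prob M W \<alpha> lam"
  shows "critical_value M W \<alpha> < \<infinity>"
proof -
  have "critical_value M W \<alpha> \<le> ereal lam"
    unfolding critical_value_def by (rule Inf_lower) (use assms in blast)
  then show ?thesis by (rule le_less_trans) simp
qed

lemma critical_value_infinite:
  assumes "\<And>lam. 0 < lam \<Longrightarrow> percolation_prob M W \<alpha> lam = 0"
  shows "critical_value M W \<alpha> = \<infinity>"
proof -
  have "{ereal lam |lam. lam > 0 \<and> percolation_prob M W \<alpha> lam > 0} = {}" using assms by fastforce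
  then show ?thesis unfolding critical_value_def by (simp only: Inf_empty top_ereal_def)
qed

end

theorem theorem3p1:
  fixes M :: "'a measure" and W :: "int ^ 'd \<Rightarrow> 'a \<Rightarrow> real" and F :: "real \<Rightarrow> real"
    and \<alpha> c \<tau> :: real
  assumes "prob_space M"
    and "prob_space.indep_vars M (\<lambda>_. borel) W UNIV"
    and "\<And>x. cdf (distr M borel (W x)) = F"
    and "\<And>x \<omega>. \<omega> \<in> space M \<Longrightarrow> W x \<omega> \<ge> 0"
    and "\<alpha> > real CARD('d)"
    and "c > 0" and "\<tau> > 1"
    and "tail_bound F c \<tau>"
    and "\<alpha> * (\<tau> - 1) / real CARD('d) > 1"
  shows "(CARD('d) \<ge> 2 \<and> measure M {\<omega> \<in> space M. W 0 \<omega> = 0} < 1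
            \<longrightarrow> critical_value M W \<alpha> < \<infinity>)
       \<and> (CARD('d) = 1 \<and> \<alpha> \<in> {1<..2} \<and> (\<exists>w>0. measure M {\<omega> \<in> space M. W 0 \<omega> \<ge> w} = 1)
            \<longrightarrow> critical_value M W \<alpha> < \<infinity>)
       \<and> (CARD('d) = 1 \<and> \<alpha> > 2 \<and>
            (\<exists>c'>0. \<exists>\<tau>'>1. tail_bound F c' \<tau>' \<and> \<alpha> * (\<tau>' - 1) / real CARD('d) > 2)
            \<longrightarrow> critical_value M W \<alpha> = \<infinity>)"
proof -
  let ?D = "distr M borel (W 0)"
  interpret iid_weights M W ?D by (rule iid_weights_distr[OF assms(1-4)])
  have \<alpha>: "0 < \<alpha>" using assms(5) by (rule le_less_trans[rotated]) simp
  show ?thesis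
  proof (intro conjI impI; elim conjE)
    assume "CARD('d) \<ge> 2" and zero: "measure M {\<omega> \<in> space M. W 0 \<omega> = 0} < 1"
    then have "1 < card (UNIV :: 'd set)" by simp
    then obtain i1 i2 :: 'd where "i1 \<noteq> i2"
      by (metis card_le_Suc0_iff_eq finite UNIV_I One_nat_def not_le)
    moreover obtain w where "0 < w" "measure ?D {..<w} < 1"
      using positive_weight_threshold[OF zero] by blast
    ultimately obtain lam where "0 < lam" "0 < percolation_prob M W \<alpha> lam"
      using percolation_plane_eventually[OF _ \<alpha>] by blast
    then show "critical_value M W \<alpha> < \<infinity>" by (rule critical_value_finite)
  next
    assume card: "CARD('d) = 1" and a: "\<alpha> \<in> {1<..2}" and "\<exists>w>0. measure M {\<omega> \<in> space M. W 0 \<omega> \<ge> w} = 1"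
    then obtain w where w: "0 < w" "measure M {\<omega> \<in> space M. W 0 \<omega> \<ge> w} = 1" by blast
    then have "measure ?D {w..} = 1" using measure_D[of "{w..}"] by simp
    (* This value of lam makes the parameter \<beta> of line_graph equal to 496. *)
    then have "0 < percolation_prob M W \<alpha> (496 / (w * w))"
      using a w by (intro percolation_line[OF card \<alpha> _ w(1)]) auto
    then show "critical_value M W \<alpha> < \<infinity>"
      using w(1) by (intro critical_value_finite[of "496 / (w * w)"]) auto
  next
    assume card: "CARD('d) = 1" and a: "\<alpha> > 2"
      and "\<exists>c'>0. \<exists>\<tau>'>1. tail_bound F c' \<tau>' \<and> \<alpha> * (\<tau>' - 1) / real CARD('d) > 2"
    then obtain c' \<tau>' where c': "0 < c'" "1 < \<tau>'" "tail_bound F c' \<tau>'" "2 < \<alpha> * (\<tau>' - 1)" by auto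
    (* An exponent in the nonempty interval between 2 / \<alpha> and min 1 (\<tau>' - 1). *)
    define s where "s = (2 / \<alpha> + min 1 (\<tau>' - 1)) / 2"
    have "2 / \<alpha> < min 1 (\<tau>' - 1)" using a c'(4) by (simp add: divide_less_eq mult.commute)
    then have s: "2 / \<alpha> < s" "s < 1" "s < \<tau>' - 1" unfolding s_def by auto
    have "0 < 2 / \<alpha>" using \<alpha> by simp
    then have s0: "0 < s" using s(1) by linarith
    have as: "2 < \<alpha> * s" using s(1) \<alpha> by (simp add: divide_less_eq mult.commute)
    have "measure ?D {w<..} \<le> c' * w powr (- (\<tau>' - 1))" if "0 < w" for w
      using c'(3) that unfolding tail_bound_def upper_tail_eq assms(3) by blast
    then have int: "integrable M (\<lambda>\<omega>. W x \<omega> powr s)" for x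
      using c'(1) s0 s(3) by (rule weight_moment)
    show "critical_value M W \<alpha> = \<infinity>"
      by (rule critical_value_infinite, rule no_percolation_line[OF card _ s0 _ as int]) (use s in auto)
  qed
qed

end
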